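(* Let $m\geq 3$. There does not exist any semi-parallel real hypersurface in the complex two-plane Grassmannian $G_2(\mathbb C_{m+2})$; that is, no connected oriented real hypersurface $M$ isometrically immersed in $G_2(\mathbb C_{m+2})$ has shape operator $A$ satisfying $R\cdot A=0$, where $R$ is the curvature tensor of $M$.
   Context: $G_2(\mathbb C_{m+2})$ is the set of complex two-dimensional linear subspaces of $\mathbb C^{m+2}$ (real dimension $4m$), a compact irreducible Riemannian symmetric space with metric $\langle\cdot,\cdot\rangle$, Kaehler structure $J$ and quaternionic Kaehler structure $\mathfrak J$ (a parallel rank-3 subbundle of the endomorphism bundle, not containing $J$). Under the identification $T_WG_2(\mathbb C_{m+2})=\mathrm{Hom}_{\mathbb C}(W,W^\perp)$, $J$ is multiplication by $i$ and $\mathfrak J_W=\{X\mapsto X\circ B: B\in\mathfrak{su}(W)\}$. A canonical local basis $\{J_1,J_2,J_3\}$ of $\mathfrak J$ consists of local almost Hermitian structures with $J_aJ_{a+1}=J_{a+2}=-J_{a+1}J_a$ (indices mod 3); one has $JJ_a=J_aJ$ and $\mathrm{Trace}(JJ_a)=0$. The metric is normalized so that the curvature tensor is $$\hat R(X,Y)Z=\langle Y,Z\rangle X-\langle X,Z\rangle Y+\langle JY,Z\rangle JX-\langle JX,Z\rangle JY-2\langle JX,Y\rangle JZ+\sum_{a=1}^3\{\langle J_aY,Z\rangle J_aX-\langle J_aX,Z\rangle J_aY-2\langle J_aX,Y\rangle J_aZ+\langle JJ_aY,Z\rangle JJ_aX-\langle JJ_aX,Z\rangle JJ_aY\}.$$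 A real hypersurface $M$ is a connected oriented manifold of real dimension $4m-1$ isometrically immersed in $G_2(\mathbb C_{m+2})$; $N$ is a unit normal vector field and $A$ the shape operator, $AX=-\hat\nabla_XN$, where $\hat\nabla$ is the Levi-Civita connection of $G_2(\mathbb C_{m+2})$. $M$ is semi-parallel if $R\cdot A=0$, i.e. $R(X,Y)(AZ)-A(R(X,Y)Z)=0$ for all tangent vectors $X,Y,Z$ of $M$. *)

theory Defs
  imports "HOL-Analysis.Analysis"
begin

subsection \<open>Smooth manifolds and maps\<close>

fun cont_diff_on ::
  "nat \<Rightarrow> 'a::euclidean_space set \<Rightarrow> ('a \<Rightarrow> 'b::real_normed_vector) \<Rightarrow> bool" where
  "cont_diff_on 0 S f \<longleftrightarrow> continuous_on S f"
| "cont_diff_on (Suc k) S f \<longleftrightarrow>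
     (\<forall>x\<in>S. f differentiable (at x)) \<and>
     (\<forall>v. cont_diff_on k S (\<lambda>x. frechet_derivative f (at x) v))"

text \<open>Only meant for open \<open>S\<close>, since the derivatives are taken in full neighbourhoods.\<close>

definition smooth_on ::
  "'a::euclidean_space set \<Rightarrow> ('a \<Rightarrow> 'b::real_normed_vector) \<Rightarrow> bool" where
  "smooth_on S f \<longleftrightarrow> (\<forall>k. cont_diff_on k S f)"

type_synonym ('p, 'e) chart = "'p set \<times> ('p \<Rightarrow> 'e)"

definition chart_inv :: "('p, 'e) chart \<Rightarrow> 'e \<Rightarrow> 'p" where
  "chart_inv c = inv_into (fst c) (snd c)"

text \<open>The coordinate expression of a map \<open>f\<close> with respect to a chart \<open>c\<close> of its
  domain and a chart \<open>d\<close> of its codomain, and the set on which it is meaningful.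
  For \<open>f = id\<close> these describe the transition map from \<open>c\<close> to \<open>d\<close>.\<close>

definition coord_dom ::
  "('p, 'a) chart \<Rightarrow> ('q, 'b) chart \<Rightarrow> ('p \<Rightarrow> 'q) \<Rightarrow> 'a set" where
  "coord_dom c d f = snd c ` (fst c \<inter> f -` fst d)"

definition coord_map ::
  "('p, 'a) chart \<Rightarrow> ('q, 'b) chart \<Rightarrow> ('p \<Rightarrow> 'q) \<Rightarrow> 'a \<Rightarrow> 'b" where
  "coord_map c d f = snd d \<circ> f \<circ> chart_inv c"

definition smooth_manifold ::
  "'p topology \<Rightarrow> ('p, 'e::euclidean_space) chart set \<Rightarrow> bool" where
  "smooth_manifold M \<A> \<longleftrightarrow>
     Hausdorff_space M \<and> second_countable M \<and>
     (\<Union>c\<in>\<A>. fst c) = topspace M \<and>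
     (\<forall>c\<in>\<A>. openin M (fst c) \<and> open (snd c ` fst c) \<and>
        homeomorphic_map (subtopology M (fst c)) (top_of_set (snd c ` fst c)) (snd c)) \<and>
     (\<forall>c\<in>\<A>. \<forall>d\<in>\<A>. smooth_on (coord_dom c d id) (coord_map c d id))"

definition oriented_atlas :: "('p, real^'d) chart set \<Rightarrow> bool" where
  "oriented_atlas \<A> \<longleftrightarrow>
     (\<forall>c\<in>\<A>. \<forall>d\<in>\<A>. \<forall>x\<in>coord_dom c d id.
        det (matrix (frechet_derivative (coord_map c d id) (at x))) > 0)"

definition smooth_immersion ::
  "'p topology \<Rightarrow> ('p, 'a::euclidean_space) chart set \<Rightarrow>
   'q topology \<Rightarrow> ('q, 'b::euclidean_space) chart set \<Rightarrow> ('p \<Rightarrow> 'q) \<Rightarrow> bool" where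
  "smooth_immersion M \<A> Q \<B> f \<longleftrightarrow>
     continuous_map M Q f \<and>
     (\<forall>c\<in>\<A>. \<forall>d\<in>\<B>. smooth_on (coord_dom c d f) (coord_map c d f) \<and>
        (\<forall>x\<in>coord_dom c d f. inj (frechet_derivative (coord_map c d f) (at x))))"


subsection \<open>Local Riemannian geometry\<close>

text \<open>A local metric \<open>g x u v\<close> is the inner product of the coordinate vectors \<open>u\<close> and
  \<open>v\<close> at the point with coordinates \<open>x\<close>. The Christoffel map \<open>\<Gamma>\<^sub>x(u, v)\<close> of
  the Levi-Civita connection is given by Koszul's formula for constant coordinate fields.\<close>

definition christoffel ::
  "('e \<Rightarrow> 'e \<Rightarrow> 'e \<Rightarrow> real) \<Rightarrow> 'e::euclidean_space \<Rightarrow> 'e \<Rightarrow> 'e \<Rightarrow> 'e" where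
  "christoffel g x u v = (THE w. \<forall>z. 2 * g x w z =
       frechet_derivative (\<lambda>y. g y v z) (at x) u
     + frechet_derivative (\<lambda>y. g y u z) (at x) v
     - frechet_derivative (\<lambda>y. g y u v) (at x) z)"

text \<open>Levi-Civita covariant derivative, in the direction \<open>u\<close> at \<open>x\<close>, of a vector field
  \<open>\<xi>\<close> along a map \<open>h\<close>.\<close>

definition cov_deriv_along ::
  "('b \<Rightarrow> 'b \<Rightarrow> 'b \<Rightarrow> real) \<Rightarrow> ('a::euclidean_space \<Rightarrow> 'b::euclidean_space) \<Rightarrow>
   ('a \<Rightarrow> 'b) \<Rightarrow> 'a \<Rightarrow> 'a \<Rightarrow> 'b" where
  "cov_deriv_along g h \<xi> x u =
     frechet_derivative \<xi> (at x) u
     + christoffel g (h x) (frechet_derivative h (at x) u) (\<xi> x)"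

text \<open>\<open>R(u,v)w = \<nabla>\<^sub>u \<nabla>\<^sub>v w - \<nabla>\<^sub>v \<nabla>\<^sub>u w\<close>, where \<open>u\<close>, \<open>v\<close>, \<open>w\<close> are
  extended to constant (hence commuting) coordinate fields.\<close>

definition riemann_curvature ::
  "('e \<Rightarrow> 'e \<Rightarrow> 'e \<Rightarrow> real) \<Rightarrow> 'e::euclidean_space \<Rightarrow> 'e \<Rightarrow> 'e \<Rightarrow> 'e \<Rightarrow> 'e" where
  "riemann_curvature g x u v w =
     cov_deriv_along g (\<lambda>y. y) (\<lambda>y. cov_deriv_along g (\<lambda>y. y) (\<lambda>_. w) y v) x u
   - cov_deriv_along g (\<lambda>y. y) (\<lambda>y. cov_deriv_along g (\<lambda>y. y) (\<lambda>_. w) y u) x v"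


subsection \<open>Hypersurfaces in a Riemannian manifold\<close>

text \<open>A Riemannian metric on a manifold is represented by its local expressions \<open>g c\<close> in
  the charts \<open>c\<close> of the atlas.\<close>

type_synonym ('p, 'e) metric = "('p, 'e) chart \<Rightarrow> 'e \<Rightarrow> 'e \<Rightarrow> 'e \<Rightarrow> real"

definition isometric_immersion ::
  "'p topology \<Rightarrow> ('p, 'a::euclidean_space) chart set \<Rightarrow> ('p, 'a) metric \<Rightarrow>
   'q topology \<Rightarrow> ('q, 'b::euclidean_space) chart set \<Rightarrow> ('q, 'b) metric \<Rightarrow>
   ('p \<Rightarrow> 'q) \<Rightarrow> bool" where
  "isometric_immersion M \<A> g Q \<B> G f \<longleftrightarrow>
     smooth_immersion M \<A> Q \<B> f \<and>
     (\<forall>c\<in>\<A>. \<forall>d\<in>\<B>. \<forall>x\<in>coord_dom c d f. \<forall>u v.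
        g c x u v = G d (coord_map c d f x)
          (frechet_derivative (coord_map c d f) (at x) u)
          (frechet_derivative (coord_map c d f) (at x) v))"

text \<open>A vector field \<open>N\<close> along \<open>f\<close> is represented by the coordinate vectors \<open>N d p\<close>
  of its values \<open>N\<^sub>p\<close> in the charts \<open>d\<close> of the codomain; in coordinates it is the
  following map.\<close>

definition field_coord ::
  "('p, 'a) chart \<Rightarrow> ('q, 'b) chart \<Rightarrow> (('q, 'b) chart \<Rightarrow> 'p \<Rightarrow> 'b) \<Rightarrow> 'a \<Rightarrow> 'b" where
  "field_coord c d N = N d \<circ> chart_inv c"

definition smooth_field_along ::
  "'p topology \<Rightarrow> ('p, 'a::euclidean_space) chart set \<Rightarrow>
   ('q, 'b::euclidean_space) chart set \<Rightarrow> ('p \<Rightarrow> 'q) \<Rightarrow>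
   (('q, 'b) chart \<Rightarrow> 'p \<Rightarrow> 'b) \<Rightarrow> bool" where
  "smooth_field_along M \<A> \<B> f N \<longleftrightarrow>
     (\<forall>d\<in>\<B>. \<forall>d'\<in>\<B>. \<forall>p\<in>topspace M. f p \<in> fst d \<inter> fst d' \<longrightarrow>
        N d' p = frechet_derivative (coord_map d d' id) (at (snd d (f p))) (N d p)) \<and>
     (\<forall>c\<in>\<A>. \<forall>d\<in>\<B>. smooth_on (coord_dom c d f) (field_coord c d N))"

definition unit_normal_field ::
  "'p topology \<Rightarrow> ('p, 'a::euclidean_space) chart set \<Rightarrow>
   ('q, 'b::euclidean_space) chart set \<Rightarrow> ('q, 'b) metric \<Rightarrow> ('p \<Rightarrow> 'q) \<Rightarrow>
   (('q, 'b) chart \<Rightarrow> 'p \<Rightarrow> 'b) \<Rightarrow> bool" where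
  "unit_normal_field M \<A> \<B> G f N \<longleftrightarrow>
     smooth_field_along M \<A> \<B> f N \<and>
     (\<forall>c\<in>\<A>. \<forall>d\<in>\<B>. \<forall>x\<in>coord_dom c d f.
        G d (coord_map c d f x) (field_coord c d N x) (field_coord c d N x) = 1 \<and>
        (\<forall>u. G d (coord_map c d f x) (field_coord c d N x)
                (frechet_derivative (coord_map c d f) (at x) u) = 0))"

text \<open>The shape operator \<open>A u = - \<nabla>\<^sub>u N\<close>, where the right-hand side, which is tangent to
  the hypersurface, is identified with a tangent vector of \<open>M\<close> through the differential of
  the immersion.\<close>

definition shape_operator ::
  "('q, 'b::euclidean_space) metric \<Rightarrow> ('p \<Rightarrow> 'q) \<Rightarrow> (('q, 'b) chart \<Rightarrow> 'p \<Rightarrow> 'b) \<Rightarrow>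
   ('p, 'a::euclidean_space) chart \<Rightarrow> ('q, 'b) chart \<Rightarrow> 'a \<Rightarrow> 'a \<Rightarrow> 'a" where
  "shape_operator G f N c d x u = (THE w.
     frechet_derivative (coord_map c d f) (at x) w =
       - cov_deriv_along (G d) (coord_map c d f) (field_coord c d N) x u)"

definition semi_parallel ::
  "('p, 'a::euclidean_space) chart set \<Rightarrow> ('p, 'a) metric \<Rightarrow>
   ('q, 'b::euclidean_space) chart set \<Rightarrow> ('q, 'b) metric \<Rightarrow>
   ('p \<Rightarrow> 'q) \<Rightarrow> (('q, 'b) chart \<Rightarrow> 'p \<Rightarrow> 'b) \<Rightarrow> bool" where
  "semi_parallel \<A> g \<B> G f N \<longleftrightarrow>
     (\<forall>c\<in>\<A>. \<forall>d\<in>\<B>. \<forall>x\<in>coord_dom c d f. \<forall>u v w.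
        riemann_curvature (g c) x u v (shape_operator G f N c d x w)
        - shape_operator G f N c d x (riemann_curvature (g c) x u v w) = 0)"


subsection \<open>The complex two-plane Grassmannian\<close>

definition hinner :: "complex^'n \<Rightarrow> complex^'n \<Rightarrow> complex" where
  "hinner x y = (\<Sum>i\<in>UNIV. x $ i * cnj (y $ i))"

definition conj_transpose :: "complex^'n^'k \<Rightarrow> complex^'k^'n" where
  "conj_transpose X = (\<chi> i j. cnj (X $ j $ i))"

definition orth_proj :: "(complex^'n) set \<Rightarrow> complex^'n \<Rightarrow> complex^'n" where
  "orth_proj W x = (THE y. y \<in> W \<and> (\<forall>w\<in>W. hinner (x - y) w = 0))"

definition proj_matrix :: "(complex^'n) set \<Rightarrow> complex^'n^'n" where
  "proj_matrix W = matrix (orth_proj W)"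

definition G2 :: "(complex^'n) set set" where
  "G2 = {W. vec.subspace W \<and> vec.dim W = 2}"

definition G2_topology :: "(complex^'n) set topology" where
  "G2_topology = pullback_topology G2 proj_matrix euclidean"

text \<open>Affine charts: for a basis of \<open>\<complex>\<^sup>n\<close>, \<open>n = m + 2\<close>, given by the columns of the
  blocks \<open>B\<close> (two columns) and \<open>C\<close> (\<open>m\<close> columns), the \<open>m \<times> 2\<close> matrix \<open>Z\<close>
  is the coordinate of the column space of \<open>B + C Z\<close>.\<close>

definition complementary_frames :: "complex^2^'n \<Rightarrow> complex^'m^'n \<Rightarrow> bool" where
  "complementary_frames B C \<longleftrightarrow> bij (\<lambda>(x, y). B *v x + C *v y)"

definition G2_param ::
  "complex^2^'n \<Rightarrow> complex^'m^'n \<Rightarrow> complex^2^'m \<Rightarrow> (complex^'n) set" where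
  "G2_param B C Z = range (\<lambda>x. (B + C ** Z) *v x)"

definition G2_atlas :: "((complex^'n) set, complex^2^'m) chart set" where
  "G2_atlas = {(range (G2_param B C), inv (G2_param B C)) | B C. complementary_frames B C}"

text \<open>The identification of tangent vectors at \<open>W\<close> with complex linear maps
  \<open>W \<rightarrow> W\<^sup>\<bottom>\<close>: a vector with coordinates \<open>u\<close>
  in the chart \<open>d\<close> corresponds to the map sending \<open>w \<in> W\<close> to the component in
  \<open>W\<^sup>\<bottom>\<close> of \<open>w'(0)\<close>, for any curve \<open>w(t) \<in> W(t)\<close> with \<open>w(0) = w\<close> and
  \<open>W'(0) = u\<close>. If \<open>P(t)\<close> is the orthogonal projection onto \<open>W(t)\<close>, this map is the
  restriction of \<open>P'(0)\<close> to \<open>W\<close>. Here it is extended by zero on \<open>W\<^sup>\<bottom>\<close>.\<close>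

definition tangent_hom ::
  "((complex^'n) set, complex^2^'m) chart \<Rightarrow> complex^2^'m \<Rightarrow> complex^2^'m \<Rightarrow> complex^'n^'n" where
  "tangent_hom d z u =
     frechet_derivative (\<lambda>y. proj_matrix (chart_inv d y)) (at z) u ** proj_matrix (chart_inv d z)"

text \<open>The invariant metric \<open>\<langle>X,Y\<rangle> = Re tr (X\<^sup>* Y) / 2\<close> on \<open>Hom(W, W\<^sup>\<bottom>)\<close>.
  Its curvature tensor is
  \<open>R(X,Y)Z = X Y\<^sup>* Z + Z Y\<^sup>* X - Y X\<^sup>* Z - Z X\<^sup>* Y\<close>. The factor \<open>1/2\<close> is the
  one for which this equals, with \<open>J\<close> the multiplication by \<open>\<i>\<close> and \<open>J\<^sub>1, J\<^sub>2, J\<^sub>3\<close> a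
  canonical basis of \<open>{X \<mapsto> X \<circ> B | B \<in> su(W)}\<close>,
  \<open>\<langle>Y,Z\<rangle>X - \<langle>X,Z\<rangle>Y + \<langle>JY,Z\<rangle>JX - \<langle>JX,Z\<rangle>JY - 2\<langle>JX,Y\<rangle>JZ +
   \<Sum>\<^sub>a (\<langle>J\<^sub>aY,Z\<rangle>J\<^sub>aX - \<langle>J\<^sub>aX,Z\<rangle>J\<^sub>aY - 2\<langle>J\<^sub>aX,Y\<rangle>J\<^sub>aZ + \<langle>JJ\<^sub>aY,Z\<rangle>JJ\<^sub>aX - \<langle>JJ\<^sub>aX,Z\<rangle>JJ\<^sub>aY)\<close>;
  in particular the maximal sectional curvature is 8.\<close>

definition G2_metric :: "((complex^'n) set, complex^2^'m) metric" where
  "G2_metric d z u v =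
     Re (trace (conj_transpose (tangent_hom d z u) ** tangent_hom d z v)) / 2"

definition real_hypersurface_G2 ::
  "'p topology \<Rightarrow> ('p, real^'d) chart set \<Rightarrow> ('p, real^'d) metric \<Rightarrow>
   ('p \<Rightarrow> (complex^'n) set) \<Rightarrow>
   (((complex^'n) set, complex^2^'m) chart \<Rightarrow> 'p \<Rightarrow> complex^2^'m) \<Rightarrow> bool" where
  "real_hypersurface_G2 M \<A> g f N \<longleftrightarrow>
     smooth_manifold M \<A> \<and> topspace M \<noteq> {} \<and> connected_space M \<and> oriented_atlas \<A> \<and>
     isometric_immersion M \<A> g G2_topology
       (G2_atlas :: ((complex^'n) set, complex^2^'m) chart set) G2_metric f \<and>
     unit_normal_field M \<A> G2_atlas G2_metric f N"

end

theory Submission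
  imports Defs
begin

text \<open>In the affine chart of a unitary frame the metric is
  \<open>Re tr (K U\<^sup>* S V) / 2\<close> with \<open>K = (1 + Z\<^sup>* Z)\<^sup>-\<^sup>1\<close> and \<open>S = (1 + Z Z\<^sup>*)\<^sup>-\<^sup>1\<close>. Writing
  \<open>K = b b\<^sup>*\<close> and \<open>S = a\<^sup>* a\<close>, the map \<open>X \<mapsto> a X b\<close> turns metric and curvature at \<open>Z\<close> into those at
  the centre of the chart, where the curvature operator of \<open>X\<close> and \<open>Y\<close> is \<open>Z \<mapsto> \<alpha> Z + Z \<beta>\<close> with
  \<open>\<alpha> = X Y\<^sup>* - Y X\<^sup>*\<close>, \<open>\<beta> = Y\<^sup>* X - X\<^sup>* Y\<close>.

  By the Gauss equation, if \<open>X\<close> and \<open>Y\<close> are principal vectors with different principal curvatures,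
  then semi-parallelism makes this operator a multiple of \<open>X \<and> Y\<close> up to terms in the direction of
  the normal \<open>N\<close>, so its real rank is at most \<open>4\<close>. For \<open>m \<ge> 3\<close> this forces \<open>\<alpha> = 0\<close> and \<open>\<beta> = 0\<close>, and
  the product of the two principal curvatures vanishes. So there are at most two principal curvatures.
  If there were two, the isotropy algebra would map each principal distribution into its sum with the
  span of \<open>N\<close>; the distribution not containing \<open>\<i> N\<close> would be complex and invariant under the isotropy
  algebra, contradicting irreducibility. Hence the hypersurface is totally umbilic, which the Codazzi
  equation excludes.\<close>

subsection \<open>Iterated derivatives\<close>

text \<open>The Gauss equation leaves the normal component of the ambient curvature free, so every
  identity drawn from semi-parallelism holds only modulo \<open>N\<close>. Hence the rank bound 4,
  from \<open>X\<close>, \<open>Y\<close>, \<open>N\<close> and the image of \<open>N\<close>. It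
  must be smaller than 2m, the real dimension of the rank-one matrices with a fixed row vector; for
  m = 2 the two numbers coincide. The condition m \<ge> 3 also supplies a vector orthogonal to both
  columns of \<open>N\<close> for the Codazzi step. The normal direction is an obstacle again in the
  irreducibility argument, where a skew matrix might push a distribution into \<open>N\<close>;
  multiplying by \<i> turns the pairing with \<open>N\<close> into a pairing with
  \<i>\<open>N\<close>, which lies in the other distribution. On the analytic side, the Christoffel
  map of the induced metric is given by a description and the principal curvature by a pointwise
  choice. Their differentiability is recovered from a linear system and from a quotient that they
  satisfy. The connection of the Grassmannian is stated in closed form and verified.\<close>

abbreviation dirderiv ("\<partial>") where
  "\<partial> f v \<equiv> \<lambda>x. frechet_derivative f (at x) v"

lemma smooth_on_dirderiv: "smooth_on S f \<Longrightarrow> smooth_on S (\<partial> f v)"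
  unfolding smooth_on_def by (metis cont_diff_on.simps(2))

lemma smooth_on_differentiable: "smooth_on S f \<Longrightarrow> x \<in> S \<Longrightarrow> f differentiable (at x)"
  unfolding smooth_on_def by (metis cont_diff_on.simps(2))

lemma smooth_on_continuous: "smooth_on S f \<Longrightarrow> continuous_on S f"
  unfolding smooth_on_def by (metis cont_diff_on.simps(1))

lemma frechet_derivative_cong_open:
  assumes "open S" "x \<in> S" "\<And>y. y \<in> S \<Longrightarrow> f y = g y"
  shows "frechet_derivative f (at x) = frechet_derivative g (at x)"
proof -
  have "(f has_derivative D) (at x) \<longleftrightarrow> (g has_derivative D) (at x)" for D
    using has_derivative_transform_within_open[OF _ assms(1,2), of f D UNIV g]
      has_derivative_transform_within_open[OF _ assms(1,2), of g D UNIV f] assms(3) by auto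
  then show ?thesis by (simp add: frechet_derivative_def)
qed

lemma differentiable_cong_open:
  assumes "open S" "x \<in> S" "\<And>y. y \<in> S \<Longrightarrow> f y = g y" "g differentiable (at x)"
  shows "f differentiable (at x)"
  using assms(4) has_derivative_transform_within_open[OF _ assms(1,2), of g _ UNIV f] assms(3)
  unfolding differentiable_def by auto

section \<open>Symmetry of mixed second derivatives\<close>

lemma frechet_derivative_inner_left:
  assumes "f differentiable (at x)"
  shows "frechet_derivative (\<lambda>y. inner (f y) e) (at x) v = inner (frechet_derivative f (at x) v) e"
proof -
  have "(f has_derivative frechet_derivative f (at x)) (at x)"
    using assms frechet_derivative_works by blast
  then have "((\<lambda>y. inner (f y) e) has_derivative (\<lambda>v. inner (frechet_derivative f (at x) v) e)) (at x)"
    by (rule has_derivative_inner_left)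
  then show ?thesis by (simp add: frechet_derivative_at[symmetric])
qed

text \<open>The mean value theorem is applied twice: in direction \<open>u\<close> to the increment
  over \<open>s *\<^sub>R v\<close>, then in direction \<open>v\<close> to \<partial>
  \<open>f u\<close>. The left side of the identity is symmetric in \<open>u\<close> and
  \<open>v\<close>, so exchanging them compares the two mixed derivatives at nearby points.\<close>

lemma second_difference:
  fixes f :: "'a::euclidean_space \<Rightarrow> real"
  assumes s: "s > 0"
    and seg: "\<And>a b. 0 \<le> a \<Longrightarrow> a \<le> s \<Longrightarrow> 0 \<le> b \<Longrightarrow> b \<le> s \<Longrightarrow> x + a *\<^sub>R u + b *\<^sub>R v \<in> S"
    and f: "\<And>y. y \<in> S \<Longrightarrow> f differentiable (at y)"
    and f': "\<And>y. y \<in> S \<Longrightarrow> \<partial> f u differentiable (at y)"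
  shows "\<exists>\<xi> \<eta>. 0 < \<xi> \<and> \<xi> < s \<and> 0 < \<eta> \<and> \<eta> < s \<and>
    f (x + s *\<^sub>R u + s *\<^sub>R v) - f (x + s *\<^sub>R u) - f (x + s *\<^sub>R v) + f x
      = s * s * \<partial> (\<partial> f u) v (x + \<xi> *\<^sub>R u + \<eta> *\<^sub>R v)"
proof -
  have along: "((\<lambda>t. g (c + t *\<^sub>R w)) has_real_derivative \<partial> g w (c + t *\<^sub>R w)) (at t)"
    if "g differentiable (at (c + t *\<^sub>R w))" for g :: "'a \<Rightarrow> real" and c w t
  proof -
    let ?D = "frechet_derivative g (at (c + t *\<^sub>R w))"
    have 1: "(g has_derivative ?D) (at (c + t *\<^sub>R w))"
      using that frechet_derivative_works by blast
    have "((\<lambda>t. g (c + t *\<^sub>R w)) has_derivative (\<lambda>h. ?D (h *\<^sub>R w))) (at t)"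
    proof (rule has_derivative_compose[of "\<lambda>t. c + t *\<^sub>R w" "\<lambda>h. h *\<^sub>R w" t UNIV g ?D, OF _ 1])
      show "((\<lambda>t. c + t *\<^sub>R w) has_derivative (\<lambda>h. h *\<^sub>R w)) (at t)"
        by (auto intro!: derivative_eq_intros)
    qed
    moreover have "(\<lambda>h. ?D (h *\<^sub>R w)) = (*) (?D w)"
      using linear_scale[OF linear_frechet_derivative[OF that]] by (simp add: fun_eq_iff)
    ultimately show ?thesis
      unfolding has_field_derivative_def by simp
  qed
  define G where "G a = f (x + s *\<^sub>R v + a *\<^sub>R u) - f (x + a *\<^sub>R u)" for a
  have "\<exists>z. 0 < z \<and> z < s \<and> G s - G 0 = (s - 0) * (\<partial> f u (x + s *\<^sub>R v + z *\<^sub>R u) - \<partial> f u (x + z *\<^sub>R u))"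
  proof (rule MVT2[OF s])
    fix a assume a: "0 \<le> a" "a \<le> s"
    have "x + s *\<^sub>R v + a *\<^sub>R u \<in> S" "x + a *\<^sub>R u \<in> S"
      using seg[OF a, of s] seg[OF a, of 0] s by (auto simp: algebra_simps)
    then show "(G has_real_derivative (\<partial> f u (x + s *\<^sub>R v + a *\<^sub>R u) - \<partial> f u (x + a *\<^sub>R u))) (at a)"
      unfolding G_def by (intro DERIV_diff along f)
  qed
  then obtain \<xi> where \<xi>: "0 < \<xi>" "\<xi> < s"
    and 1: "G s - G 0 = s * (\<partial> f u (x + s *\<^sub>R v + \<xi> *\<^sub>R u) - \<partial> f u (x + \<xi> *\<^sub>R u))" by auto
  have "\<exists>z. 0 < z \<and> z < s \<and> \<partial> f u (x + \<xi> *\<^sub>R u + s *\<^sub>R v) - \<partial> f u (x + \<xi> *\<^sub>R u + 0 *\<^sub>R v)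
      = (s - 0) * \<partial> (\<partial> f u) v (x + \<xi> *\<^sub>R u + z *\<^sub>R v)"
  proof (rule MVT2[OF s])
    fix b assume "0 \<le> b" "b \<le> s"
    then have "x + \<xi> *\<^sub>R u + b *\<^sub>R v \<in> S"
      using seg[of \<xi> b] \<xi> by simp
    then show "((\<lambda>b. \<partial> f u (x + \<xi> *\<^sub>R u + b *\<^sub>R v)) has_real_derivative
        \<partial> (\<partial> f u) v (x + \<xi> *\<^sub>R u + b *\<^sub>R v)) (at b)"
      using along[of "\<partial> f u"] f' by blast
  qed
  then obtain \<eta> where \<eta>: "0 < \<eta>" "\<eta> < s"
    and 2: "\<partial> f u (x + \<xi> *\<^sub>R u + s *\<^sub>R v) - \<partial> f u (x + \<xi> *\<^sub>R u)
      = s * \<partial> (\<partial> f u) v (x + \<xi> *\<^sub>R u + \<eta> *\<^sub>R v)" by auto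
  have "f (x + s *\<^sub>R u + s *\<^sub>R v) - f (x + s *\<^sub>R u) - f (x + s *\<^sub>R v) + f x = G s - G 0"
    by (simp add: G_def algebra_simps)
  also have "\<dots> = s * s * \<partial> (\<partial> f u) v (x + \<xi> *\<^sub>R u + \<eta> *\<^sub>R v)"
    using 1 2 by (simp add: algebra_simps)
  finally show ?thesis using \<xi> \<eta> by blast
qed

lemma mixed_derivatives_commute_real:
  fixes f :: "'a::euclidean_space \<Rightarrow> real"
  assumes S: "open S" "x \<in> S" and f: "smooth_on S f"
  shows "\<partial> (\<partial> f u) v x = \<partial> (\<partial> f v) u x"
proof (rule ccontr)
  assume ne: "\<not> ?thesis"
  \<comment> \<open>Half the supposed gap: both mixed derivatives take a common value at points
    where each is within \<open>e\<close> of its value at \<open>x\<close>, so the gap would be less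
    than \<open>2 * e\<close>.\<close>
  define e where "e = \<bar>\<partial> (\<partial> f u) v x - \<partial> (\<partial> f v) u x\<bar> / 2"
  have e: "e > 0" using ne by (simp add: e_def)
  have cont: "isCont (\<partial> (\<partial> f a) b) x" for a b
    using f S continuous_on_eq_continuous_at smooth_on_continuous smooth_on_dirderiv by metis
  obtain d1 where d1: "d1 > 0" "\<And>y. dist y x < d1 \<Longrightarrow> dist (\<partial> (\<partial> f u) v y) (\<partial> (\<partial> f u) v x) < e"
    using cont[of u v] e unfolding continuous_at_eps_delta dist_norm by auto
  obtain d2 where d2: "d2 > 0" "\<And>y. dist y x < d2 \<Longrightarrow> dist (\<partial> (\<partial> f v) u y) (\<partial> (\<partial> f v) u x) < e"
    using cont[of v u] e unfolding continuous_at_eps_delta dist_norm by auto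
  obtain d3 where d3: "d3 > 0" "\<And>y. dist y x < d3 \<Longrightarrow> y \<in> S"
    using S open_dist by blast
  define d where "d = min d1 (min d2 d3)"
  \<comment> \<open>The parallelogram with sides \<open>s *\<^sub>R u\<close> and
    \<open>s *\<^sub>R v\<close> then stays within distance \<open>d / 2\<close> of
    \<open>x\<close>; the summand 1 keeps the denominator positive when \<open>u\<close> and
    \<open>v\<close> vanish.\<close>
  define s where "s = d / (2 * (norm u + norm v + 1))"
  have d: "d > 0" using d1 d2 d3 by (simp add: d_def)
  have s: "s > 0" using d by (simp add: s_def add_nonneg_pos)
  have near: "dist (x + a *\<^sub>R u + b *\<^sub>R v) x < d" if "0 \<le> a" "a \<le> s" "0 \<le> b" "b \<le> s" for a b
  proof -
    have "dist (x + a *\<^sub>R u + b *\<^sub>R v) x \<le> a * norm u + b * norm v"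
      using that norm_triangle_ineq[of "a *\<^sub>R u" "b *\<^sub>R v"] by (simp add: dist_norm add.assoc)
    also have "\<dots> \<le> s * norm u + s * norm v"
      using that by (intro add_mono mult_right_mono) auto
    also have "\<dots> \<le> s * (norm u + norm v + 1)" using s by (simp add: algebra_simps)
    also have "\<dots> = d / 2"
      unfolding s_def using add_nonneg_pos[of "norm u + norm v" 1] by (simp add: field_simps)
    also have "\<dots> < d" using d by simp
    finally show ?thesis .
  qed
  have near': "dist (x + a *\<^sub>R v + b *\<^sub>R u) x < d" if "0 \<le> a" "a \<le> s" "0 \<le> b" "b \<le> s" for a b
    using near[of b a] that by (simp add: algebra_simps)
  have fd: "f differentiable (at y)" "\<partial> f w differentiable (at y)" if "y \<in> S" for y w
    using f that smooth_on_differentiable smooth_on_dirderiv by blast+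
  obtain \<xi> \<eta> where 1: "0 < \<xi>" "\<xi> < s" "0 < \<eta>" "\<eta> < s"
    and e1: "f (x + s *\<^sub>R u + s *\<^sub>R v) - f (x + s *\<^sub>R u) - f (x + s *\<^sub>R v) + f x
      = s * s * \<partial> (\<partial> f u) v (x + \<xi> *\<^sub>R u + \<eta> *\<^sub>R v)"
    using second_difference[of s x u v S f] s near d3 fd by (auto simp: d_def)
  obtain \<xi>' \<eta>' where 2: "0 < \<xi>'" "\<xi>' < s" "0 < \<eta>'" "\<eta>' < s"
    and e2: "f (x + s *\<^sub>R v + s *\<^sub>R u) - f (x + s *\<^sub>R v) - f (x + s *\<^sub>R u) + f x
      = s * s * \<partial> (\<partial> f v) u (x + \<xi>' *\<^sub>R v + \<eta>' *\<^sub>R u)"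
    using second_difference[of s x v u S f] s near' d3 fd by (auto simp: d_def)
  have "s * s * \<partial> (\<partial> f u) v (x + \<xi> *\<^sub>R u + \<eta> *\<^sub>R v) = s * s * \<partial> (\<partial> f v) u (x + \<xi>' *\<^sub>R v + \<eta>' *\<^sub>R u)"
    using e1 e2 by (simp add: algebra_simps)
  then have "\<partial> (\<partial> f u) v (x + \<xi> *\<^sub>R u + \<eta> *\<^sub>R v) = \<partial> (\<partial> f v) u (x + \<xi>' *\<^sub>R v + \<eta>' *\<^sub>R u)"
    using s by simp
  moreover have "dist (\<partial> (\<partial> f u) v (x + \<xi> *\<^sub>R u + \<eta> *\<^sub>R v)) (\<partial> (\<partial> f u) v x) < e"
    using near[of \<xi> \<eta>] 1 by (intro d1) (auto simp: d_def)
  moreover have "dist (\<partial> (\<partial> f v) u (x + \<xi>' *\<^sub>R v + \<eta>' *\<^sub>R u)) (\<partial> (\<partial> f v) u x) < e"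
    using near'[of \<xi>' \<eta>'] 2 by (intro d2) (auto simp: d_def)
  ultimately have "\<bar>\<partial> (\<partial> f u) v x - \<partial> (\<partial> f v) u x\<bar> < e + e"
    unfolding dist_real_def by linarith
  then show False
    by (simp add: e_def)
qed

lemma cont_diff_on_inner_left:
  assumes "open S" "cont_diff_on k S f"
  shows "cont_diff_on k S (\<lambda>x. inner (f x) e)"
  using assms(2)
proof (induction k arbitrary: f)
  case 0
  then show ?case by (auto intro!: continuous_intros)
next
  case (Suc k)
  have d: "(\<lambda>x. inner (f x) e) differentiable (at x)" if "x \<in> S" for x
  proof -
    have "(f has_derivative frechet_derivative f (at x)) (at x)"
      using Suc.prems that frechet_derivative_works by auto
    then show ?thesis using has_derivative_inner_left unfolding differentiable_def by blast
  qed
  have "cont_diff_on k S (\<partial> (\<lambda>x. inner (f x) e) v)" for v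
  proof -
    have eq: "\<partial> (\<lambda>x. inner (f x) e) v y = inner (\<partial> f v y) e" if "y \<in> S" for y
      using frechet_derivative_inner_left[of f y e v] Suc.prems that by simp
    \<comment> \<open>The two derivatives are known to agree only on \<open>S\<close>, so
      \<open>cont_diff_on\<close> has to be shown insensitive to changes outside the open set
      \<open>S\<close>.\<close>
    have cong: "cont_diff_on k S g" if "cont_diff_on k S h" "\<And>y. y \<in> S \<Longrightarrow> g y = h y"
      for g h :: "'a \<Rightarrow> real" and k
      using that
    proof (induction k arbitrary: g h)
      case 0
      then show ?case using continuous_on_cong[of S S g h] by simp
    next
      case (Suc k)
      have "\<partial> g v y = \<partial> h v y" if "y \<in> S" for v y
        using frechet_derivative_cong_open[OF assms(1) that Suc.prems(2)] by simp
      then show ?case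
        using Suc differentiable_cong_open[OF assms(1) _ Suc.prems(2)] by (auto intro: Suc.IH)
    qed
    show ?thesis
      using Suc cong[OF _ eq] by auto
  qed
  with d show ?case by simp
qed

lemma mixed_derivatives_commute:
  fixes f :: "'a::euclidean_space \<Rightarrow> 'b::euclidean_space"
  assumes S: "open S" "x \<in> S" and f: "smooth_on S f"
  shows "\<partial> (\<partial> f u) v x = \<partial> (\<partial> f v) u x"
proof (rule euclidean_eqI)
  fix e :: 'b
  have sm: "smooth_on S (\<lambda>y. inner (f y) e)"
    using f S cont_diff_on_inner_left unfolding smooth_on_def by blast
  have "inner (\<partial> (\<partial> f a) b x) e = \<partial> (\<partial> (\<lambda>y. inner (f y) e) a) b x" for a b
  proof -
    have "inner (\<partial> (\<partial> f a) b x) e = \<partial> (\<lambda>y. inner (\<partial> f a y) e) b x"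
      using frechet_derivative_inner_left smooth_on_differentiable smooth_on_dirderiv f S by metis
    also have "\<dots> = \<partial> (\<partial> (\<lambda>y. inner (f y) e) a) b x"
      using frechet_derivative_cong_open[OF S, of "\<lambda>y. inner (\<partial> f a y) e" "\<partial> (\<lambda>y. inner (f y) e) a"]
        frechet_derivative_inner_left[OF smooth_on_differentiable[OF f], of _ e a] by metis
    finally show ?thesis .
  qed
  then show "inner (\<partial> (\<partial> f u) v x) e = inner (\<partial> (\<partial> f v) u x) e"
    using mixed_derivatives_commute_real[OF S sm] by simp
qed

section \<open>Differentiability of solutions of linear systems\<close>

lemma differentiable_prod:
  fixes f :: "'i \<Rightarrow> 'a::real_normed_vector \<Rightarrow> 'b::real_normed_field"
  assumes "\<And>i. i \<in> I \<Longrightarrow> f i differentiable (at x)"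
  shows "(\<lambda>x. \<Prod>i\<in>I. f i x) differentiable (at x)"
  using assms by (induction I rule: infinite_finite_induct) (auto intro: differentiable_mult)

lemma differentiable_vec_lambda:
  fixes f :: "'i::finite \<Rightarrow> 'a::real_normed_vector \<Rightarrow> 'b::euclidean_space"
  assumes "\<And>i. f i differentiable (at x)"
  shows "(\<lambda>x. \<chi> i. f i x) differentiable (at x)"
proof -
  have "bounded_linear (axis i :: 'b \<Rightarrow> 'b^'i)" for i
    using linear_linear[of "axis i :: 'b \<Rightarrow> 'b^'i"] by (auto intro!: linearI simp: axis_def vec_eq_iff)
  then have "(\<lambda>x. axis i (f i x)) differentiable (at x)" for i
    using assms[of i] bounded_linear.has_derivative unfolding differentiable_def by blast
  then have "(\<lambda>x. \<Sum>i\<in>UNIV. axis i (f i x)) differentiable (at x)"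
    by simp
  moreover have "(\<Sum>i\<in>UNIV. axis i (f i x)) = (\<chi> i. f i x)" for x
    by (simp add: vec_eq_iff axis_def if_distrib[of "\<lambda>c. _ * c"] sum.delta cong: if_cong)
  ultimately show ?thesis by simp
qed

lemma differentiable_vec_nth:
  fixes f :: "'a::real_normed_vector \<Rightarrow> 'b::euclidean_space^'i::finite"
  assumes "f differentiable (at x)"
  shows "(\<lambda>x. f x $ i) differentiable (at x)"
  using assms bounded_linear.has_derivative[OF bounded_linear_vec_nth] unfolding differentiable_def by blast

lemma differentiable_det:
  fixes M :: "'e::real_normed_vector \<Rightarrow> 'a::{real_normed_field,euclidean_space}^'k^'k"
  assumes "\<And>i j. (\<lambda>x. M x $ i $ j) differentiable (at x)"
  shows "(\<lambda>x. det (M x)) differentiable (at x)"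
proof -
  have "(\<lambda>x. \<Prod>i\<in>UNIV. M x $ i $ p i) differentiable (at x)" for p
    using differentiable_prod[of UNIV "\<lambda>i x. M x $ i $ p i"] assms by blast
  then show ?thesis
    unfolding det_def by (intro differentiable_sum differentiable_mult differentiable_const finite_permutations) auto
qed

text \<open>By Cramer's rule.\<close>

lemma differentiable_linear_solution:
  fixes M :: "'e::real_normed_vector \<Rightarrow> 'a::{real_normed_field,euclidean_space}^'k^'k"
  assumes S: "open S" "x \<in> S"
    and M: "M differentiable (at x)" and b: "b differentiable (at x)"
    and det: "det (M x) \<noteq> 0"
    and w: "\<And>y. y \<in> S \<Longrightarrow> M y *v w y = b y"
  shows "w differentiable (at x)"
proof -
  have Mij: "(\<lambda>x. M x $ i $ j) differentiable (at x)" for i j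
    by (intro differentiable_vec_nth M)
  have bi: "(\<lambda>x. b x $ i) differentiable (at x)" for i
    by (intro differentiable_vec_nth b)
  have dM: "(\<lambda>x. det (M x)) differentiable (at x)"
    by (intro differentiable_det Mij)
  define N where "N k y = (\<chi> i j. if j = k then b y $ i else M y $ i $ j)" for k y
  have dN: "(\<lambda>x. det (N k x)) differentiable (at x)" for k
  proof (rule differentiable_det)
    show "(\<lambda>x. N k x $ i $ j) differentiable (at x)" for i j
      using Mij bi by (cases "j = k") (simp_all add: N_def)
  qed
  have "isCont (\<lambda>x. det (M x)) x"
    using dM differentiable_imp_continuous_within by blast
  then have "eventually (\<lambda>y. det (M y) \<noteq> 0) (nhds x)"
    using det continuous_at_avoid[of x "\<lambda>x. det (M x)" 0] unfolding eventually_nhds_metric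
    by (metis dist_commute)
  then obtain T where T: "open T" "x \<in> T" "\<And>y. y \<in> T \<Longrightarrow> det (M y) \<noteq> 0"
    unfolding eventually_nhds by blast
  have "w y = (\<chi> k. det (N k y) / det (M y))" if "y \<in> S \<inter> T" for y
    using that w T cramer[of "M y" "w y" "b y"] by (auto simp: N_def)
  moreover have "(\<lambda>y. \<chi> k. det (N k y) / det (M y)) differentiable (at x)"
    using dM dN det by (intro differentiable_vec_lambda differentiable_divide) auto
  ultimately show ?thesis
    using S T by (intro differentiable_cong_open[of "S \<inter> T" x w]) auto
qed

subsection \<open>Complex matrices and unitary frames\<close>

notation conj_transpose ("_\<^sup>\<dagger>" [1000] 1000)

lemma conj_transpose_nth [simp]: "X\<^sup>\<dagger> $ i $ j = cnj (X $ j $ i)"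
  by (simp add: conj_transpose_def)

lemma conj_transpose_idem [simp]: "X\<^sup>\<dagger>\<^sup>\<dagger> = X"
  by (simp add: vec_eq_iff)

lemma conj_transpose_mult: "(X ** Y)\<^sup>\<dagger> = Y\<^sup>\<dagger> ** X\<^sup>\<dagger>"
  by (simp add: vec_eq_iff matrix_matrix_mult_def mult.commute)

lemma conj_transpose_add: "(X + Y)\<^sup>\<dagger> = X\<^sup>\<dagger> + Y\<^sup>\<dagger>"
  and conj_transpose_diff: "(X - Y)\<^sup>\<dagger> = X\<^sup>\<dagger> - Y\<^sup>\<dagger>"
  and conj_transpose_minus: "(- X)\<^sup>\<dagger> = - X\<^sup>\<dagger>"
  by (auto simp: vec_eq_iff)

lemma conj_transpose_zero [simp]: "0\<^sup>\<dagger> = 0"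
  and conj_transpose_one [simp]: "(mat 1)\<^sup>\<dagger> = mat 1"
  by (auto simp: vec_eq_iff mat_def)

lemma conj_transpose_scaleR: "(r *\<^sub>R X)\<^sup>\<dagger> = r *\<^sub>R X\<^sup>\<dagger>"
  by (simp add: vec_eq_iff)

lemma bounded_linear_conj_transpose: "bounded_linear (conj_transpose :: complex^'n^'k \<Rightarrow> _)"
  by (intro linear_conv_bounded_linear[THEN iffD1] linearI conj_transpose_add conj_transpose_scaleR)

lemma matrix_mult_minus_left: "(- A) ** B = - (A ** (B :: complex^'n^'k))"
  and matrix_mult_minus_right: "A ** (- B) = - (A ** (B :: complex^'n^'k))"
  by (simp_all add: vec_eq_iff matrix_matrix_mult_def sum_negf)

lemma matrix_mult_zero_left [simp]: "0 ** (B :: complex^'n^'k) = 0"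
  by (simp add: vec_eq_iff matrix_matrix_mult_def)

lemma matrix_mult_zero_right [simp]: "A ** (0 :: complex^'n^'k) = 0"
  by (simp add: vec_eq_iff matrix_matrix_mult_def)

lemma matrix_mult_add_left: "(A + B) ** C = A ** C + B ** (C :: complex^'n^'k)"
  by (simp add: vec_eq_iff matrix_matrix_mult_def sum.distrib algebra_simps)

lemma matrix_mult_add_right: "A ** (B + C) = A ** B + A ** (C :: complex^'n^'k)"
  by (simp add: vec_eq_iff matrix_matrix_mult_def sum.distrib algebra_simps)

lemma matrix_mult_diff_left: "(A - B) ** C = A ** C - B ** (C :: complex^'n^'k)"
  by (simp add: vec_eq_iff matrix_matrix_mult_def sum_subtractf algebra_simps)

lemma matrix_mult_diff_right: "A ** (B - C) = A ** B - A ** (C :: complex^'n^'k)"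
  by (simp add: vec_eq_iff matrix_matrix_mult_def sum_subtractf algebra_simps)

lemma matrix_mult_scaleR_left: "(r *\<^sub>R A) ** B = r *\<^sub>R (A ** (B :: complex^'n^'k))"
  and matrix_mult_scaleR_right: "A ** (r *\<^sub>R B) = r *\<^sub>R (A ** (B :: complex^'n^'k))"
  by (simp_all add: vec_eq_iff matrix_matrix_mult_def scaleR_sum_right)

lemmas matrix_distribs = matrix_mult_add_left matrix_mult_add_right matrix_mult_diff_left
  matrix_mult_diff_right matrix_mult_minus_left matrix_mult_minus_right matrix_mult_scaleR_left
  matrix_mult_scaleR_right

lemmas conj_transpose_simps = conj_transpose_mult conj_transpose_add conj_transpose_diff
  conj_transpose_minus conj_transpose_scaleR

lemma bounded_bilinear_matrix_mult:
  "bounded_bilinear ((**) :: complex^'k^'l \<Rightarrow> complex^'n^'k \<Rightarrow> complex^'n^'l)"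
  unfolding bilinear_conv_bounded_bilinear[symmetric] bilinear_def
  by (auto intro!: linearI simp: matrix_distribs)

lemma has_derivative_matrix_mult [derivative_intros]:
  assumes "(f has_derivative f') (at x within S)" "(g has_derivative g') (at x within S)"
  shows "((\<lambda>x. f x ** (g x :: complex^'n^'k)) has_derivative (\<lambda>h. f x ** g' h + f' h ** g x)) (at x within S)"
  by (rule bounded_bilinear.FDERIV[OF bounded_bilinear_matrix_mult assms])

lemma has_derivative_conj_transpose [derivative_intros]:
  assumes "(f has_derivative f') (at x within S)"
  shows "((\<lambda>x. (f x)\<^sup>\<dagger>) has_derivative (\<lambda>h. (f' h)\<^sup>\<dagger>)) (at x within S)"
  by (rule bounded_linear.has_derivative[OF bounded_linear_conj_transpose assms])

text \<open>Identifies the trace form of the metric with the real inner product on matrices, so that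
  left and right multiplications acquire their adjoints in the two lemmas below.\<close>

lemma Re_trace_conj_transpose_mult: "Re (trace (X\<^sup>\<dagger> ** Y)) = inner X (Y :: complex^'n^'k)"
proof -
  have "Re (trace (X\<^sup>\<dagger> ** Y)) = (\<Sum>i\<in>UNIV. \<Sum>k\<in>UNIV. Re (cnj (X $ k $ i) * Y $ k $ i))"
    by (simp add: trace_def matrix_matrix_mult_def)
  also have "\<dots> = (\<Sum>k\<in>UNIV. \<Sum>i\<in>UNIV. Re (cnj (X $ k $ i) * Y $ k $ i))"
    by (rule sum.swap)
  also have "\<dots> = inner X Y"
    by (simp add: inner_vec_def inner_complex_def)
  finally show ?thesis .
qed

lemma inner_matrix_mult_left: "inner (A ** X) Y = inner X (A\<^sup>\<dagger> ** (Y :: complex^'n^'k))"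
  by (simp add: Re_trace_conj_transpose_mult[symmetric] conj_transpose_mult matrix_mul_assoc)

lemma inner_matrix_mult_right: "inner (X ** B) Y = inner X (Y ** (B\<^sup>\<dagger> :: complex^'l^'k))"
proof -
  have "trace ((X ** B)\<^sup>\<dagger> ** Y) = trace (B\<^sup>\<dagger> ** (X\<^sup>\<dagger> ** Y))"
    by (simp add: conj_transpose_mult matrix_mul_assoc)
  also have "\<dots> = trace (X\<^sup>\<dagger> ** (Y ** B\<^sup>\<dagger>))"
    using trace_mul_sym[of "B\<^sup>\<dagger>" "X\<^sup>\<dagger> ** Y"] by (simp add: matrix_mul_assoc)
  finally show ?thesis
    by (simp add: Re_trace_conj_transpose_mult[symmetric])
qed

section \<open>The Hermitian product and unitary frames\<close>

lemma hinner_add_left: "hinner (x + y) z = hinner x z + hinner y z"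
  and hinner_diff_left: "hinner (x - y) z = hinner x z - hinner y z"
  and hinner_scale_left: "hinner (c *s x) z = c * hinner x z"
  and hinner_scale_right: "hinner x (c *s z) = cnj c * hinner x z"
  and hinner_zero_left [simp]: "hinner 0 z = 0"
  and hinner_zero_right [simp]: "hinner x 0 = 0"
  by (simp_all add: hinner_def sum.distrib sum_subtractf sum_distrib_left algebra_simps)

lemma hinner_commute: "hinner y x = cnj (hinner x y)"
  by (simp add: hinner_def mult.commute)

lemma hinner_self: "hinner x x = complex_of_real ((norm x)\<^sup>2)"
proof -
  have "hinner x x = (\<Sum>i\<in>UNIV. complex_of_real ((norm (x $ i))\<^sup>2))"
    by (simp only: hinner_def complex_norm_square)
  also have "\<dots> = complex_of_real ((norm x)\<^sup>2)"
    by (simp add: norm_vec_def L2_set_def sum_nonneg)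
  finally show ?thesis .
qed

lemma hinner_self_eq_0 [simp]: "hinner x x = 0 \<longleftrightarrow> x = 0"
  by (simp add: hinner_self)

lemma hinner_matrix_vector_left: "hinner (A *v x) y = hinner x (A\<^sup>\<dagger> *v y)"
proof -
  have "hinner (A *v x) y = (\<Sum>i\<in>UNIV. \<Sum>j\<in>UNIV. A $ i $ j * x $ j * cnj (y $ i))"
    by (simp add: hinner_def matrix_vector_mult_def sum_distrib_right)
  also have "\<dots> = (\<Sum>j\<in>UNIV. \<Sum>i\<in>UNIV. A $ i $ j * x $ j * cnj (y $ i))"
    by (rule sum.swap)
  also have "\<dots> = hinner x (A\<^sup>\<dagger> *v y)"
    by (simp add: hinner_def matrix_vector_mult_def sum_distrib_left mult_ac)
  finally show ?thesis .
qed

lemma hinner_normalize: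
  assumes "x \<noteq> 0"
  shows "\<exists>r. hinner (r *s x) (r *s x) = 1"
proof -
  define r where "r = complex_of_real (inverse (norm x))"
  have "hinner (r *s x) (r *s x) = r * cnj r * hinner x x"
    by (simp add: hinner_scale_left hinner_scale_right)
  also have "\<dots> = complex_of_real (inverse (norm x) * inverse (norm x) * (norm x)\<^sup>2)"
    by (simp add: hinner_self r_def)
  also have "inverse (norm x) * inverse (norm x) * (norm x)\<^sup>2 = 1"
    using assms by (simp add: power2_eq_square field_simps)
  finally show ?thesis by (intro exI) simp
qed

definition horthonormal_on :: "'i set \<Rightarrow> ('i \<Rightarrow> complex^'n) \<Rightarrow> bool" where
  "horthonormal_on I e \<longleftrightarrow> (\<forall>i\<in>I. \<forall>j\<in>I. hinner (e i) (e j) = (if i = j then 1 else 0))"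

text \<open>The square matrix \<open>L\<close> whose rows with index in \<open>I\<close> are the
  conjugated vectors has a zero row, so it is not surjective and hence not injective. A normalized
  kernel vector is orthogonal to the family.\<close>

lemma exists_unit_horthogonal:
  fixes e :: "'n::finite \<Rightarrow> complex^'n"
  assumes "I \<noteq> UNIV"
  shows "\<exists>x. hinner x x = 1 \<and> (\<forall>i\<in>I. hinner x (e i) = 0)"
proof -
  define L where "L = (\<chi> i j. if i \<in> I then cnj (e i $ j) else 0)"
  obtain k where k: "k \<notin> I" using assms by auto
  have L: "(L *v x) $ i = (if i \<in> I then hinner x (e i) else 0)" for x i
    by (simp add: L_def matrix_vector_mult_def hinner_def mult.commute)
  have "L *v x \<noteq> axis k 1" for x
    using L[of x k] k by (metis axis_nth zero_neq_one)
  then have "\<not> surj ((*v) L)"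
    by (metis surjD)
  then have "\<not> inj ((*v) L)"
    using vec.linear_inj_imp_surj matrix_vector_mul_linear_gen by blast
  then obtain x where x: "x \<noteq> 0" "L *v x = 0"
    using vec.linear_inj_iff_eq_0[OF matrix_vector_mul_linear_gen, of L] by blast
  obtain r where "hinner (r *s x) (r *s x) = 1"
    using hinner_normalize x by blast
  moreover have "hinner (r *s x) (e i) = 0" if "i \<in> I" for i
    using L[of x i] x that by (simp add: hinner_scale_left)
  ultimately show ?thesis by blast
qed

lemma extend_horthonormal:
  fixes e :: "'n::finite \<Rightarrow> complex^'n"
  assumes "horthonormal_on I e"
  shows "\<exists>e'. horthonormal_on UNIV e' \<and> (\<forall>i\<in>I. e' i = e i)"
  using assms
proof (induction "card (- I)" arbitrary: I e)
  case 0
  then have "I = UNIV" by auto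
  then show ?case using 0 by auto
next
  case (Suc k)
  then have "- I \<noteq> {}" by (metis card.empty nat.distinct(1))
  then obtain j where j: "j \<notin> I" by blast
  then obtain x where x: "hinner x x = 1" "\<And>i. i \<in> I \<Longrightarrow> hinner x (e i) = 0"
    using exists_unit_horthogonal[of I e] by auto
  then have x': "\<And>i. i \<in> I \<Longrightarrow> hinner (e i) x = 0"
    by (metis complex_cnj_zero hinner_commute)
  have 1: "horthonormal_on (insert j I) (e(j := x))"
    using Suc.prems x x' j by (auto simp: horthonormal_on_def)
  have "- insert j I = - I - {j}" by auto
  then have 2: "k = card (- insert j I)"
    using Suc.hyps(2) j by simp
  obtain e' where e': "horthonormal_on UNIV e'" "\<And>i. i \<in> insert j I \<Longrightarrow> e' i = (e(j := x)) i"
    using Suc.hyps(1)[OF 2 1] by blast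
  then have "\<forall>i\<in>I. e' i = e i" using j by auto
  then show ?case using e' by blast
qed

lemma G2_orthonormal_basis:
  assumes "W \<in> G2"
  shows "\<exists>x y. hinner x x = 1 \<and> hinner y y = 1 \<and> hinner x y = 0 \<and> hinner y x = 0 \<and>
    W = range (\<lambda>(a, b). a *s x + b *s y)"
proof -
  have W: "vec.subspace W" "vec.dim W = 2"
    using assms by (auto simp: G2_def)
  note unit = hinner_normalize
  have "\<exists>x\<in>W. x \<noteq> 0"
  proof (rule ccontr)
    assume "\<not> ?thesis"
    then have "W \<subseteq> {0}" by auto
    then show False using W vec.dim_le_card[of W "{}"] by simp
  qed
  then obtain x where x: "x \<in> W" "hinner x x = 1"
    using unit W(1) by (metis vec.subspace_scale)
  have "\<exists>y\<in>W. y \<notin> vec.span {x}"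
  proof (rule ccontr)
    assume "\<not> ?thesis"
    then show False using W vec.dim_le_card[of W "{x}"] by auto
  qed
  then obtain z where z: "z \<in> W" "z \<notin> vec.span {x}" by blast
  define z' where "z' = z - hinner z x *s x"
  have "z' \<in> W" unfolding z'_def using W x z by (simp add: vec.subspace_diff vec.subspace_scale)
  moreover have "z' \<noteq> 0"
    using z by (auto simp: z'_def vec.span_breakdown_eq)
  moreover have "hinner z' x = 0"
    by (simp add: z'_def hinner_diff_left hinner_scale_left x)
  ultimately obtain y where y: "y \<in> W" "hinner y y = 1" "hinner y x = 0"
    using unit[of z'] W(1) by (metis hinner_scale_left mult_zero_right vec.subspace_scale)
  have xy: "hinner x y = 0" using y by (metis complex_cnj_zero hinner_commute)
  have comb: "a *s x + b *s y \<in> W" for a b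
    using x y W by (simp add: vec.subspace_add vec.subspace_scale)
  have ne: "x \<noteq> y" using x y by auto
  have "vec.independent {x, y}"
  proof -
    have "y \<noteq> c *s x" for c
      using x y by (auto simp: hinner_scale_left)
    then have "y \<notin> vec.span {x}" by (auto simp: vec.span_breakdown_eq)
    moreover have "x \<noteq> 0" using x by auto
    ultimately have "vec.independent {y, x}"
      using vec.independent_insertI[of y "{x}"] vec.dependent_single[of x] by blast
    then show ?thesis by (simp add: insert_commute)
  qed
  then have "W \<subseteq> vec.span {x, y}"
    using vec.card_ge_dim_independent[of "{x, y}" W] x y W ne by auto
  also have "\<dots> \<subseteq> range (\<lambda>(a, b). a *s x + b *s y)"
  proof
    fix w assume "w \<in> vec.span {x, y}"
    then obtain a where "w - a *s x \<in> vec.span {y}" by (auto simp: vec.span_breakdown_eq)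
    then obtain b where "w - a *s x = b *s y" by (auto simp: vec.span_breakdown_eq)
    then have "w = a *s x + b *s y" by (simp add: algebra_simps)
    then show "w \<in> range (\<lambda>(a, b). a *s x + b *s y)" by auto
  qed
  finally have "W = range (\<lambda>(a, b). a *s x + b *s y)"
    using comb by auto
  then show ?thesis using x y xy by blast
qed

text \<open>Unitarity of the block matrix with blocks \<open>B\<close> and \<open>C\<close>, written
  blockwise because its columns are indexed by \<open>2 + 'm\<close> and its rows by
  \<open>'n\<close>. The first four equations make the adjoint a left inverse, the last one a right
  inverse.\<close>

definition unitary_frame :: "complex^2^'n \<Rightarrow> complex^'m^'n \<Rightarrow> bool" where
  "unitary_frame B C \<longleftrightarrow> B\<^sup>\<dagger> ** B = mat 1 \<and> C\<^sup>\<dagger> ** C = mat 1 \<and> B\<^sup>\<dagger> ** C = 0 \<and> C\<^sup>\<dagger> ** B = 0 \<and>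
     B ** B\<^sup>\<dagger> + C ** C\<^sup>\<dagger> = mat 1"

lemma adapted_unitary_frame:
  fixes W :: "(complex^'n) set"
  assumes W: "W \<in> G2" and card: "CARD('n) = CARD('m::finite) + 2"
  shows "\<exists>(B :: complex^2^'n) (C :: complex^'m^'n). unitary_frame B C \<and> range ((*v) B) = W"
proof -
  obtain x y where xy: "hinner x x = 1" "hinner y y = 1" "hinner x y = 0" "hinner y x = 0"
    and Wxy: "W = range (\<lambda>(a, b). a *s x + b *s y)"
    using G2_orthonormal_basis[OF W] by blast
  \<comment> \<open>A bijection between the two index types lets the columns of \<open>B\<close> and
    \<open>C\<close> be read as one family indexed by \<open>'n\<close>, to which the extension
    lemma applies.\<close>
  have "card (UNIV :: (2 + 'm) set) = card (UNIV :: 'n set)"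
    using card by simp
  then obtain \<sigma> :: "2 + 'm \<Rightarrow> 'n" where \<sigma>: "bij \<sigma>"
    using finite_same_card_bij[of "UNIV :: (2 + 'm) set" "UNIV :: 'n set"] by auto
  then have inj: "\<sigma> p = \<sigma> q \<longleftrightarrow> p = q" for p q
    by (meson bij_is_inj inj_eq)
  \<comment> \<open>The value \<open>y\<close> serves the index \<sigma> \<open>(Inl 2)\<close> and
    is a mere default elsewhere; the extension overrides all indices other than these two.\<close>
  define e0 where "e0 i = (if i = \<sigma> (Inl 1) then x else y)" for i
  have "horthonormal_on {\<sigma> (Inl 1), \<sigma> (Inl 2)} e0"
    using xy by (auto simp: horthonormal_on_def e0_def inj)
  then obtain e where e: "horthonormal_on UNIV e"
    and e0: "e (\<sigma> (Inl 1)) = x" "e (\<sigma> (Inl 2)) = y"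
    using extend_horthonormal[of "{\<sigma> (Inl 1), \<sigma> (Inl 2)}" e0] by (auto simp: e0_def inj)
  have ee: "hinner (e i) (e j) = (if i = j then 1 else 0)" for i j
    using e by (simp add: horthonormal_on_def)
  define B :: "complex^2^'n" where "B = (\<chi> i j. e (\<sigma> (Inl j)) $ i)"
  define C :: "complex^'m^'n" where "C = (\<chi> i j. e (\<sigma> (Inr j)) $ i)"
  define E :: "complex^'n^'n" where "E = (\<chi> i j. e j $ i)"
  have "E\<^sup>\<dagger> ** E = mat 1"
  proof -
    have "(E\<^sup>\<dagger> ** E) $ i $ j = hinner (e j) (e i)" for i j
      by (simp add: E_def matrix_matrix_mult_def hinner_def mult.commute)
    then show ?thesis by (auto simp: vec_eq_iff ee mat_def)
  qed
  then have EE: "E ** E\<^sup>\<dagger> = mat 1" by (simp add: matrix_left_right_inverse)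
  have "B ** B\<^sup>\<dagger> + C ** C\<^sup>\<dagger> = E ** E\<^sup>\<dagger>"
  proof -
    have "(E ** E\<^sup>\<dagger>) $ i $ j = (\<Sum>k\<in>UNIV. e k $ i * cnj (e k $ j))" for i j
      by (simp add: E_def matrix_matrix_mult_def)
    also have "\<dots> i j = (\<Sum>p\<in>UNIV. e (\<sigma> p) $ i * cnj (e (\<sigma> p) $ j))" for i j
      by (rule sum.reindex_bij_betw[OF \<sigma>, symmetric])
    also have "\<dots> i j = (B ** B\<^sup>\<dagger> + C ** C\<^sup>\<dagger>) $ i $ j" for i j
      by (subst UNIV_sum, subst sum.union_disjoint)
        (auto simp: sum.reindex B_def C_def matrix_matrix_mult_def)
    finally show ?thesis by (simp add: vec_eq_iff)
  qed
  moreover have "B\<^sup>\<dagger> ** B = mat 1"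
  proof -
    have "(B\<^sup>\<dagger> ** B) $ i $ j = hinner (e (\<sigma> (Inl j))) (e (\<sigma> (Inl i)))" for i j
      by (simp add: B_def matrix_matrix_mult_def hinner_def mult.commute)
    then show ?thesis by (auto simp: vec_eq_iff ee mat_def inj)
  qed
  moreover have "C\<^sup>\<dagger> ** C = mat 1"
  proof -
    have "(C\<^sup>\<dagger> ** C) $ i $ j = hinner (e (\<sigma> (Inr j))) (e (\<sigma> (Inr i)))" for i j
      by (simp add: C_def matrix_matrix_mult_def hinner_def mult.commute)
    then show ?thesis by (auto simp: vec_eq_iff ee mat_def inj)
  qed
  moreover have BC: "B\<^sup>\<dagger> ** C = 0"
  proof -
    have "(B\<^sup>\<dagger> ** C) $ i $ j = hinner (e (\<sigma> (Inr j))) (e (\<sigma> (Inl i)))" for i j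
      by (simp add: B_def C_def matrix_matrix_mult_def hinner_def mult.commute)
    then show ?thesis by (auto simp: vec_eq_iff ee mat_def inj)
  qed
  moreover have "C\<^sup>\<dagger> ** B = 0"
    using arg_cong[OF BC, of conj_transpose] by (simp add: conj_transpose_mult)
  ultimately have "unitary_frame B C"
    using EE by (simp add: unitary_frame_def)
  moreover have "range ((*v) B) = W"
  proof -
    have B: "B *v v = v $ 1 *s x + v $ 2 *s y" for v
      by (simp add: B_def matrix_vector_mult_def sum_2 vec_eq_iff e0 mult.commute)
    have "\<exists>v::complex^2. v $ 1 = a \<and> v $ 2 = b" for a b
      by (rule exI[of _ "vector [a, b]"]) simp
    then show ?thesis unfolding Wxy B by (auto simp: image_def) metis
  qed
  ultimately show ?thesis by blast
qed

subsection \<open>The Gauss and Codazzi equations\<close>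

text \<open>Models a chart with coordinate domain the whole space. Compatibility and the derivative
  of \<Gamma> are stated jointly in base point and both vectors, so that the chain rule immediately
  differentiates along a map \<open>h\<close> with fields \<xi> and \<eta>.
  \<open>D\<Gamma> z w\<close> is the derivative in the base point.\<close>

locale ambient_metric =
  fixes G :: "'b \<Rightarrow> 'b \<Rightarrow> 'b::euclidean_space \<Rightarrow> real" and \<Gamma> :: "'b \<Rightarrow> 'b \<Rightarrow> 'b \<Rightarrow> 'b"
    and D\<Gamma> :: "'b \<Rightarrow> 'b \<Rightarrow> 'b \<Rightarrow> 'b \<Rightarrow> 'b"
  assumes G_bilinear: "bilinear (G z)"
    and G_commute: "G z u v = G z v u"
    and G_pos: "u \<noteq> 0 \<Longrightarrow> G z u u > 0"
    and \<Gamma>_bilinear: "bilinear (\<Gamma> z)"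
    and \<Gamma>_commute: "\<Gamma> z u v = \<Gamma> z v u"
    and G_compatible: "((\<lambda>(z, u, v). G z u v) has_derivative
      (\<lambda>(w, u', v'). G z (u' + \<Gamma> z w u) v + G z u (v' + \<Gamma> z w v))) (at (z, u, v))"
    and \<Gamma>_derivative: "((\<lambda>(z, u, v). \<Gamma> z u v) has_derivative
      (\<lambda>(w, u', v'). D\<Gamma> z w u v + \<Gamma> z u' v + \<Gamma> z u v')) (at (z, u, v))"
begin

lemmas G_simps = bilinear_ladd[OF G_bilinear] bilinear_radd[OF G_bilinear]
  bilinear_lsub[OF G_bilinear] bilinear_rsub[OF G_bilinear]
  bilinear_lmul[OF G_bilinear] bilinear_rmul[OF G_bilinear]
  bilinear_lneg[OF G_bilinear] bilinear_rneg[OF G_bilinear]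
  bilinear_lzero[OF G_bilinear] bilinear_rzero[OF G_bilinear]

lemmas \<Gamma>_simps = bilinear_ladd[OF \<Gamma>_bilinear] bilinear_radd[OF \<Gamma>_bilinear]
  bilinear_lsub[OF \<Gamma>_bilinear] bilinear_rsub[OF \<Gamma>_bilinear]
  bilinear_lmul[OF \<Gamma>_bilinear] bilinear_rmul[OF \<Gamma>_bilinear]
  bilinear_lneg[OF \<Gamma>_bilinear] bilinear_rneg[OF \<Gamma>_bilinear]
  bilinear_lzero[OF \<Gamma>_bilinear] bilinear_rzero[OF \<Gamma>_bilinear]

lemma G_eq_0_iff: "G z u u = 0 \<longleftrightarrow> u = 0"
  using G_pos[of u z] by (cases "u = 0") (auto simp: G_simps)

lemma G_nondegenerate: "(\<And>w. G z u w = G z v w) \<Longrightarrow> u = v"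
  using G_eq_0_iff[of z "u - v"] by (simp add: G_simps)

lemma has_derivative_G:
  assumes "(h has_derivative h') (at x)" "(\<xi> has_derivative \<xi>') (at x)" "(\<eta> has_derivative \<eta>') (at x)"
  shows "((\<lambda>y. G (h y) (\<xi> y) (\<eta> y)) has_derivative
    (\<lambda>u. G (h x) (\<xi>' u + \<Gamma> (h x) (h' u) (\<xi> x)) (\<eta> x) + G (h x) (\<xi> x) (\<eta>' u + \<Gamma> (h x) (h' u) (\<eta> x)))) (at x)"
  using has_derivative_compose[OF has_derivative_Pair[OF assms(1) has_derivative_Pair[OF assms(2,3)]]
      G_compatible[of "h x" "\<xi> x" "\<eta> x"]] by simp

lemma has_derivative_\<Gamma>:
  assumes "(h has_derivative h') (at x)" "(\<xi> has_derivative \<xi>') (at x)" "(\<eta> has_derivative \<eta>') (at x)"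
  shows "((\<lambda>y. \<Gamma> (h y) (\<xi> y) (\<eta> y)) has_derivative
    (\<lambda>u. D\<Gamma> (h x) (h' u) (\<xi> x) (\<eta> x) + \<Gamma> (h x) (\<xi>' u) (\<eta> x) + \<Gamma> (h x) (\<xi> x) (\<eta>' u))) (at x)"
  using has_derivative_compose[OF has_derivative_Pair[OF assms(1) has_derivative_Pair[OF assms(2,3)]]
      \<Gamma>_derivative[of "h x" "\<xi> x" "\<eta> x"]] by simp

text \<open>Compatibility and symmetry collapse the three terms of Koszul's formula to twice the
  pairing with \<Gamma>; positivity makes the described vector unique.\<close>

lemma christoffel_eq: "christoffel G z u v = \<Gamma> z u v"
proof -
  have D: "frechet_derivative (\<lambda>y. G y a b) (at z) c = G z (\<Gamma> z c a) b + G z a (\<Gamma> z c b)" for a b c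
    using has_derivative_G[OF has_derivative_ident[of "at z"] has_derivative_const[of a] has_derivative_const[of b]]
    by (simp add: frechet_derivative_at[symmetric])
  have koszul: "G z (\<Gamma> z u v) w + G z v (\<Gamma> z u w) + (G z (\<Gamma> z v u) w + G z u (\<Gamma> z v w))
      - (G z (\<Gamma> z w u) v + G z u (\<Gamma> z w v)) = 2 * G z (\<Gamma> z u v) w" for w
    using \<Gamma>_commute[of z v u] \<Gamma>_commute[of z w u] \<Gamma>_commute[of z w v] G_commute[of z v "\<Gamma> z u w"] by simp
  show ?thesis
    unfolding christoffel_def D koszul
    by (rule the_equality) (auto intro: G_nondegenerate)
qed

definition riem :: "'b \<Rightarrow> 'b \<Rightarrow> 'b \<Rightarrow> 'b \<Rightarrow> 'b" where
  "riem z u v w = D\<Gamma> z u v w - D\<Gamma> z v u w + \<Gamma> z u (\<Gamma> z v w) - \<Gamma> z v (\<Gamma> z u w)"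

lemma cov_deriv_along_eq:
  "cov_deriv_along G h \<xi> x u = \<partial> \<xi> u x + \<Gamma> (h x) (\<partial> h u x) (\<xi> x)"
  by (simp add: cov_deriv_along_def christoffel_eq)

end

section \<open>Calculus along an immersed hypersurface\<close>

lemma has_derivative_frechet: "f differentiable (at x) \<Longrightarrow> (f has_derivative (\<lambda>u. \<partial> f u x)) (at x)"
  using frechet_derivative_works by blast

lemma dirderiv_eqI: "(f has_derivative f') (at x) \<Longrightarrow> \<partial> f u x = f' u"
  by (simp add: frechet_derivative_at[symmetric])

lemma linear_dirderiv: "f differentiable (at x) \<Longrightarrow> linear (\<lambda>u. \<partial> f u x)"
  by (rule linear_frechet_derivative)

text \<open>The situation in one chart of the hypersurface and one of the ambient space:
  \<open>h\<close> and \<open>n\<close> are the coordinate expressions of the immersion and of the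
  normal field on the coordinate domain \<open>U\<close>.\<close>

locale immersed_hypersurface = ambient_metric G \<Gamma> D\<Gamma>
  for G :: "'b \<Rightarrow> 'b \<Rightarrow> 'b::euclidean_space \<Rightarrow> real" and \<Gamma> D\<Gamma> +
  fixes U :: "(real^'d) set" and h n :: "real^'d \<Rightarrow> 'b"
    and g :: "real^'d \<Rightarrow> real^'d \<Rightarrow> real^'d \<Rightarrow> real"
  assumes U: "open U" and h: "smooth_on U h" and n: "smooth_on U n"
    and inj: "x \<in> U \<Longrightarrow> inj (\<lambda>u. \<partial> h u x)"
    and n_unit: "x \<in> U \<Longrightarrow> G (h x) (n x) (n x) = 1"
    and n_normal: "x \<in> U \<Longrightarrow> G (h x) (n x) (\<partial> h u x) = 0"
    and codim: "DIM('b) = CARD('d) + 1"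
    and g: "x \<in> U \<Longrightarrow> g x u v = G (h x) (\<partial> h u x) (\<partial> h v x)"
begin

abbreviation nabla ("\<nabla>") where "\<nabla> u \<xi> x \<equiv> cov_deriv_along G h \<xi> x u"

lemma h_diff: "x \<in> U \<Longrightarrow> h differentiable (at x)"
  and dh_diff: "x \<in> U \<Longrightarrow> \<partial> h u differentiable (at x)"
  and n_diff: "x \<in> U \<Longrightarrow> n differentiable (at x)"
  and dh_smooth: "smooth_on U (\<partial> h u)"
  using h n smooth_on_differentiable smooth_on_dirderiv by blast+

lemmas linear_dh = linear_dirderiv[OF h_diff]

lemma dirderiv_G:
  assumes "x \<in> U" "\<xi> differentiable (at x)" "\<eta> differentiable (at x)"
  shows "(\<lambda>y. G (h y) (\<xi> y) (\<eta> y)) differentiable (at x)"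
    and "\<partial> (\<lambda>y. G (h y) (\<xi> y) (\<eta> y)) u x = G (h x) (\<nabla> u \<xi> x) (\<eta> x) + G (h x) (\<xi> x) (\<nabla> u \<eta> x)"
proof -
  note D = has_derivative_G[OF has_derivative_frechet[OF h_diff[OF assms(1)]]
      has_derivative_frechet[OF assms(2)] has_derivative_frechet[OF assms(3)]]
  show "(\<lambda>y. G (h y) (\<xi> y) (\<eta> y)) differentiable (at x)" using D by (rule differentiableI)
  show "\<partial> (\<lambda>y. G (h y) (\<xi> y) (\<eta> y)) u x = G (h x) (\<nabla> u \<xi> x) (\<eta> x) + G (h x) (\<xi> x) (\<nabla> u \<eta> x)"
    using dirderiv_eqI[OF D] by (simp add: cov_deriv_along_eq)
qed

lemma nabla_has_derivative:
  assumes x: "x \<in> U" and \<xi>: "\<xi> differentiable (at x)" "\<partial> \<xi> v differentiable (at x)"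
  shows "(\<nabla> v \<xi> has_derivative (\<lambda>u. \<partial> (\<partial> \<xi> v) u x + (D\<Gamma> (h x) (\<partial> h u x) (\<partial> h v x) (\<xi> x)
    + \<Gamma> (h x) (\<partial> (\<partial> h v) u x) (\<xi> x) + \<Gamma> (h x) (\<partial> h v x) (\<partial> \<xi> u x)))) (at x)"
  unfolding cov_deriv_along_eq
  by (intro has_derivative_add has_derivative_frechet \<xi> has_derivative_\<Gamma> h_diff dh_diff x)

lemma nabla_differentiable:
  assumes "smooth_on U \<xi>" "x \<in> U"
  shows "\<nabla> v \<xi> differentiable (at x)"
  using smooth_on_differentiable[OF assms] smooth_on_differentiable[OF smooth_on_dirderiv[OF assms(1)] assms(2)]
  by (intro differentiableI[OF nabla_has_derivative] assms(2))

text \<open>All second derivatives of \<xi> and \<open>h\<close> cancel by symmetry of mixed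
  derivatives. The case \<xi> = \<partial> \<open>h w\<close> leads to the Gauss equation, the case
  \<xi> = \<open>n\<close> to the Codazzi equation.\<close>

lemma nabla_commutator:
  assumes \<xi>: "smooth_on U \<xi>" and x: "x \<in> U"
  shows "\<nabla> u (\<nabla> v \<xi>) x - \<nabla> v (\<nabla> u \<xi>) x = riem (h x) (\<partial> h u x) (\<partial> h v x) (\<xi> x)"
proof -
  have d: "\<xi> differentiable (at x)" "\<partial> \<xi> w differentiable (at x)" for w
    using \<xi> x smooth_on_differentiable smooth_on_dirderiv by blast+
  have 1: "\<nabla> a (\<nabla> b \<xi>) x = \<partial> (\<partial> \<xi> b) a x + (D\<Gamma> (h x) (\<partial> h a x) (\<partial> h b x) (\<xi> x)
    + \<Gamma> (h x) (\<partial> (\<partial> h b) a x) (\<xi> x) + \<Gamma> (h x) (\<partial> h b x) (\<partial> \<xi> a x))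
    + \<Gamma> (h x) (\<partial> h a x) (\<partial> \<xi> b x + \<Gamma> (h x) (\<partial> h b x) (\<xi> x))" for a b
    unfolding cov_deriv_along_eq[of h "\<nabla> b \<xi>"] dirderiv_eqI[OF nabla_has_derivative[OF x d]]
    by (simp add: cov_deriv_along_eq)
  show ?thesis
    unfolding 1 riem_def mixed_derivatives_commute[OF U x \<xi>, of v u] mixed_derivatives_commute[OF U x h, of v u]
    by (simp add: \<Gamma>_simps)
qed

lemma nabla_dh_commute: "x \<in> U \<Longrightarrow> \<nabla> u (\<partial> h v) x = \<nabla> v (\<partial> h u) x"
  unfolding cov_deriv_along_eq using mixed_derivatives_commute[OF U _ h, of x v u]
    \<Gamma>_commute[of "h x" "\<partial> h u x"] by simp

lemma nabla_cong:
  assumes "x \<in> U" "\<And>y. y \<in> U \<Longrightarrow> \<xi> y = \<eta> y"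
  shows "\<nabla> u \<xi> x = \<nabla> u \<eta> x"
  unfolding cov_deriv_along_eq using frechet_derivative_cong_open[OF U assms(1), of \<xi> \<eta>] assms by simp

lemma nabla_add:
  assumes "\<xi> differentiable (at x)" "\<eta> differentiable (at x)"
  shows "\<nabla> u (\<lambda>y. \<xi> y + \<eta> y) x = \<nabla> u \<xi> x + \<nabla> u \<eta> x"
  using dirderiv_eqI[OF has_derivative_add[OF assms[THEN has_derivative_frechet]]]
  unfolding cov_deriv_along_eq by (simp add: \<Gamma>_simps)

lemma nabla_scaleR:
  assumes "f differentiable (at x)" "\<xi> differentiable (at x)"
  shows "\<nabla> u (\<lambda>y. f y *\<^sub>R \<xi> y) x = \<partial> f u x *\<^sub>R \<xi> x + f x *\<^sub>R \<nabla> u \<xi> x"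
  using dirderiv_eqI[OF has_derivative_scaleR[OF assms[THEN has_derivative_frechet]]]
  unfolding cov_deriv_along_eq by (simp add: \<Gamma>_simps algebra_simps)

text \<open>A dimension count: the image of the injective differential lies in the normal
  hyperplane, which is proper because it omits \<open>n x\<close>, and the codimension is
  one.\<close>

lemma tangent_iff:
  assumes x: "x \<in> U"
  shows "(\<exists>u. z = \<partial> h u x) \<longleftrightarrow> G (h x) (n x) z = 0"
proof -
  let ?H = "{z. G (h x) (n x) z = 0}" and ?R = "range (\<lambda>u. \<partial> h u x)"
  have H: "subspace ?H" by (auto simp: subspace_def G_simps)
  have R: "subspace ?R" by (rule linear_subspace_image[OF linear_dh[OF x] subspace_UNIV])
  have sub: "?R \<subseteq> ?H" using n_normal[OF x] by auto
  have "n x \<notin> ?H" using n_unit[OF x] by simp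
  then have "?H \<noteq> UNIV" by blast
  then have "dim ?H \<noteq> DIM('b)" using dim_eq_full span_eq_iff[THEN iffD2, OF H] by metis
  then have "dim ?H \<le> CARD('d)" using dim_subset_UNIV[of ?H] codim by simp
  also have "CARD('d) = dim ?R"
    using dim_image_eq[OF linear_dh[OF x] inj_on_subset[OF inj[OF x]], of UNIV] by (simp add: dim_UNIV)
  finally have "?R = ?H" using subspace_dim_equal[OF R H sub] by simp
  then show ?thesis by blast
qed

lemma dh_eq_iff: "x \<in> U \<Longrightarrow> \<partial> h u x = \<partial> h v x \<longleftrightarrow> u = v"
  using inj by (metis injD)

definition shape where
  "shape x u = (THE w. frechet_derivative h (at x) w = - cov_deriv_along G h n x u)"

text \<open>Differentiating \<open>G n n = 1\<close> shows that the covariant derivative of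
  \<open>n\<close> is tangent, so the description defining \<open>shape\<close> has a solution,
  unique by injectivity of the differential.\<close>

lemma dh_shape:
  assumes x: "x \<in> U"
  shows "\<partial> h (shape x u) x = - \<nabla> u n x"
proof -
  have "\<partial> (\<lambda>y. G (h y) (n y) (n y)) u x = 0"
    using frechet_derivative_cong_open[OF U x, of "\<lambda>y. G (h y) (n y) (n y)" "\<lambda>_. 1"] n_unit
    by simp
  then have "G (h x) (n x) (- \<nabla> u n x) = 0"
    using dirderiv_G(2)[OF x n_diff[OF x] n_diff[OF x], of u] by (simp add: G_simps G_commute[of _ _ "n x"])
  then obtain w where w: "\<partial> h w x = - \<nabla> u n x" using tangent_iff[OF x] by metis
  then show ?thesis
    unfolding shape_def by (rule theI) (use w dh_eq_iff[OF x] in metis)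
qed

lemma second_fundamental_form:
  assumes x: "x \<in> U"
  shows "G (h x) (\<nabla> u (\<partial> h v) x) (n x) = g x (shape x u) v"
proof -
  have "\<partial> (\<lambda>y. G (h y) (n y) (\<partial> h v y)) u x = 0"
    using frechet_derivative_cong_open[OF U x, of "\<lambda>y. G (h y) (n y) (\<partial> h v y)" "\<lambda>_. 0"] n_normal
    by simp
  then have "G (h x) (\<nabla> u n x) (\<partial> h v x) + G (h x) (n x) (\<nabla> u (\<partial> h v) x) = 0"
    using dirderiv_G(2)[OF x n_diff[OF x] dh_diff[OF x, of v], of u] by simp
  moreover have "\<nabla> u n x = - \<partial> h (shape x u) x" using dh_shape[OF x, of u] by simp
  ultimately show ?thesis
    using G_commute[of "h x" "n x" "\<nabla> u (\<partial> h v) x"] by (simp add: g[OF x] G_simps)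
qed

lemma shape_symmetric:
  assumes x: "x \<in> U"
  shows "g x (shape x u) v = g x u (shape x v)"
  using second_fundamental_form[OF x, of u v] second_fundamental_form[OF x, of v u] nabla_dh_commute[OF x, of u v] x
  by (simp add: g G_commute)

lemma linear_shape:
  assumes x: "x \<in> U"
  shows "linear (shape x)"
proof (rule linearI)
  have lin: "linear (\<lambda>u. \<nabla> u n x)"
    unfolding cov_deriv_along_eq
    by (intro linearI) (simp_all add: linear_add[OF linear_dh[OF x]] linear_scale[OF linear_dh[OF x]]
        linear_add[OF linear_dirderiv[OF n_diff[OF x]]] linear_scale[OF linear_dirderiv[OF n_diff[OF x]]]
        \<Gamma>_simps algebra_simps)
  show "shape x (u + v) = shape x u + shape x v" for u v
    unfolding dh_eq_iff[OF x, symmetric] linear_add[OF linear_dh[OF x]] dh_shape[OF x] linear_add[OF lin] by simp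
  show "shape x (r *\<^sub>R u) = r *\<^sub>R shape x u" for r u
    unfolding dh_eq_iff[OF x, symmetric] linear_scale[OF linear_dh[OF x]] dh_shape[OF x] linear_scale[OF lin] by simp
qed

text \<open>By compatibility and symmetry, \<nabla> \<open>u (\<partial> h v)\<close> paired with
  tangent vectors satisfies Koszul's formula of the induced metric, so its tangential part is the
  Christoffel map of \<open>g\<close>. The normal part is the second fundamental form.\<close>

lemma gauss_formula:
  assumes x: "x \<in> U"
  shows "\<nabla> u (\<partial> h v) x = \<partial> h (christoffel g x u v) x + g x (shape x u) v *\<^sub>R n x"
proof -
  have D: "frechet_derivative (\<lambda>y. g y a b) (at x) c
      = G (h x) (\<nabla> c (\<partial> h a) x) (\<partial> h b x) + G (h x) (\<partial> h a x) (\<nabla> c (\<partial> h b) x)" for a b c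
    using frechet_derivative_cong_open[OF U x, of "\<lambda>y. g y a b" "\<lambda>y. G (h y) (\<partial> h a y) (\<partial> h b y)"] g
      dirderiv_G(2)[OF x dh_diff[OF x] dh_diff[OF x]] by simp
  have koszul: "frechet_derivative (\<lambda>y. g y v z) (at x) u + frechet_derivative (\<lambda>y. g y u z) (at x) v
      - frechet_derivative (\<lambda>y. g y u v) (at x) z = 2 * G (h x) (\<nabla> u (\<partial> h v) x) (\<partial> h z x)" for z
    unfolding D using nabla_dh_commute[OF x, of v u] nabla_dh_commute[OF x, of z u] nabla_dh_commute[OF x, of z v]
    by (simp add: G_commute[of _ "\<partial> h v x"] G_commute[of _ "\<partial> h u x"])
  let ?t = "\<nabla> u (\<partial> h v) x - g x (shape x u) v *\<^sub>R n x"
  have "G (h x) (n x) ?t = 0"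
    using second_fundamental_form[OF x, of v u] n_unit[OF x]
      G_commute[of "h x" "n x" "\<nabla> u (\<partial> h v) x"] by (simp add: G_simps)
  then obtain w where w: "\<partial> h w x = ?t" using tangent_iff[OF x] by metis
  have gw: "g x w z = G (h x) (\<nabla> u (\<partial> h v) x) (\<partial> h z x)" for z
    unfolding g[OF x] w using n_normal[OF x] by (simp add: G_simps)
  have "christoffel g x u v = w"
    unfolding christoffel_def koszul
  proof (rule the_equality)
    show "\<forall>z. 2 * g x w z = 2 * G (h x) (\<nabla> u (\<partial> h v) x) (\<partial> h z x)" by (simp add: gw)
    fix w' assume "\<forall>z. 2 * g x w' z = 2 * G (h x) (\<nabla> u (\<partial> h v) x) (\<partial> h z x)"
    then have "g x w' z = g x w z" for z by (simp add: gw)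
    then have "G (h x) (\<partial> h w' x - \<partial> h w x) (\<partial> h w' x - \<partial> h w x) = 0"
      by (simp add: g[OF x] G_simps)
    then show "w' = w" using dh_eq_iff[OF x] by (simp add: G_eq_0_iff)
  qed
  then show ?thesis using w by simp
qed

lemma dh_expand: "y \<in> U \<Longrightarrow> \<partial> h w y = (\<Sum>i\<in>UNIV. w $ i *\<^sub>R \<partial> h (axis i 1) y)"
proof -
  assume y: "y \<in> U"
  have "\<partial> h w y = \<partial> h (\<Sum>i\<in>UNIV. w $ i *\<^sub>R axis i 1) y"
    using basis_expansion[of w] by (simp add: scalar_mult_eq_scaleR)
  then show ?thesis by (simp add: linear_sum[OF linear_dh[OF y]] linear_scale[OF linear_dh[OF y]])
qed

text \<open>Meant for Christoffel fields of \<open>g\<close>, whose definition by description shows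
  no regularity. A left inverse \<open>L\<close> of the differential at \<open>x\<close> alone turns
  the defining equation into a square linear system with identity matrix at \<open>x\<close>, to
  which Cramer's rule applies.\<close>

lemma tangent_field_differentiable:
  assumes x: "x \<in> U" and w: "\<And>y. y \<in> U \<Longrightarrow> \<partial> h (w y) y = \<tau> y" and \<tau>: "\<tau> differentiable (at x)"
  shows "w differentiable (at x)"
proof -
  obtain L where L: "linear L" "L \<circ> (\<lambda>u. \<partial> h u x) = id"
    using linear_injective_left_inverse[OF linear_dh[OF x] inj[OF x]] by blast
  have dL: "(\<lambda>y. L (f y)) differentiable (at x)" if "f differentiable (at x)" for f :: "real^'d \<Rightarrow> 'b"
    using that L(1) linear_conv_bounded_linear bounded_linear.has_derivative unfolding differentiable_def by blast
  define M where "M y = (\<chi> i j. L (\<partial> h (axis j 1) y) $ i)" for y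
  have LM: "M y *v v = L (\<partial> h v y)" if "y \<in> U" for y v
    by (simp add: M_def vec_eq_iff matrix_vector_mult_def dh_expand[OF that, of v] linear_sum[OF L(1)]
        linear_scale[OF L(1)] mult.commute)
  have "M x *v v = v" for v using LM[OF x] L(2) by (simp add: fun_eq_iff)
  then have "M x = mat 1" by (simp add: matrix_eq)
  then have "det (M x) \<noteq> 0" by simp
  moreover have "M differentiable (at x)"
    unfolding M_def by (intro differentiable_vec_lambda differentiable_vec_nth dL dh_diff x)
  moreover have "M y *v w y = L (\<tau> y)" if "y \<in> U" for y using LM w that by simp
  ultimately show ?thesis
    using differentiable_linear_solution[OF U x _ dL[OF \<tau>]] by blast
qed

lemma nabla_tangent_field:
  assumes x: "x \<in> U" and w: "w differentiable (at x)"
  shows "(\<lambda>y. \<partial> h (w y) y) differentiable (at x)"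
    and "\<nabla> u (\<lambda>y. \<partial> h (w y) y) x = \<partial> h (\<partial> w u x) x + \<nabla> u (\<partial> h (w x)) x"
proof -
  let ?F = "\<lambda>w y. \<Sum>i\<in>UNIV. w y $ i *\<^sub>R \<partial> h (axis i 1) y"
  have D: "(?F w has_derivative (\<lambda>u. \<Sum>i\<in>UNIV. w x $ i *\<^sub>R \<partial> (\<partial> h (axis i 1)) u x
      + \<partial> w u x $ i *\<^sub>R \<partial> h (axis i 1) x)) (at x)"
    if w: "w differentiable (at x)" for w
    by (intro has_derivative_sum has_derivative_scaleR has_derivative_frechet dh_diff x
        bounded_linear.has_derivative[OF bounded_linear_vec_nth] w)
  have eq: "\<partial> h (w y) y = ?F w y" if "y \<in> U" for y w
    using dh_expand[OF that] .
  show "(\<lambda>y. \<partial> h (w y) y) differentiable (at x)"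
    using differentiable_cong_open[OF U x, of "\<lambda>y. \<partial> h (w y) y" "?F w"] eq differentiableI[OF D[OF w]] by blast
  have D': "\<partial> (\<lambda>y. \<partial> h (w y) y) u x = (\<Sum>i\<in>UNIV. w x $ i *\<^sub>R \<partial> (\<partial> h (axis i 1)) u x
      + \<partial> w u x $ i *\<^sub>R \<partial> h (axis i 1) x)" if "w differentiable (at x)" for w
    using frechet_derivative_cong_open[OF U x, of "\<lambda>y. \<partial> h (w y) y" "?F w"] eq dirderiv_eqI[OF D[OF that]]
    by simp
  \<comment> \<open>The expansion is used twice, for \<open>w\<close> and for the constant field
    with value \<open>w x\<close>; the second use identifies the terms that do not differentiate
    \<open>w\<close>.\<close>
  have "\<partial> (\<lambda>y. \<partial> h (w y) y) u x = \<partial> (\<partial> h (w x)) u x + \<partial> h (\<partial> w u x) x"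
    using D'[OF w] D'[of "\<lambda>_. w x"] dh_expand[OF x, of "\<partial> w u x"] by (simp add: sum.distrib)
  then show "\<nabla> u (\<lambda>y. \<partial> h (w y) y) x = \<partial> h (\<partial> w u x) x + \<nabla> u (\<partial> h (w x)) x"
    by (simp add: cov_deriv_along_eq)
qed

lemma riemann_curvature_eq:
  "riemann_curvature g x u v w = \<partial> (\<lambda>y. christoffel g y v w) u x + christoffel g x u (christoffel g x v w)
    - (\<partial> (\<lambda>y. christoffel g y u w) v x + christoffel g x v (christoffel g x u w))"
proof -
  have "frechet_derivative (\<lambda>y. y) (at y) v = v" for y v :: "real^'d"
    using frechet_derivative_ident by metis
  then show ?thesis
    by (simp add: riemann_curvature_def cov_deriv_along_def)
qed

text \<open>The normal component stays an unspecified multiple of \<open>n\<close>: later the shape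
  operator is extended by zero along the normal, which removes this term.\<close>

theorem gauss_equation:
  assumes x: "x \<in> U"
  shows "\<exists>c. \<partial> h (riemann_curvature g x u v w) x = riem (h x) (\<partial> h u x) (\<partial> h v x) (\<partial> h w x)
    + g x (shape x v) w *\<^sub>R \<partial> h (shape x u) x - g x (shape x u) w *\<^sub>R \<partial> h (shape x v) x + c *\<^sub>R n x"
proof -
  have second: "\<exists>c. \<nabla> a (\<nabla> b (\<partial> h w)) x = \<partial> h (\<partial> (\<lambda>y. christoffel g y b w) a x
      + christoffel g x a (christoffel g x b w)) x - g x (shape x b) w *\<^sub>R \<partial> h (shape x a) x + c *\<^sub>R n x" for a b
  proof -
    \<comment> \<open>\<open>f\<close> is the normal component of \<nabla>
      \<open>b (\<partial> h w)\<close> and \<gamma> the coordinate vector of its tangential part.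
      Differentiability of \<open>f\<close> comes first, since \<gamma> inherits its own from the
      difference.\<close>
    define f where "f y = G (h y) (\<nabla> b (\<partial> h w) y) (n y)" for y
    define \<gamma> where "\<gamma> y = christoffel g y b w" for y
    have nd: "\<nabla> b (\<partial> h w) differentiable (at x)" by (rule nabla_differentiable[OF dh_smooth x])
    have f: "f differentiable (at x)"
      unfolding f_def by (rule dirderiv_G(1)[OF x nd n_diff[OF x]])
    have fx: "f x = g x (shape x b) w" by (simp add: f_def second_fundamental_form[OF x])
    have eq: "\<nabla> b (\<partial> h w) y = \<partial> h (\<gamma> y) y + f y *\<^sub>R n y" if "y \<in> U" for y
      unfolding f_def \<gamma>_def second_fundamental_form[OF that] by (rule gauss_formula[OF that])
    have fn: "(\<lambda>y. f y *\<^sub>R n y) differentiable (at x)"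
      using f n_diff[OF x] by (rule differentiable_scaleR)
    have \<gamma>: "\<gamma> differentiable (at x)"
    proof (rule tangent_field_differentiable[OF x])
      show "\<partial> h (\<gamma> y) y = \<nabla> b (\<partial> h w) y - f y *\<^sub>R n y" if "y \<in> U" for y using eq[OF that] by simp
      show "(\<lambda>y. \<nabla> b (\<partial> h w) y - f y *\<^sub>R n y) differentiable (at x)"
        using nd fn by (rule differentiable_diff)
    qed
    have "\<nabla> a (\<nabla> b (\<partial> h w)) x = \<nabla> a (\<lambda>y. \<partial> h (\<gamma> y) y + f y *\<^sub>R n y) x"
      by (rule nabla_cong[OF x]) (rule eq)
    also have "\<dots> = \<partial> h (\<partial> \<gamma> a x) x + \<nabla> a (\<partial> h (\<gamma> x)) x + (\<partial> f a x *\<^sub>R n x + f x *\<^sub>R \<nabla> a n x)"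
      by (simp add: nabla_add[OF nabla_tangent_field(1)[OF x \<gamma>] fn] nabla_tangent_field(2)[OF x \<gamma>]
          nabla_scaleR[OF f n_diff[OF x]])
    also have "\<nabla> a (\<partial> h (\<gamma> x)) x = \<partial> h (christoffel g x a (\<gamma> x)) x + g x (shape x a) (\<gamma> x) *\<^sub>R n x"
      by (rule gauss_formula[OF x])
    also have "\<nabla> a n x = - \<partial> h (shape x a) x" using dh_shape[OF x] by simp
    finally have "\<nabla> a (\<nabla> b (\<partial> h w)) x = \<partial> h (\<partial> \<gamma> a x + christoffel g x a (\<gamma> x)) x
        - f x *\<^sub>R \<partial> h (shape x a) x + (\<partial> f a x + g x (shape x a) (\<gamma> x)) *\<^sub>R n x"
      by (simp add: linear_add[OF linear_dh[OF x]] algebra_simps)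
    moreover have "\<gamma> = (\<lambda>y. christoffel g y b w)" by (simp add: fun_eq_iff \<gamma>_def)
    ultimately show ?thesis unfolding fx by blast
  qed
  obtain c where c: "\<nabla> u (\<nabla> v (\<partial> h w)) x = \<partial> h (\<partial> (\<lambda>y. christoffel g y v w) u x
      + christoffel g x u (christoffel g x v w)) x - g x (shape x v) w *\<^sub>R \<partial> h (shape x u) x + c *\<^sub>R n x"
    using second by blast
  obtain d where d: "\<nabla> v (\<nabla> u (\<partial> h w)) x = \<partial> h (\<partial> (\<lambda>y. christoffel g y u w) v x
      + christoffel g x v (christoffel g x u w)) x - g x (shape x u) w *\<^sub>R \<partial> h (shape x v) x + d *\<^sub>R n x"
    using second by blast
  show ?thesis
    using nabla_commutator[OF dh_smooth[of w] x, where u=u and v=v] unfolding c d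
    by (intro exI[of _ "d - c"]) (simp add: riemann_curvature_eq linear_diff[OF linear_dh[OF x]] algebra_simps)
qed

text \<open>Here \<nabla> \<open>u n\<close> = \<open>- l *\<^sub>R \<partial> h u\<close>. In the
  commutator of second derivatives of \<open>n\<close> the terms with \<nabla>
  \<open>u (\<partial> h v)\<close> cancel by symmetry, and only derivatives of \<open>l\<close>
  times tangent vectors remain.\<close>

theorem codazzi_umbilic:
  assumes x: "x \<in> U" and umb: "\<And>y u. y \<in> U \<Longrightarrow> shape y u = l y *\<^sub>R u"
  shows "\<exists>c d. riem (h x) (\<partial> h u x) (\<partial> h v x) (n x) = c *\<^sub>R \<partial> h u x + d *\<^sub>R \<partial> h v x"
proof -
  \<comment> \<open>Any nonzero vector would serve; \<open>undefined\<close> is an unspecified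
    index. Pairing \<nabla> \<open>e n\<close> with \<partial> \<open>h e\<close> presents
    \<open>- l\<close> as a quotient of differentiable functions.\<close>
  define e :: "real^'d" where "e = axis undefined 1"
  define q where "q y = G (h y) (\<partial> h e y) (\<partial> h e y)" for y
  have q: "q y \<noteq> 0" if "y \<in> U" for y
  proof -
    have "e \<noteq> 0" by (simp add: e_def axis_eq_0_iff)
    then have "\<partial> h e y \<noteq> 0"
      using dh_eq_iff[OF that, of e 0] linear_0[OF linear_dh[OF that]] by simp
    then show ?thesis by (simp add: q_def G_eq_0_iff)
  qed
  have nab: "\<nabla> a n y = (- l y) *\<^sub>R \<partial> h a y" if "y \<in> U" for a y
    using dh_shape[OF that, of a] linear_scale[OF linear_dh[OF that]] by (simp add: umb[OF that] minus_equation_iff)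
  have l_eq: "- l y = G (h y) (\<nabla> e n y) (\<partial> h e y) / q y" if "y \<in> U" for y
    using q[OF that] by (simp add: nab[OF that] G_simps q_def)
  have l: "(\<lambda>y. - l y) differentiable (at x)"
  proof (rule differentiable_cong_open[OF U x l_eq])
    show "(\<lambda>y. G (h y) (\<nabla> e n y) (\<partial> h e y) / q y) differentiable (at x)"
      unfolding q_def using q[OF x] unfolding q_def
      by (intro differentiable_divide dirderiv_G(1) x nabla_differentiable n dh_diff)
  qed
  have second: "\<nabla> a (\<nabla> b n) x = \<partial> (\<lambda>y. - l y) a x *\<^sub>R \<partial> h b x + (- l x) *\<^sub>R \<nabla> a (\<partial> h b) x" for a b
    using nabla_cong[OF x, of "\<nabla> b n" "\<lambda>y. (- l y) *\<^sub>R \<partial> h b y" a] nab nabla_scaleR[OF l dh_diff[OF x]] by simp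
  have "riem (h x) (\<partial> h u x) (\<partial> h v x) (n x)
      = \<partial> (\<lambda>y. - l y) u x *\<^sub>R \<partial> h v x - \<partial> (\<lambda>y. - l y) v x *\<^sub>R \<partial> h u x"
    unfolding nabla_commutator[OF n x, symmetric] second nabla_dh_commute[OF x, of v u] by simp
  then show ?thesis
    by (intro exI[of _ "- \<partial> (\<lambda>y. - l y) v x"] exI[of _ "\<partial> (\<lambda>y. - l y) u x"]) simp
qed

end

subsection \<open>The metric of the Grassmannian in a unitary chart\<close>

definition gram :: "complex^2^'m \<Rightarrow> complex^2^2" where
  "gram Z = mat 1 + Z\<^sup>\<dagger> ** Z"

definition gram_inv :: "complex^2^'m \<Rightarrow> complex^2^2" ("\<K>") where
  "\<K> Z = matrix_inv (gram Z)"

text \<open>The inverse of \<open>mat 1 + Z ** Z\<^sup>\<dagger>\<close>, as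
  \<open>cogram_inv_inverse\<close> confirms, expressed through the inverse \<K> of a two by two
  matrix so that only \<K> has to be differentiated from scratch.\<close>

definition cogram_inv :: "complex^2^'m \<Rightarrow> complex^'m^'m" ("\<S>") where
  "\<S> Z = mat 1 - Z ** \<K> Z ** Z\<^sup>\<dagger>"

definition q_map :: "complex^2^'m \<Rightarrow> complex^'m^2" ("\<Q>") where
  "\<Q> Z = \<K> Z ** Z\<^sup>\<dagger>"

definition G2_G :: "complex^2^'m \<Rightarrow> complex^2^'m \<Rightarrow> complex^2^'m \<Rightarrow> real" where
  "G2_G Z U V = inner U (\<S> Z ** V ** \<K> Z) / 2"

definition G2_Gamma :: "complex^2^'m \<Rightarrow> complex^2^'m \<Rightarrow> complex^2^'m \<Rightarrow> complex^2^'m" where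
  "G2_Gamma Z U V = - (U ** \<Q> Z ** V + V ** \<Q> Z ** U)"

definition D_q_map :: "complex^2^'m \<Rightarrow> complex^2^'m \<Rightarrow> complex^'m^2" where
  "D_q_map Z W = \<K> Z ** W\<^sup>\<dagger> ** \<S> Z - \<Q> Z ** W ** \<Q> Z"

definition D_G2_Gamma :: "complex^2^'m \<Rightarrow> complex^2^'m \<Rightarrow> complex^2^'m \<Rightarrow> complex^2^'m \<Rightarrow> complex^2^'m" where
  "D_G2_Gamma Z W U V = - (U ** D_q_map Z W ** V + V ** D_q_map Z W ** U)"

lemma det_gram: "det (gram Z) \<noteq> 0"
proof -
  have "x = 0" if "gram Z *v x = 0" for x
  proof -
    have "hinner (gram Z *v x) x = hinner x x + hinner (Z *v x) (Z *v x)"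
      by (simp add: gram_def matrix_vector_mult_add_rdistrib hinner_add_left matrix_vector_mul_assoc[symmetric]
          hinner_matrix_vector_left)
    then have "complex_of_real ((norm x)\<^sup>2 + (norm (Z *v x))\<^sup>2) = 0"
      using that by (simp add: hinner_self)
    then have "(norm x)\<^sup>2 + (norm (Z *v x))\<^sup>2 = 0" unfolding of_real_eq_0_iff .
    then show "x = 0" by (simp add: sum_power2_eq_zero_iff)
  qed
  then have "invertible (gram Z)"
    using matrix_left_invertible_ker invertible_left_inverse by blast
  then show ?thesis using invertible_det_nz by blast
qed

lemma gram_inv: "\<K> Z ** gram Z = mat 1" "gram Z ** \<K> Z = mat 1"
proof -
  have "invertible (gram Z)" using det_gram invertible_det_nz by blast
  then have "gram Z ** \<K> Z = mat 1 \<and> \<K> Z ** gram Z = mat 1"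
    unfolding invertible_def gram_inv_def matrix_inv_def by (rule someI_ex)
  then show "\<K> Z ** gram Z = mat 1" "gram Z ** \<K> Z = mat 1" by simp_all
qed

lemma matrix_inverse_unique:
  fixes A :: "complex^'k^'k"
  assumes "L ** A = mat 1" "A ** R = mat 1"
  shows "L = R"
proof -
  have "L = L ** (A ** R)" by (simp add: assms)
  also have "\<dots> = R" by (simp add: matrix_mul_assoc assms(1))
  finally show ?thesis .
qed

lemma gram_inv_hermitian [simp]: "(\<K> Z)\<^sup>\<dagger> = \<K> Z"
proof (rule matrix_inverse_unique)
  have "(gram Z)\<^sup>\<dagger> = gram Z" by (simp add: gram_def conj_transpose_simps)
  then show "(\<K> Z)\<^sup>\<dagger> ** gram Z = mat 1"
    using arg_cong[OF gram_inv(2)[of Z], of conj_transpose] by (simp add: conj_transpose_mult)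
qed (rule gram_inv)

lemma cogram_inv_hermitian [simp]: "(\<S> Z)\<^sup>\<dagger> = \<S> Z"
  by (simp add: cogram_inv_def conj_transpose_simps matrix_mul_assoc)

lemma q_map_adjoint: "(\<Q> Z)\<^sup>\<dagger> = Z ** \<K> Z"
  by (simp add: q_map_def conj_transpose_mult)

lemma gram_Z: "Z\<^sup>\<dagger> ** Z = gram Z - mat 1"
  by (simp add: gram_def)

lemma cogram_inv_Z: "\<S> Z ** Z = Z ** \<K> Z" "Z\<^sup>\<dagger> ** \<S> Z = \<Q> Z"
proof -
  have "\<S> Z ** Z = Z - Z ** (\<K> Z ** (Z\<^sup>\<dagger> ** Z))"
    by (simp add: cogram_inv_def matrix_distribs matrix_mul_assoc)
  then show 1: "\<S> Z ** Z = Z ** \<K> Z"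
    by (simp add: gram_Z matrix_distribs gram_inv)
  show "Z\<^sup>\<dagger> ** \<S> Z = \<Q> Z"
    using arg_cong[OF 1, of conj_transpose] by (simp add: conj_transpose_mult q_map_def)
qed

lemma cogram_inv_inverse: "\<S> Z ** (mat 1 + Z ** Z\<^sup>\<dagger>) = mat 1"
proof -
  have "\<S> Z ** (mat 1 + Z ** Z\<^sup>\<dagger>) = \<S> Z + Z ** \<K> Z ** Z\<^sup>\<dagger>"
    by (simp add: matrix_mult_add_right matrix_mul_assoc cogram_inv_Z)
  then show ?thesis by (simp add: cogram_inv_def)
qed

lemma gram_has_derivative: "(gram has_derivative (\<lambda>W. W\<^sup>\<dagger> ** Z + Z\<^sup>\<dagger> ** W)) (at Z)"
  unfolding gram_def by (auto intro!: derivative_eq_intros)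

text \<open>Cramer's rule, column by column, gives bare differentiability; differentiating
  \<open>gram Z ** \<K> Z = mat 1\<close> then yields the formula.\<close>

lemma gram_inv_has_derivative:
  "(\<K> has_derivative (\<lambda>W. - (\<K> Z ** W\<^sup>\<dagger> ** Z ** \<K> Z + \<Q> Z ** W ** \<K> Z))) (at Z)"
proof -
  have col: "(\<lambda>Y. column j (\<K> Y)) differentiable (at Z)" for j
  proof (rule differentiable_linear_solution[OF open_UNIV UNIV_I, where M=gram and b="\<lambda>_. axis j 1"])
    show "gram differentiable (at Z)" using gram_has_derivative by (rule differentiableI)
    show "gram Y *v column j (\<K> Y) = axis j 1" for Y :: "complex^2^'m"
      using arg_cong[OF gram_inv(2)[of Y], of "\<lambda>M. column j M"]
      by (simp add: vec_eq_iff column_def matrix_matrix_mult_def matrix_vector_mult_def mat_def axis_def)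
  qed (auto simp: det_gram)
  have "(\<lambda>Y. \<chi> i j. column j (\<K> Y) $ i) differentiable (at Z)"
    by (intro differentiable_vec_lambda differentiable_vec_nth col)
  then have "\<K> differentiable (at Z)" by (simp add: column_def)
  then obtain K' where K': "(\<K> has_derivative K') (at Z)" unfolding differentiable_def by blast
  have "((\<lambda>Y. gram Y ** \<K> Y) has_derivative (\<lambda>W. gram Z ** K' W + (W\<^sup>\<dagger> ** Z + Z\<^sup>\<dagger> ** W) ** \<K> Z)) (at Z)"
    by (intro has_derivative_matrix_mult gram_has_derivative K')
  moreover have "((\<lambda>Y. gram Y ** \<K> Y) has_derivative (\<lambda>W. 0)) (at Z)"
    by (simp add: gram_inv)
  ultimately have "(\<lambda>W. gram Z ** K' W + (W\<^sup>\<dagger> ** Z + Z\<^sup>\<dagger> ** W) ** \<K> Z) = (\<lambda>W. 0)"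
    by (rule has_derivative_unique)
  then have "gram Z ** K' W + (W\<^sup>\<dagger> ** Z + Z\<^sup>\<dagger> ** W) ** \<K> Z = 0" for W
    by (rule fun_cong)
  then have "gram Z ** K' W = - ((W\<^sup>\<dagger> ** Z + Z\<^sup>\<dagger> ** W) ** \<K> Z)" for W
    using eq_neg_iff_add_eq_0 by blast
  then have "\<K> Z ** (gram Z ** K' W) = - (\<K> Z ** ((W\<^sup>\<dagger> ** Z + Z\<^sup>\<dagger> ** W) ** \<K> Z))" for W
    by (simp add: matrix_distribs)
  then have "K' W = - (\<K> Z ** ((W\<^sup>\<dagger> ** Z + Z\<^sup>\<dagger> ** W) ** \<K> Z))" for W
    by (simp add: matrix_mul_assoc gram_inv)
  then have "K' = (\<lambda>W. - (\<K> Z ** W\<^sup>\<dagger> ** Z ** \<K> Z + \<Q> Z ** W ** \<K> Z))"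
    by (simp add: fun_eq_iff q_map_def matrix_distribs matrix_mul_assoc)
  with K' show ?thesis by simp
qed

lemma q_map_has_derivative: "(\<Q> has_derivative D_q_map Z) (at Z)"
proof -
  have "((\<lambda>Y. \<K> Y ** Y\<^sup>\<dagger>) has_derivative (\<lambda>W. \<K> Z ** W\<^sup>\<dagger> +
      (- (\<K> Z ** W\<^sup>\<dagger> ** Z ** \<K> Z + \<Q> Z ** W ** \<K> Z)) ** Z\<^sup>\<dagger>)) (at Z)"
    by (intro has_derivative_matrix_mult gram_inv_has_derivative has_derivative_conj_transpose has_derivative_ident)
  moreover have "\<K> Z ** W\<^sup>\<dagger> + (- (\<K> Z ** W\<^sup>\<dagger> ** Z ** \<K> Z + \<Q> Z ** W ** \<K> Z)) ** Z\<^sup>\<dagger> = D_q_map Z W" for W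
    by (simp add: D_q_map_def cogram_inv_def q_map_def matrix_distribs matrix_mul_assoc)
  ultimately show ?thesis by (simp add: q_map_def[abs_def])
qed

lemma cogram_inv_has_derivative:
  "(\<S> has_derivative (\<lambda>W. - (\<S> Z ** W ** \<Q> Z + Z ** \<K> Z ** W\<^sup>\<dagger> ** \<S> Z))) (at Z)"
proof -
  have "((\<lambda>Y. mat 1 - Y ** \<Q> Y) has_derivative (\<lambda>W. 0 - (Z ** D_q_map Z W + W ** \<Q> Z))) (at Z)"
    by (intro has_derivative_diff has_derivative_const has_derivative_matrix_mult has_derivative_ident
        q_map_has_derivative)
  moreover have "0 - (Z ** D_q_map Z W + W ** \<Q> Z) = - (\<S> Z ** W ** \<Q> Z + Z ** \<K> Z ** W\<^sup>\<dagger> ** \<S> Z)" for W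
    by (simp add: D_q_map_def cogram_inv_def q_map_def matrix_distribs matrix_mul_assoc)
  ultimately show ?thesis by (simp add: q_map_def cogram_inv_def[abs_def] matrix_mul_assoc)
qed

text \<open>Inserting \<open>mat 1 + Z ** Z\<^sup>\<dagger>\<close> between two copies of \<S>
  writes \<S> as a sum of two squares, the first of which is invertible. \<open>G2_G_pos\<close>
  treats \<K> in the same way.\<close>

lemma inner_cogram_inv_pos:
  fixes V :: "complex^'k^'m"
  assumes "V \<noteq> 0"
  shows "inner V (\<S> Z ** V) > 0"
proof -
  have S: "\<S> Z = \<S> Z ** \<S> Z + \<S> Z ** Z ** (\<S> Z ** Z)\<^sup>\<dagger>"
  proof -
    have "\<S> Z = \<S> Z ** (mat 1 + Z ** Z\<^sup>\<dagger>) ** \<S> Z" by (simp add: cogram_inv_inverse)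
    also have "\<dots> = \<S> Z ** \<S> Z + \<S> Z ** Z ** (\<S> Z ** Z)\<^sup>\<dagger>"
      by (simp add: matrix_mult_add_left matrix_mult_add_right conj_transpose_mult matrix_mul_assoc)
    finally show ?thesis .
  qed
  have "inner V (\<S> Z ** V) = inner V ((\<S> Z ** \<S> Z + \<S> Z ** Z ** (\<S> Z ** Z)\<^sup>\<dagger>) ** V)"
    using S by simp
  also have "\<dots> = inner V (\<S> Z ** (\<S> Z ** V)) + inner V (\<S> Z ** Z ** ((\<S> Z ** Z)\<^sup>\<dagger> ** V))"
    by (simp add: matrix_mult_add_left inner_add_right matrix_mul_assoc)
  also have "\<dots> = inner (\<S> Z ** V) (\<S> Z ** V) + inner ((\<S> Z ** Z)\<^sup>\<dagger> ** V) ((\<S> Z ** Z)\<^sup>\<dagger> ** V)"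
    using inner_matrix_mult_left[of "\<S> Z" V "\<S> Z ** V"]
      inner_matrix_mult_left[of "(\<S> Z ** Z)\<^sup>\<dagger>" V "(\<S> Z ** Z)\<^sup>\<dagger> ** V"] by simp
  also have "\<dots> > 0"
  proof -
    have "(mat 1 + Z ** Z\<^sup>\<dagger>) ** (\<S> Z ** V) = V"
      using matrix_left_right_inverse[THEN iffD1, OF cogram_inv_inverse[of Z]] by (simp add: matrix_mul_assoc)
    then have "\<S> Z ** V \<noteq> 0" using assms by auto
    then show ?thesis by (simp add: add_pos_nonneg)
  qed
  finally show ?thesis .
qed

lemma G2_G_pos:
  assumes "U \<noteq> 0"
  shows "G2_G Z U U > 0"
proof -
  have K: "\<K> Z = \<K> Z ** \<K> Z + (Z ** \<K> Z)\<^sup>\<dagger> ** (Z ** \<K> Z)"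
  proof -
    have "\<K> Z = \<K> Z ** gram Z ** \<K> Z" by (simp add: gram_inv)
    also have "\<dots> = \<K> Z ** \<K> Z + (Z ** \<K> Z)\<^sup>\<dagger> ** (Z ** \<K> Z)"
      by (simp add: gram_def matrix_mult_add_left matrix_mult_add_right conj_transpose_mult matrix_mul_assoc)
    finally show ?thesis .
  qed
  have "inner U (\<S> Z ** U ** \<K> Z) = inner U (\<S> Z ** U ** (\<K> Z ** \<K> Z + (Z ** \<K> Z)\<^sup>\<dagger> ** (Z ** \<K> Z)))"
    using K by simp
  also have "\<dots> = inner U (\<S> Z ** (U ** \<K> Z) ** \<K> Z)
      + inner U (\<S> Z ** (U ** (Z ** \<K> Z)\<^sup>\<dagger>) ** (Z ** \<K> Z))"
    by (simp add: matrix_mult_add_right inner_add_right matrix_mul_assoc)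
  also have "\<dots> = inner (U ** \<K> Z) (\<S> Z ** (U ** \<K> Z))
      + inner (U ** (Z ** \<K> Z)\<^sup>\<dagger>) (\<S> Z ** (U ** (Z ** \<K> Z)\<^sup>\<dagger>))"
    using inner_matrix_mult_right[of U "\<K> Z" "\<S> Z ** (U ** \<K> Z)"]
      inner_matrix_mult_right[of U "(Z ** \<K> Z)\<^sup>\<dagger>" "\<S> Z ** (U ** (Z ** \<K> Z)\<^sup>\<dagger>)"] by simp
  also have "\<dots> > 0"
  proof (rule add_pos_nonneg)
    have "U ** \<K> Z ** gram Z = U" by (simp add: matrix_mul_assoc[symmetric] gram_inv)
    then have "U ** \<K> Z \<noteq> 0" using assms by auto
    then show "inner (U ** \<K> Z) (\<S> Z ** (U ** \<K> Z)) > 0" by (rule inner_cogram_inv_pos)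
    show "inner (U ** (Z ** \<K> Z)\<^sup>\<dagger>) (\<S> Z ** (U ** (Z ** \<K> Z)\<^sup>\<dagger>)) \<ge> 0"
      using inner_cogram_inv_pos[of "U ** (Z ** \<K> Z)\<^sup>\<dagger>" Z] by (cases "U ** (Z ** \<K> Z)\<^sup>\<dagger> = 0") auto
  qed
  finally show ?thesis by (simp add: G2_G_def)
qed

text \<open>Differentiating \<S> and \<K> yields four terms. Two are the action of
  \<open>G2_Gamma z w\<close> on \<open>v\<close>; the other two, moved across the inner product by
  adjoints, are its action on \<open>u\<close>. This is the origin of the formula for
  \<open>G2_Gamma\<close>.\<close>

lemma G2_G_compatible:
  "((\<lambda>(z, u, v). G2_G z u v) has_derivative
    (\<lambda>(w, u', v'). G2_G z (u' + G2_Gamma z w u) v + G2_G z u (v' + G2_Gamma z w v))) (at (z, u, v))"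
proof -
  let ?S' = "\<lambda>w. - (\<S> z ** w ** \<Q> z + z ** \<K> z ** w\<^sup>\<dagger> ** \<S> z)"
  let ?K' = "\<lambda>w. - (\<K> z ** w\<^sup>\<dagger> ** z ** \<K> z + \<Q> z ** w ** \<K> z)"
  have fst: "(fst has_derivative fst) (at (z, u, v))"
    by (rule bounded_linear_imp_has_derivative) (rule bounded_linear_fst)
  have snd: "(snd has_derivative snd) (at (z, u, v))"
    by (rule bounded_linear_imp_has_derivative) (rule bounded_linear_snd)
  have S: "((\<lambda>p. \<S> (fst p)) has_derivative (\<lambda>p. ?S' (fst p))) (at (z, u, v))"
    using has_derivative_compose[OF fst, of \<S> ?S'] cogram_inv_has_derivative[of z] by simp
  have K: "((\<lambda>p. \<K> (fst p)) has_derivative (\<lambda>p. ?K' (fst p))) (at (z, u, v))"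
    using has_derivative_compose[OF fst, of \<K> ?K'] gram_inv_has_derivative[of z] by simp
  have D: "((\<lambda>p. inner (fst (snd p)) (\<S> (fst p) ** snd (snd p) ** \<K> (fst p))) has_derivative
      (\<lambda>p. inner u (\<S> z ** v ** ?K' (fst p) + (\<S> z ** snd (snd p) + ?S' (fst p) ** v) ** \<K> z)
        + inner (fst (snd p)) (\<S> z ** v ** \<K> z))) (at (z, u, v))"
    using has_derivative_inner[OF has_derivative_fst[OF snd]
        has_derivative_matrix_mult[OF has_derivative_matrix_mult[OF S has_derivative_snd[OF snd]] K]] by simp
  have key: "inner u (\<S> z ** v ** ?K' w + (\<S> z ** v' + ?S' w ** v) ** \<K> z) + inner u' (\<S> z ** v ** \<K> z)
      = inner (u' + G2_Gamma z w u) (\<S> z ** v ** \<K> z) + inner u (\<S> z ** (v' + G2_Gamma z w v) ** \<K> z)"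
    for w u' v'
  proof -
    have "inner (w ** \<Q> z ** u) (\<S> z ** v ** \<K> z) = inner u (z ** \<K> z ** w\<^sup>\<dagger> ** \<S> z ** v ** \<K> z)"
      by (simp add: inner_matrix_mult_left conj_transpose_mult q_map_adjoint matrix_mul_assoc)
    moreover have "inner (u ** \<Q> z ** w) (\<S> z ** v ** \<K> z) = inner u (\<S> z ** v ** \<K> z ** w\<^sup>\<dagger> ** z ** \<K> z)"
      by (simp add: inner_matrix_mult_right q_map_adjoint matrix_mul_assoc)
    ultimately show ?thesis
      by (simp add: G2_Gamma_def inner_add_left inner_add_right inner_minus_left inner_minus_right
          inner_diff_left inner_diff_right matrix_distribs matrix_mul_assoc)
  qed
  have "((\<lambda>(z, u, v). inner u (\<S> z ** v ** \<K> z)) has_derivative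
    (\<lambda>(w, u', v'). inner (u' + G2_Gamma z w u) (\<S> z ** v ** \<K> z) + inner u (\<S> z ** (v' + G2_Gamma z w v) ** \<K> z)))
    (at (z, u, v))"
    using D unfolding key case_prod_beta .
  from has_derivative_mult_left[OF this, of "1 / 2"] show ?thesis
    by (simp add: G2_G_def case_prod_beta' algebra_simps add_divide_distrib)
qed

lemma G2_Gamma_derivative:
  "((\<lambda>(z, u, v). G2_Gamma z u v) has_derivative
    (\<lambda>(w, u', v'). D_G2_Gamma z w u v + G2_Gamma z u' v + G2_Gamma z u v')) (at (z, u, v))"
proof -
  have fst: "(fst has_derivative fst) (at (z, u, v))"
    by (rule bounded_linear_imp_has_derivative) (rule bounded_linear_fst)
  have snd: "(snd has_derivative snd) (at (z, u, v))"
    by (rule bounded_linear_imp_has_derivative) (rule bounded_linear_snd)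
  note u = has_derivative_fst[OF snd] and v = has_derivative_snd[OF snd]
  have Q: "((\<lambda>p. \<Q> (fst p)) has_derivative (\<lambda>p. D_q_map z (fst p))) (at (z, u, v))"
    using has_derivative_compose[OF fst, of \<Q> "D_q_map z"] q_map_has_derivative[of z] by simp
  have D: "((\<lambda>p. - (fst (snd p) ** \<Q> (fst p) ** snd (snd p) + snd (snd p) ** \<Q> (fst p) ** fst (snd p)))
    has_derivative (\<lambda>p. - ((u ** \<Q> z ** snd (snd p) + (u ** D_q_map z (fst p) + fst (snd p) ** \<Q> z) ** v)
      + (v ** \<Q> z ** fst (snd p) + (v ** D_q_map z (fst p) + snd (snd p) ** \<Q> z) ** u)))) (at (z, u, v))"
    using has_derivative_minus[OF has_derivative_add[OF
        has_derivative_matrix_mult[OF has_derivative_matrix_mult[OF u Q] v]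
        has_derivative_matrix_mult[OF has_derivative_matrix_mult[OF v Q] u]]] by simp
  have key: "- ((u ** \<Q> z ** v' + (u ** D_q_map z w + u' ** \<Q> z) ** v)
      + (v ** \<Q> z ** u' + (v ** D_q_map z w + v' ** \<Q> z) ** u))
    = D_G2_Gamma z w u v + G2_Gamma z u' v + G2_Gamma z u v'" for w u' v'
    by (simp add: D_G2_Gamma_def G2_Gamma_def matrix_distribs)
  show ?thesis
    using D unfolding key G2_Gamma_def[symmetric] case_prod_beta .
qed

interpretation G2: ambient_metric G2_G G2_Gamma D_G2_Gamma
proof
  show "bilinear (G2_G z)" for z :: "complex^2^'m"
    by (auto simp: bilinear_def G2_G_def inner_add_left inner_add_right matrix_distribs add_divide_distrib
        intro!: linearI)
  show "G2_G z u v = G2_G z v u" for z u v :: "complex^2^'m"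
    using inner_matrix_mult_right[of "\<S> z ** u" "\<K> z" v] inner_matrix_mult_left[of "\<S> z" u "v ** \<K> z"]
    by (simp add: G2_G_def inner_commute[of v] matrix_mul_assoc)
  show "bilinear (G2_Gamma z)" for z :: "complex^2^'m"
    by (auto simp: bilinear_def G2_Gamma_def matrix_distribs algebra_simps intro!: linearI)
  show "G2_Gamma z u v = G2_Gamma z v u" for z u v :: "complex^2^'m"
    by (simp add: G2_Gamma_def)
qed (fact G2_G_pos G2_G_compatible G2_Gamma_derivative)+

text \<open>The quadratic terms in \<open>G2_Gamma\<close> cancel the
  \<open>\<Q> ** W ** \<Q>\<close> part of the derivative of \<Q>, leaving only the part with \<K>
  and \<S>.\<close>

lemma G2_riem:
  "G2.riem Z U V W = U ** \<K> Z ** V\<^sup>\<dagger> ** \<S> Z ** W + W ** \<K> Z ** V\<^sup>\<dagger> ** \<S> Z ** U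
    - V ** \<K> Z ** U\<^sup>\<dagger> ** \<S> Z ** W - W ** \<K> Z ** U\<^sup>\<dagger> ** \<S> Z ** V"
  unfolding G2.riem_def D_G2_Gamma_def D_q_map_def G2_Gamma_def
  by (simp add: matrix_distribs matrix_mul_assoc algebra_simps)

section \<open>Unitary charts of the Grassmannian\<close>

lemma unitary_frame_simps:
  assumes "unitary_frame B C"
  shows "B\<^sup>\<dagger> ** B = mat 1" "C\<^sup>\<dagger> ** C = mat 1" "B\<^sup>\<dagger> ** C = 0" "C\<^sup>\<dagger> ** B = 0"
    "B ** B\<^sup>\<dagger> + C ** C\<^sup>\<dagger> = mat 1"
    "B\<^sup>\<dagger> ** (B + C ** Z) = mat 1" "C\<^sup>\<dagger> ** (B + C ** Z) = Z"
    "(B + C ** Z)\<^sup>\<dagger> ** (B + C ** Z) = gram Z"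
    "(B + C ** Z)\<^sup>\<dagger> ** C = Z\<^sup>\<dagger>"
  using assms by (simp_all add: unitary_frame_def gram_def conj_transpose_simps matrix_distribs
      matrix_mul_assoc) (simp_all add: matrix_mul_assoc[symmetric])

lemma inj_matrix_left_inverse:
  fixes A :: "complex^'k^'n" and L :: "complex^'n^'k"
  assumes "L ** A = mat 1"
  shows "inj ((*v) A)"
  by (metis assms injI matrix_vector_mul_assoc matrix_vector_mul_lid)

lemma proj_matrix_range:
  fixes F :: "complex^2^'n"
  assumes "K ** (F\<^sup>\<dagger> ** F) = mat 1" "(F\<^sup>\<dagger> ** F) ** K = mat 1"
  shows "proj_matrix (range ((*v) F)) = F ** K ** F\<^sup>\<dagger>"
proof -
  have "orth_proj (range ((*v) F)) x = (F ** K ** F\<^sup>\<dagger>) *v x" for x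
    unfolding orth_proj_def
  proof (rule the_equality)
    have "F\<^sup>\<dagger> *v (x - (F ** K ** F\<^sup>\<dagger>) *v x) = 0"
      using assms(2) by (simp add: matrix_vector_mult_diff_distrib matrix_vector_mul_assoc matrix_mul_assoc)
    then have "hinner (x - (F ** K ** F\<^sup>\<dagger>) *v x) (F *v v) = 0" for v
      using hinner_matrix_vector_left[of "F\<^sup>\<dagger>" "x - (F ** K ** F\<^sup>\<dagger>) *v x" v] by simp
    moreover have "(F ** K ** F\<^sup>\<dagger>) *v x \<in> range ((*v) F)"
      by (simp add: matrix_vector_mul_assoc[symmetric])
    ultimately show "(F ** K ** F\<^sup>\<dagger>) *v x \<in> range ((*v) F) \<and>
        (\<forall>w\<in>range ((*v) F). hinner (x - (F ** K ** F\<^sup>\<dagger>) *v x) w = 0)" by blast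
    fix y assume y: "y \<in> range ((*v) F) \<and> (\<forall>w\<in>range ((*v) F). hinner (x - y) w = 0)"
    then obtain v where v: "y = F *v v" by blast
    have "hinner (F\<^sup>\<dagger> *v (x - y)) (F\<^sup>\<dagger> *v (x - y)) = 0"
      using y hinner_matrix_vector_left[of "F\<^sup>\<dagger>" "x - y" "F\<^sup>\<dagger> *v (x - y)"] by simp
    then have "F\<^sup>\<dagger> *v x = (F\<^sup>\<dagger> ** F) *v v"
      by (simp add: v matrix_vector_mult_diff_distrib matrix_vector_mul_assoc)
    then have "K *v (F\<^sup>\<dagger> *v x) = v"
      by (simp add: matrix_vector_mul_assoc assms(1))
    then show "y = (F ** K ** F\<^sup>\<dagger>) *v x" by (simp add: v matrix_vector_mul_assoc[symmetric])
  qed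
  then have "orth_proj (range ((*v) F)) = (*v) (F ** K ** F\<^sup>\<dagger>)" by (simp add: fun_eq_iff)
  then show ?thesis
    unfolding proj_matrix_def by simp
qed

lemma range_in_G2:
  fixes F :: "complex^2^'n"
  assumes "inj ((*v) F)"
  shows "range ((*v) F) \<in> G2"
proof -
  have "vec.dim (range ((*v) F)) = vec.dim (UNIV :: (complex^2) set)"
    by (rule vec.dim_image_eq[OF matrix_vector_mul_linear_gen]) (use assms in \<open>simp add: inj_on_subset\<close>)
  moreover have "vec.subspace (range ((*v) F))"
    using vec.subspace_image[OF vec.subspace_UNIV] by blast
  ultimately show ?thesis
    by (simp add: G2_def card_cart_basis)
qed

lemma G2_param_eq: "G2_param B C Z = range ((*v) (B + C ** Z))"
  by (simp add: G2_param_def)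

context
  fixes B :: "complex^2^'n" and C :: "complex^'m^'n"
  assumes BC: "unitary_frame B C"
begin

lemma complementary_unitary: "complementary_frames B C"
proof -
  have "bij (\<lambda>(x, y). B *v x + C *v y)"
  proof (rule o_bij[where g = "\<lambda>z. (B\<^sup>\<dagger> *v z, C\<^sup>\<dagger> *v z)"])
    show "(\<lambda>z. (B\<^sup>\<dagger> *v z, C\<^sup>\<dagger> *v z)) \<circ> (\<lambda>(x, y). B *v x + C *v y) = id"
      by (auto simp: fun_eq_iff matrix_vector_right_distrib matrix_vector_mul_assoc unitary_frame_simps[OF BC])
    show "(\<lambda>(x, y). B *v x + C *v y) \<circ> (\<lambda>z. (B\<^sup>\<dagger> *v z, C\<^sup>\<dagger> *v z)) = id"
      by (auto simp: fun_eq_iff matrix_vector_mul_assoc matrix_vector_mult_add_rdistrib[symmetric]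
          unitary_frame_simps[OF BC])
  qed
  then show ?thesis by (simp add: complementary_frames_def)
qed

lemma inj_G2_param: "inj (G2_param B C)"
proof (rule injI)
  fix Z Z' assume eq: "G2_param B C Z = G2_param B C Z'"
  have "Z *v x = Z' *v x" for x
  proof -
    obtain y where y: "(B + C ** Z) *v x = (B + C ** Z') *v y" using eq by (auto simp: G2_param_eq)
    have "B\<^sup>\<dagger> *v ((B + C ** Z) *v x) = B\<^sup>\<dagger> *v ((B + C ** Z') *v y)" by (simp add: y)
    then have "x = y" by (simp add: matrix_vector_mul_assoc unitary_frame_simps[OF BC])
    have "C\<^sup>\<dagger> *v ((B + C ** Z) *v x) = C\<^sup>\<dagger> *v ((B + C ** Z') *v y)" by (simp add: y)
    then show ?thesis using \<open>x = y\<close> by (simp add: matrix_vector_mul_assoc unitary_frame_simps[OF BC])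
  qed
  then show "Z = Z'" by (simp add: matrix_eq)
qed

lemma chart_inv_G2: "chart_inv (range (G2_param B C), inv (G2_param B C)) = G2_param B C"
proof
  fix Z
  have "inj_on (inv (G2_param B C)) (range (G2_param B C))"
    by (intro inj_on_inv_into) simp
  then show "chart_inv (range (G2_param B C), inv (G2_param B C)) Z = G2_param B C Z"
    using inv_into_f_f[of "inv (G2_param B C)" "range (G2_param B C)" "G2_param B C Z"]
    by (simp add: chart_inv_def inv_f_f[OF inj_G2_param])
qed

lemma proj_matrix_G2_param:
  "proj_matrix (G2_param B C Z) = (B + C ** Z) ** \<K> Z ** (B + C ** Z)\<^sup>\<dagger>"
  unfolding G2_param_eq by (rule proj_matrix_range) (simp_all add: unitary_frame_simps[OF BC] gram_inv)

text \<open>With \<open>F = B + C ** Z\<close>, \<open>\<Q> Z\<close> equals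
  \<open>\<K> Z ** F\<^sup>\<dagger> ** C\<close>, so the first factor is the component of
  \<open>C\<close> orthogonal to the plane. The term from the derivative of
  \<open>F\<^sup>\<dagger>\<close> cancels one half of the derivative of \<K>, because
  \<open>C\<^sup>\<dagger> ** F = Z\<close>.\<close>

lemma tangent_hom_G2:
  "tangent_hom (range (G2_param B C), inv (G2_param B C)) Z U
    = (C - (B + C ** Z) ** \<Q> Z) ** U ** \<K> Z ** (B + C ** Z)\<^sup>\<dagger>"
proof -
  define F where "F Y = B + C ** Y" for Y
  have FF: "(F Z)\<^sup>\<dagger> ** F Z = gram Z" "C\<^sup>\<dagger> ** F Z = Z"
    by (simp_all add: F_def unitary_frame_simps[OF BC])
  have F: "(F has_derivative (\<lambda>W. C ** W)) (at Z)"
    unfolding F_def by (auto intro!: derivative_eq_intros)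
  note D = has_derivative_matrix_mult[OF has_derivative_matrix_mult[OF F gram_inv_has_derivative]
      has_derivative_conj_transpose[OF F]]
  have "tangent_hom (range (G2_param B C), inv (G2_param B C)) Z U =
    (F Z ** \<K> Z ** (C ** U)\<^sup>\<dagger> + (F Z ** - (\<K> Z ** U\<^sup>\<dagger> ** Z ** \<K> Z + \<Q> Z ** U ** \<K> Z)
      + C ** U ** \<K> Z) ** (F Z)\<^sup>\<dagger>) ** (F Z ** \<K> Z ** (F Z)\<^sup>\<dagger>)"
    unfolding tangent_hom_def chart_inv_G2 proj_matrix_G2_param F_def[symmetric]
    by (simp add: frechet_derivative_at[OF D, symmetric])
  also have "\<dots> = F Z ** \<K> Z ** U\<^sup>\<dagger> ** (C\<^sup>\<dagger> ** F Z) ** \<K> Z ** (F Z)\<^sup>\<dagger>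
      + (F Z ** - (\<K> Z ** U\<^sup>\<dagger> ** Z ** \<K> Z + \<Q> Z ** U ** \<K> Z) + C ** U ** \<K> Z)
        ** (((F Z)\<^sup>\<dagger> ** F Z) ** \<K> Z) ** (F Z)\<^sup>\<dagger>"
    by (simp add: matrix_mult_add_left conj_transpose_mult matrix_mul_assoc)
  also have "\<dots> = (C - F Z ** \<Q> Z) ** U ** \<K> Z ** (F Z)\<^sup>\<dagger>"
    by (simp add: FF gram_inv matrix_distribs matrix_mul_assoc)
  finally show ?thesis by (simp add: F_def)
qed

lemma G2_metric_eq: "G2_metric (range (G2_param B C), inv (G2_param B C)) = G2_G"
proof (intro ext)
  fix Z U V :: "complex^2^'m"
  define F where "F = B + C ** Z"
  have FF: "F\<^sup>\<dagger> ** F = gram Z" "C\<^sup>\<dagger> ** F = Z" "F\<^sup>\<dagger> ** C = Z\<^sup>\<dagger>" "C\<^sup>\<dagger> ** C = mat 1"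
    by (simp_all add: F_def unitary_frame_simps[OF BC])
  let ?E = "C - F ** \<Q> Z"
  have "?E\<^sup>\<dagger> ** ?E = C\<^sup>\<dagger> ** C - (C\<^sup>\<dagger> ** F) ** \<Q> Z - (\<Q> Z)\<^sup>\<dagger> ** (F\<^sup>\<dagger> ** C)
      + (\<Q> Z)\<^sup>\<dagger> ** (F\<^sup>\<dagger> ** F) ** \<Q> Z"
    by (simp add: conj_transpose_simps matrix_distribs matrix_mul_assoc)
  also have "(\<Q> Z)\<^sup>\<dagger> ** (F\<^sup>\<dagger> ** F) ** \<Q> Z = Z ** (\<K> Z ** gram Z) ** \<K> Z ** Z\<^sup>\<dagger>"
    by (simp add: FF q_map_adjoint matrix_mul_assoc) (simp add: q_map_def matrix_mul_assoc)
  finally have EE: "?E\<^sup>\<dagger> ** ?E = \<S> Z"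
    by (simp add: FF gram_inv q_map_adjoint) (simp add: q_map_def cogram_inv_def matrix_mul_assoc)
  have "G2_metric (range (G2_param B C), inv (G2_param B C)) Z U V
      = inner (?E ** U ** \<K> Z ** F\<^sup>\<dagger>) (?E ** V ** \<K> Z ** F\<^sup>\<dagger>) / 2"
    unfolding G2_metric_def tangent_hom_G2 F_def[symmetric] Re_trace_conj_transpose_mult ..
  also have "inner (?E ** U ** \<K> Z ** F\<^sup>\<dagger>) (?E ** V ** \<K> Z ** F\<^sup>\<dagger>)
      = inner U ((?E\<^sup>\<dagger> ** ?E) ** V ** \<K> Z ** (F\<^sup>\<dagger> ** F) ** \<K> Z)"
    using inner_matrix_mult_right[of "?E ** U ** \<K> Z" "F\<^sup>\<dagger>"] inner_matrix_mult_right[of "?E ** U" "\<K> Z"]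
      inner_matrix_mult_left[of ?E U]
    by (simp add: matrix_mul_assoc)
  also have "\<dots> = inner U (\<S> Z ** V ** \<K> Z ** (gram Z ** \<K> Z))"
    by (simp only: EE FF matrix_mul_assoc)
  finally show "G2_metric (range (G2_param B C), inv (G2_param B C)) Z U V = G2_G Z U V"
    by (simp add: gram_inv G2_G_def)
qed

text \<open>The factors are read off from a second unitary frame centred at the given plane, which
  avoids square roots of positive matrices. Since \<open>F = B' ** \<beta>\<close> and
  \<open>B'\<close> is isometric, \<open>gram Z\<close> is
  \<open>\<beta>\<^sup>\<dagger> ** \<beta>\<close>, and \<open>b\<close> is the inverse of
  \<beta>.\<close>

lemma adapted_frame_factor:
  fixes B' :: "complex^2^'n" and C' :: "complex^'m^'n"
  assumes BC': "unitary_frame B' C'" and W: "range ((*v) B') = G2_param B C Z"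
  shows "\<exists>(a :: complex^'m^'m) (b :: complex^2^2) a' b'. \<S> Z = a\<^sup>\<dagger> ** a \<and> \<K> Z = b ** b\<^sup>\<dagger> \<and> a' ** a = mat 1 \<and> a ** a' = mat 1 \<and>
    b ** b' = mat 1 \<and> b' ** b = mat 1"
proof -
  define F where "F = B + C ** Z"
  define \<beta> where "\<beta> = B'\<^sup>\<dagger> ** F"
  have "(B' ** \<beta>) *v x = F *v x" for x
  proof -
    have "F *v x \<in> range ((*v) B')" unfolding W G2_param_eq F_def by simp
    then obtain y where y: "F *v x = B' *v y" by blast
    have "(B' ** \<beta>) *v x = B' *v (B'\<^sup>\<dagger> *v (F *v x))"
      by (simp add: \<beta>_def matrix_vector_mul_assoc matrix_mul_assoc)
    also have "\<dots> = B' *v y"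
      unfolding y by (simp add: matrix_vector_mul_assoc matrix_mul_assoc[symmetric] unitary_frame_simps[OF BC'])
    finally show ?thesis by (simp add: y)
  qed
  then have B'\<beta>: "B' ** \<beta> = F" by (simp add: matrix_eq)
  have "(B\<^sup>\<dagger> ** B') ** \<beta> = mat 1"
    by (simp add: matrix_mul_assoc[symmetric] B'\<beta>) (simp add: F_def unitary_frame_simps[OF BC])
  then obtain b where b: "b ** \<beta> = mat 1" "\<beta> ** b = mat 1" using matrix_left_right_inverse by blast
  have gram: "gram Z = \<beta>\<^sup>\<dagger> ** \<beta>"
  proof -
    have "gram Z = (B' ** \<beta>)\<^sup>\<dagger> ** (B' ** \<beta>)"
      unfolding B'\<beta> by (simp add: F_def unitary_frame_simps[OF BC])
    also have "\<dots> = \<beta>\<^sup>\<dagger> ** (B'\<^sup>\<dagger> ** B') ** \<beta>" by (simp add: conj_transpose_mult matrix_mul_assoc)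
    finally show ?thesis by (simp add: unitary_frame_simps[OF BC'])
  qed
  have "b ** b\<^sup>\<dagger> = \<K> Z"
  proof (rule matrix_inverse_unique)
    have "b ** b\<^sup>\<dagger> ** gram Z = b ** (\<beta> ** b)\<^sup>\<dagger> ** \<beta>"
      unfolding gram by (simp add: conj_transpose_mult matrix_mul_assoc)
    then show "b ** b\<^sup>\<dagger> ** gram Z = mat 1" by (simp add: b)
  qed (rule gram_inv)
  define a where "a = C'\<^sup>\<dagger> ** C"
  have "C'\<^sup>\<dagger> ** F = (C'\<^sup>\<dagger> ** B') ** \<beta>" by (simp add: B'\<beta>[symmetric] matrix_mul_assoc)
  then have "C'\<^sup>\<dagger> ** B + a ** Z = 0"
    by (simp add: F_def a_def unitary_frame_simps(3,4)[OF BC'] matrix_mult_add_right matrix_mul_assoc)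
  then have C'B: "C'\<^sup>\<dagger> ** B = - (a ** Z)" by (simp add: eq_neg_iff_add_eq_0)
  \<comment> \<open>Resolving the identity in the old frame, where \<open>C'\<close> being
    orthogonal to the plane has replaced \<open>C'\<^sup>\<dagger> ** B\<close> by
    \<open>- (a ** Z)\<close>, shows that \<open>a\<close> inverts the factor needed for
    \<S>.\<close>
  have "mat 1 = C'\<^sup>\<dagger> ** (B ** B\<^sup>\<dagger> + C ** C\<^sup>\<dagger>) ** C'"
    by (simp add: unitary_frame_simps[OF BC] unitary_frame_simps[OF BC'])
  also have "\<dots> = (C'\<^sup>\<dagger> ** B) ** (C'\<^sup>\<dagger> ** B)\<^sup>\<dagger> + a ** a\<^sup>\<dagger>"
    by (simp add: a_def matrix_mult_add_left matrix_mult_add_right conj_transpose_mult matrix_mul_assoc)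
  also have "\<dots> = a ** ((mat 1 + Z ** Z\<^sup>\<dagger>) ** a\<^sup>\<dagger>)"
    unfolding C'B by (simp add: matrix_distribs conj_transpose_simps matrix_mul_assoc)
  finally have a: "a ** ((mat 1 + Z ** Z\<^sup>\<dagger>) ** a\<^sup>\<dagger>) = mat 1" by simp
  then have a': "((mat 1 + Z ** Z\<^sup>\<dagger>) ** a\<^sup>\<dagger>) ** a = mat 1"
    using matrix_left_right_inverse by blast
  have "\<S> Z = \<S> Z ** (((mat 1 + Z ** Z\<^sup>\<dagger>) ** a\<^sup>\<dagger>) ** a)" by (simp add: a')
  also have "\<dots> = (\<S> Z ** (mat 1 + Z ** Z\<^sup>\<dagger>)) ** a\<^sup>\<dagger> ** a" by (simp add: matrix_mul_assoc)
  finally have "\<S> Z = a\<^sup>\<dagger> ** a" by (simp add: cogram_inv_inverse)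
  with \<open>b ** b\<^sup>\<dagger> = \<K> Z\<close> a a' b show ?thesis
    by (intro exI[of _ a] exI[of _ b] exI[of _ "(mat 1 + Z ** Z\<^sup>\<dagger>) ** a\<^sup>\<dagger>"] exI[of _ \<beta>] conjI) simp_all
qed

text \<open>A plane is a graph over the range of \<open>B\<close> exactly when its projection to
  that range is bijective. The condition is phrased through \<open>proj_matrix\<close>, along which
  the topology is pulled back, so that openness of the chart domain follows from continuity of the
  determinant.\<close>

lemma G2_param_iff_det:
  assumes W: "W \<in> G2" and card: "CARD('n) = CARD('m) + 2"
  shows "W \<in> range (G2_param B C) \<longleftrightarrow> det (B\<^sup>\<dagger> ** proj_matrix W ** B) \<noteq> 0"
proof -
  obtain B' and C' :: "complex^'m^'n" where BC': "unitary_frame B' C'" and W_eq: "range ((*v) B') = W"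
    using adapted_unitary_frame[OF W card] by blast
  have "proj_matrix W = B' ** mat 1 ** B'\<^sup>\<dagger>"
    unfolding W_eq[symmetric] by (rule proj_matrix_range) (simp_all add: unitary_frame_simps[OF BC'])
  then have "B\<^sup>\<dagger> ** proj_matrix W ** B = (B\<^sup>\<dagger> ** B') ** (B\<^sup>\<dagger> ** B')\<^sup>\<dagger>"
    by (simp add: conj_transpose_mult matrix_mul_assoc)
  moreover have "det (M\<^sup>\<dagger>) = cnj (det M)" for M :: "complex^2^2"
    by (simp add: det_2 mult.commute)
  ultimately have det: "det (B\<^sup>\<dagger> ** proj_matrix W ** B) \<noteq> 0 \<longleftrightarrow> det (B\<^sup>\<dagger> ** B') \<noteq> 0"
    by (simp add: det_mul)
  show ?thesis
  proof
    assume "W \<in> range (G2_param B C)"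
    then obtain Z where Z: "W = range ((*v) (B + C ** Z))" by (auto simp: G2_param_eq)
    have "\<exists>y. (B + C ** Z) *v x = B' *v y" for x using Z W_eq by blast
    then have "x \<in> range ((*v) (B\<^sup>\<dagger> ** B'))" for x
      by (metis (no_types, lifting) matrix_vector_mul_assoc matrix_vector_mul_lid rangeI unitary_frame_simps(6)[OF BC])
    then have "surj ((*v) (B\<^sup>\<dagger> ** B'))" by blast
    then have "invertible (B\<^sup>\<dagger> ** B')"
      using matrix_right_invertible_surjective invertible_right_inverse by blast
    then show "det (B\<^sup>\<dagger> ** proj_matrix W ** B) \<noteq> 0" using det invertible_det_nz by blast
  next
    assume "det (B\<^sup>\<dagger> ** proj_matrix W ** B) \<noteq> 0"
    then have "invertible (B\<^sup>\<dagger> ** B')" using det invertible_det_nz by blast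
    then obtain b where b: "(B\<^sup>\<dagger> ** B') ** b = mat 1" "b ** (B\<^sup>\<dagger> ** B') = mat 1"
      unfolding invertible_def by blast
    have "B' ** b = (B ** B\<^sup>\<dagger> + C ** C\<^sup>\<dagger>) ** (B' ** b)" by (simp add: unitary_frame_simps[OF BC])
    also have "\<dots> = B ** ((B\<^sup>\<dagger> ** B') ** b) + C ** (C\<^sup>\<dagger> ** B' ** b)"
      by (simp add: matrix_mult_add_left matrix_mul_assoc)
    finally have eq: "B' ** b = B + C ** (C\<^sup>\<dagger> ** B' ** b)" by (simp add: b)
    have "range ((*v) (B' ** b)) = range ((*v) B')"
    proof -
      have "B' *v y = (B' ** b) *v ((B\<^sup>\<dagger> ** B') *v y)" for y
        by (simp add: matrix_vector_mul_assoc matrix_mul_assoc[symmetric] b)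
      moreover have "(B' ** b) *v y = B' *v (b *v y)" for y by (simp add: matrix_vector_mul_assoc)
      ultimately show ?thesis by (metis (no_types, lifting) image_cong rangeI image_subset_iff subset_antisym)
    qed
    then show "W \<in> range (G2_param B C)"
      using W_eq eq by (metis G2_param_eq rangeI)
  qed
qed

lemma openin_G2_chart:
  assumes card: "CARD('n) = CARD('m) + 2"
  shows "openin G2_topology (range (G2_param B C))"
proof -
  have "open {P. det (B\<^sup>\<dagger> ** P ** B) \<noteq> 0}"
  proof (rule open_Collect_neq)
    have "bounded_linear (\<lambda>P. B\<^sup>\<dagger> ** P ** B)"
      using bounded_linear_compose[OF bounded_bilinear.bounded_linear_left[OF bounded_bilinear_matrix_mult]
          bounded_bilinear.bounded_linear_right[OF bounded_bilinear_matrix_mult]] by blast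
    then have "continuous_on UNIV (\<lambda>P. B\<^sup>\<dagger> ** P ** B)"
      by (rule linear_continuous_on)
    then show "continuous_on UNIV (\<lambda>P. det (B\<^sup>\<dagger> ** P ** B))"
      unfolding det_2 by (intro continuous_intros)
  qed simp
  moreover have "range (G2_param B C) = proj_matrix -` {P. det (B\<^sup>\<dagger> ** P ** B) \<noteq> 0} \<inter> G2"
  proof -
    have "range (G2_param B C) \<subseteq> G2"
      using range_in_G2 inj_matrix_left_inverse[OF unitary_frame_simps(6)[OF BC]] by (auto simp: G2_param_eq)
    then show ?thesis using G2_param_iff_det[OF _ card] by blast
  qed
  ultimately show ?thesis
    unfolding G2_topology_def openin_pullback_topology by (auto simp: openin_open_eq)
qed

end

subsection \<open>The pointwise algebra\<close>

definition curv0 :: "complex^2^'m \<Rightarrow> complex^2^'m \<Rightarrow> complex^2^'m \<Rightarrow> complex^2^'m" where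
  "curv0 X Y Z = X ** Y\<^sup>\<dagger> ** Z + Z ** Y\<^sup>\<dagger> ** X - Y ** X\<^sup>\<dagger> ** Z - Z ** X\<^sup>\<dagger> ** Y"

lemma curv0_conv: "curv0 X Y Z = (X ** Y\<^sup>\<dagger> - Y ** X\<^sup>\<dagger>) ** Z + Z ** (Y\<^sup>\<dagger> ** X - X\<^sup>\<dagger> ** Y)"
  by (simp add: curv0_def matrix_distribs matrix_mul_assoc)

lemma inner_trace_rotate:
  fixes X Y :: "complex^2^'m"
  shows "inner X Y = Re (trace (Y ** X\<^sup>\<dagger>))" "inner X Y = Re (trace (Y\<^sup>\<dagger> ** X))"
  using Re_trace_conj_transpose_mult[of X Y] Re_trace_conj_transpose_mult[of Y X] trace_mul_sym[of Y "X\<^sup>\<dagger>"]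
  by (simp_all add: inner_commute)

text \<open>Converts information on how \<open>curv0 U W\<close> pairs the principal vectors
  \<open>X\<close> and \<open>Y\<close>, for arbitrary tangent \<open>U\<close> and
  \<open>W\<close>, into information on the range of the single operator \<open>curv0 X Y\<close>.
  Each of the four terms follows by rotating and conjugating a trace.\<close>

lemma curv0_pair_symmetry: "inner (curv0 U W X) Y = inner (curv0 X Y U) (W :: complex^2^'m)"
proof -
  have eqs: "inner (U ** W\<^sup>\<dagger> ** X) Y = inner (X ** Y\<^sup>\<dagger> ** U) W"
    "inner (X ** W\<^sup>\<dagger> ** U) Y = inner (U ** Y\<^sup>\<dagger> ** X) W"
    "inner (W ** U\<^sup>\<dagger> ** X) Y = inner (Y ** X\<^sup>\<dagger> ** U) W"
    "inner (X ** U\<^sup>\<dagger> ** W) Y = inner (U ** X\<^sup>\<dagger> ** Y) W"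
  proof -
    have c: "trace (A ** B ** C ** D) = trace (C ** D ** A ** B)"
      for A C :: "complex^2^'m" and B D :: "complex^'m^2"
      using trace_mul_sym[of "A ** B" "C ** D"] by (simp add: matrix_mul_assoc)
    have d: "inner (A ** B\<^sup>\<dagger> ** C) D = Re (trace (A ** B\<^sup>\<dagger> ** C ** D\<^sup>\<dagger>))"
      for A B C D :: "complex^2^'m"
      using inner_trace_rotate(2)[of "A ** B\<^sup>\<dagger> ** C" D] trace_mul_sym[of "D\<^sup>\<dagger>" "A ** B\<^sup>\<dagger> ** C"] by simp
    have e: "Re (trace (A ** B\<^sup>\<dagger> ** C ** D\<^sup>\<dagger>)) = Re (trace (D ** C\<^sup>\<dagger> ** B ** A\<^sup>\<dagger>))"
      for A B C D :: "complex^2^'m"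
    proof -
      have "trace (M\<^sup>\<dagger>) = cnj (trace M)" for M :: "complex^'m^'m" by (simp add: trace_def)
      from this[of "A ** B\<^sup>\<dagger> ** C ** D\<^sup>\<dagger>"] show ?thesis
        by (simp add: conj_transpose_mult matrix_mul_assoc)
    qed
    have f: "trace (A ** B\<^sup>\<dagger> ** C ** D\<^sup>\<dagger>) = trace (C ** D\<^sup>\<dagger> ** A ** B\<^sup>\<dagger>)" for A B C D :: "complex^2^'m"
      by (rule c)
    show "inner (U ** W\<^sup>\<dagger> ** X) Y = inner (X ** Y\<^sup>\<dagger> ** U) W"
      "inner (X ** W\<^sup>\<dagger> ** U) Y = inner (U ** Y\<^sup>\<dagger> ** X) W"
      "inner (W ** U\<^sup>\<dagger> ** X) Y = inner (Y ** X\<^sup>\<dagger> ** U) W"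
      "inner (X ** U\<^sup>\<dagger> ** W) Y = inner (U ** X\<^sup>\<dagger> ** Y) W"
      unfolding d by (metis e f)+
  qed
  show ?thesis
    unfolding curv0_def inner_add_left inner_diff_left eqs by simp
qed

section \<open>Curvature operators of small rank\<close>

definition outer :: "complex^'m \<Rightarrow> complex^2 \<Rightarrow> complex^2^'m" where
  "outer z v = (\<chi> i j. z $ i * v $ j)"

lemma outer_nth [simp]: "outer z v $ i $ j = z $ i * v $ j"
  by (simp add: outer_def)

lemma matrix_mult_outer: "a ** outer z v = outer (a *v z) v"
  and outer_matrix_mult: "outer z v ** b = outer z (v v* b)"
  by (simp_all add: vec_eq_iff matrix_matrix_mult_def matrix_vector_mult_def vector_matrix_mult_def
      sum_distrib_left sum_distrib_right mult_ac)

lemma linear_outer_right: "linear (outer z)"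
  by (auto intro!: linearI simp: vec_eq_iff algebra_simps)

lemma outer_eq_0_iff: "outer z v = 0 \<longleftrightarrow> z = 0 \<or> v = 0"
  by (auto simp: vec_eq_iff)

text \<open>For fixed \<open>v\<close> the map acts real-linearly on the matrices
  \<open>outer z v\<close>, a space of dimension 2m > 4, so it kills some nonzero
  \<open>outer z v\<close>. A row with nonzero coordinate of \<open>z\<close> shows that
  \<open>v\<close> is a left eigenvector of \<open>b\<close>; a matrix for which every vector is one
  is scalar.\<close>

lemma small_range_imp_scalar:
  fixes a :: "complex^'m^'m" and b :: "complex^2^2"
  assumes m: "CARD('m) \<ge> 3" and F: "subspace F" "dim F \<le> 4"
    and K: "\<And>Z :: complex^2^'m. a ** Z + Z ** b \<in> F"
  shows "\<exists>\<beta>. b = mat \<beta>"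
proof -
  have ev: "\<exists>c. v v* b = c *s v" for v
  proof -
    let ?L = "\<lambda>z. outer (a *v z) v + outer z (v v* b)"
    have L: "linear ?L"
      by (intro linearI) (simp_all add: vec_eq_iff matrix_vector_mult_def sum.distrib
          scaleR_sum_right[symmetric] algebra_simps)
    have "\<not> inj ?L"
    proof
      assume "inj ?L"
      then have "dim (range ?L) = DIM(complex^'m)"
        using dim_image_eq[OF L, of UNIV] by (simp add: dim_UNIV)
      moreover have "range ?L \<subseteq> F"
        using K[of "outer _ v"] by (auto simp: matrix_mult_outer outer_matrix_mult)
      ultimately show False
        using dim_subset[of "range ?L" F] F m by simp
    qed
    then obtain z where z: "z \<noteq> 0" "?L z = 0"
      using linear_injective_0[OF L] by blast
    obtain i where i: "z $ i \<noteq> 0" using z(1) by (auto simp: vec_eq_iff)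
    have "(a *v z) $ i * v $ j + z $ i * (v v* b) $ j = 0" for j
      using arg_cong[OF z(2), of "\<lambda>M. M $ i $ j"] by simp
    then have "v v* b = (- ((a *v z) $ i / z $ i)) *s v"
      using i by (simp add: vec_eq_iff field_simps eq_neg_iff_add_eq_0 add.commute)
    then show ?thesis by blast
  qed
  have nth: "(v v* b) $ j = v $ 1 * b $ 1 $ j + v $ 2 * b $ 2 $ j" for v j
    by (simp add: vector_matrix_mult_def sum_2 mult.commute)
  \<comment> \<open>The two coordinate vectors make \<open>b\<close> diagonal, and the all-ones
    vector makes its diagonal entries equal.\<close>
  obtain c1 c2 c3 where c: "axis 1 1 v* b = c1 *s axis 1 1" "axis 2 1 v* b = c2 *s axis 2 1"
    "(\<chi> _. 1) v* b = c3 *s (\<chi> _. 1)"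
    using ev by metis
  have "b $ 1 $ 2 = 0" "b $ 2 $ 1 = 0" "b $ 1 $ j + b $ 2 $ j = c3" for j
    using arg_cong[OF c(1), of "\<lambda>w. w $ 2"] arg_cong[OF c(2), of "\<lambda>w. w $ 1"]
      arg_cong[OF c(3), of "\<lambda>w. w $ j"] by (simp_all add: nth axis_def)
  note this(1,2) and this(3)[of 1] and this(3)[of 2]
  then have "b = mat c3"
    by (simp add: vec_eq_iff forall_2 mat_def)
  then show ?thesis by blast
qed

lemma mat_matrix_mult: "mat c ** (Z :: complex^'k^'l) = (\<chi> i j. c * Z $ i $ j)"
  by (simp add: vec_eq_iff matrix_matrix_mult_def mat_def if_distrib[of "\<lambda>x. x * _"] cong: if_cong)

lemma matrix_mult_mat: "(Z :: complex^'k^'l) ** mat c = (\<chi> i j. c * Z $ i $ j)"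
  by (simp add: vec_eq_iff matrix_matrix_mult_def mat_def if_distrib[of "\<lambda>x. _ * x"] mult.commute cong: if_cong)

text \<open>Once \<open>b\<close> is a scalar \<beta>, \<open>a + mat \<beta>\<close> multiplies
  everything into \<open>F\<close>. If it were nonzero, \<open>F\<close> would consist exactly of
  the matrices \<open>outer p v\<close> for one \<open>p\<close>; then \<beta> = 0 and
  \<open>a = 0\<close>, a contradiction. So \<open>a\<close> and \<open>b\<close> are opposite
  scalars, and comparing traces makes them zero.\<close>

lemma curv0_small_range:
  fixes X Y :: "complex^2^'m"
  assumes m: "CARD('m) \<ge> 3" and F: "subspace F" "dim F \<le> 4" and XY: "X \<in> F" "Y \<in> F"
    and K: "\<And>Z. curv0 X Y Z \<in> F"
  shows "X ** Y\<^sup>\<dagger> = Y ** X\<^sup>\<dagger> \<and> X\<^sup>\<dagger> ** Y = Y\<^sup>\<dagger> ** X"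
proof -
  define a where "a = X ** Y\<^sup>\<dagger> - Y ** X\<^sup>\<dagger>"
  define b where "b = Y\<^sup>\<dagger> ** X - X\<^sup>\<dagger> ** Y"
  have K': "a ** Z + Z ** b \<in> F" for Z
    using K[of Z] by (simp add: curv0_conv a_def b_def)
  obtain \<beta> where \<beta>: "b = mat \<beta>"
    using small_range_imp_scalar[OF m F K'] by blast
  define a' where "a' = a + mat \<beta>"
  have a': "a' ** Z \<in> F" for Z
    using K'[of Z] by (simp add: a'_def \<beta> matrix_mult_add_left mat_matrix_mult matrix_mult_mat)
  have "a' = 0"
  proof (rule ccontr)
    assume "a' \<noteq> 0"
    then obtain z where z: "a' *v z \<noteq> 0"
      by (metis matrix_eq matrix_vector_mult_0)
    define p where "p = a' *v z"
    have p: "p \<noteq> 0" using z by (simp add: p_def)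
    have inF: "outer (a' *v z) v \<in> F" for z v
      using a'[of "outer z v"] by (simp add: matrix_mult_outer)
    have "inj (outer p)"
      using linear_injective_0[OF linear_outer_right] p by (auto simp: outer_eq_0_iff)
    then have "dim (range (outer p)) = 4"
      using dim_image_eq[OF linear_outer_right[of p], of UNIV] by (simp add: dim_UNIV)
    moreover have "range (outer p) \<subseteq> F" using inF by (auto simp: p_def)
    ultimately have F_eq: "F = range (outer p)"
      using F subspace_dim_equal[of "range (outer p)" F]
      by (simp add: linear_subspace_image[OF linear_outer_right])
    obtain x y where x: "X = outer p x" and y: "Y = outer p y"
      using XY F_eq by auto
    \<comment> \<open>An arbitrary index; it only serves to obtain a vector \<open>q\<close>
      orthogonal to the single vector \<open>p\<close>.\<close>
    obtain i0 :: 'm where True by blast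
    have "{i0} \<noteq> UNIV"
      using m by (metis One_nat_def card.empty card.insert empty_iff finite.emptyI numeral_le_one_iff semiring_norm(70) One_nat_def)
    then obtain q where q: "hinner q q = 1" "hinner q p = 0"
      using exists_unit_horthogonal[of "{i0}" "\<lambda>_. p"] by auto
    have outer_q: "(outer p w)\<^sup>\<dagger> *v q = 0" for w
    proof -
      have "((outer p w)\<^sup>\<dagger> *v q) $ j = cnj (w $ j) * hinner q p" for j
        by (simp add: matrix_vector_mult_def hinner_def sum_distrib_left mult_ac)
      then show ?thesis by (simp add: vec_eq_iff q)
    qed
    have "a *v q = 0"
      by (simp add: a_def x y matrix_vector_mult_diff_rdistrib matrix_vector_mul_assoc[symmetric] outer_q)
    then have a'q: "a' *v q = \<beta> *s q"
      by (simp add: a'_def matrix_vector_mult_add_rdistrib)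
        (simp add: vec_eq_iff matrix_vector_mult_def mat_def if_distrib[of "\<lambda>x. x * _"] cong: if_cong)
    obtain w where w: "outer (\<beta> *s q) (axis 1 1) = outer p w"
      using inF[of q "axis 1 1"] F_eq a'q by auto
    have "\<beta> * q $ i = w $ 1 * p $ i" for i
      using arg_cong[OF w, of "\<lambda>M. M $ i $ 1"] by (simp add: axis_def mult.commute)
    then have "\<beta> *s q = w $ 1 *s p" by (simp add: vec_eq_iff)
    then have "hinner q (\<beta> *s q) = 0" by (simp add: hinner_scale_right q)
    then have "\<beta> = 0" by (simp add: hinner_scale_right q)
    \<comment> \<open>With \<beta> = 0 the right factor vanishes. Its diagonal entries say that each
      \<open>cnj (y $ k) * x $ k\<close> is real, which for matrices with the common column
      \<open>p\<close> also makes the left factor vanish.\<close>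
    then have "Y\<^sup>\<dagger> ** X = X\<^sup>\<dagger> ** Y"
      using \<beta> by (simp add: b_def mat_def vec_eq_iff)
    then have YX: "(Y\<^sup>\<dagger> ** X) $ k $ k = (X\<^sup>\<dagger> ** Y) $ k $ k" for k
      by simp
    have outer_outer: "((outer p v)\<^sup>\<dagger> ** outer p w) $ k $ k = hinner p p * (cnj (v $ k) * w $ k)" for v w k
      by (simp add: matrix_matrix_mult_def hinner_def sum_distrib_left sum_distrib_right mult_ac)
    have "hinner p p * (cnj (y $ k) * x $ k) = hinner p p * (cnj (x $ k) * y $ k)" for k
      using YX[of k] unfolding x y outer_outer .
    then have xy: "cnj (y $ k) * x $ k = cnj (x $ k) * y $ k" for k
      using p by simp
    have "(X ** Y\<^sup>\<dagger>) $ i $ j = (Y ** X\<^sup>\<dagger>) $ i $ j" for i j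
    proof -
      have "(X ** Y\<^sup>\<dagger>) $ i $ j = (\<Sum>k\<in>UNIV. p $ i * cnj (p $ j) * (cnj (y $ k) * x $ k))"
        by (simp add: x y matrix_matrix_mult_def mult_ac)
      also have "\<dots> = (Y ** X\<^sup>\<dagger>) $ i $ j"
        unfolding xy by (simp add: x y matrix_matrix_mult_def mult_ac)
      finally show ?thesis .
    qed
    then have "a = 0" by (simp add: a_def vec_eq_iff)
    with \<open>\<beta> = 0\<close> \<open>a' \<noteq> 0\<close> show False by (simp add: a'_def mat_def vec_eq_iff)
  qed
  then have a: "a = - mat \<beta>"
    by (simp add: a'_def eq_neg_iff_add_eq_0)
  \<comment> \<open>Cyclicity of the trace; the two scalars have opposite signs and sizes m and 2,
    whence the factor m + 2.\<close>
  have "trace a = trace b"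
    using trace_mul_sym[of X "Y\<^sup>\<dagger>"] trace_mul_sym[of Y "X\<^sup>\<dagger>"] by (simp add: a_def b_def trace_sub)
  then have "- (of_nat CARD('m) * \<beta>) = 2 * \<beta>"
    by (simp add: a \<beta> trace_def mat_def sum_negf)
  then have "of_nat (CARD('m) + 2) * \<beta> = 0"
    by (metis add.commute add.right_inverse distrib_right of_nat_add of_nat_numeral)
  then have "\<beta> = 0" by (simp del: of_nat_add of_nat_Suc)
  then show ?thesis
    using a \<beta> by (simp add: a_def b_def mat_def vec_eq_iff)
qed

text \<open>A maximum of the Rayleigh quotient is an eigenvalue.\<close>

lemma selfadjoint_eigenvector:
  fixes T :: "'e::euclidean_space \<Rightarrow> 'e"
  assumes T: "linear T" and V: "subspace V" "V \<noteq> {0}" and TV: "\<And>x. x \<in> V \<Longrightarrow> T x \<in> V"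
    and sym: "\<And>x y. x \<in> V \<Longrightarrow> y \<in> V \<Longrightarrow> inner (T x) y = inner x (T y)"
  shows "\<exists>x l. x \<in> V \<and> x \<noteq> 0 \<and> T x = l *\<^sub>R x"
proof -
  let ?S = "sphere 0 1 \<inter> V"
  have "compact ?S"
    using compact_Int_closed[OF compact_sphere closed_subspace[OF V(1)]] .
  moreover have "?S \<noteq> {}"
  proof -
    obtain x where "x \<in> V" "x \<noteq> 0" using V subspace_0 by blast
    then have "x /\<^sub>R norm x \<in> ?S" using V by (simp add: subspace_scale)
    then show ?thesis by blast
  qed
  moreover have "continuous_on ?S (\<lambda>x. inner (T x) x)"
    using T linear_conv_bounded_linear linear_continuous_on by (intro continuous_on_inner continuous_on_id) blast
  ultimately obtain x where x: "x \<in> ?S" and max: "\<And>y. y \<in> ?S \<Longrightarrow> inner (T y) y \<le> inner (T x) x"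
    using continuous_attains_sup[of ?S "\<lambda>x. inner (T x) x"] by blast
  define l where "l = inner (T x) x"
  have xV: "x \<in> V" and xx: "inner x x = 1" using x by (auto simp: dot_square_norm)
  have nonneg: "0 \<le> l * inner y y - inner (T y) y" if "y \<in> V" for y
  proof (cases "y = 0")
    case True
    then show ?thesis using T by (simp add: linear_0)
  next
    case False
    then have "y /\<^sub>R norm y \<in> ?S" using V that by (simp add: subspace_scale)
    from max[OF this] have "inner (T y) y / (norm y * norm y) \<le> l"
      by (simp add: linear_scale[OF T] l_def divide_inverse mult_ac)
    moreover have "norm y * norm y > 0" using False by simp
    ultimately show ?thesis by (simp add: divide_le_eq dot_square_norm power2_eq_square)
  qed
  have "inner (l *\<^sub>R x - T x) y = 0" if y: "y \<in> V" for y
  proof -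
    define p where "p = inner (l *\<^sub>R x - T x) y"
    define q where "q = l * inner y y - inner (T y) y"
    have quad: "0 \<le> 2 * t * p + t\<^sup>2 * q" for t
    proof -
      have "x + t *\<^sub>R y \<in> V" using xV y V by (simp add: subspace_add subspace_scale)
      from nonneg[OF this] show ?thesis
        using sym[OF xV y] xx
        by (simp add: linear_add[OF T] linear_scale[OF T] p_def q_def l_def inner_commute
            power2_eq_square algebra_simps)
    qed
    have q: "0 \<le> q" using nonneg[OF y] by (simp add: q_def)
    \<comment> \<open>Inserting \<open>t = - p * r\<close> into \<open>quad\<close> bounds a
      nonpositive multiple of \<open>p\<^sup>2\<close> below by zero; the summand 1 covers the case
      \<open>q = 0\<close>.\<close>
    define r where "r = inverse (q + 1)"
    have r: "r > 0" "r * q \<le> 1" using q by (simp_all add: r_def field_simps)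
    have "0 \<le> 2 * (- p * r) * p + (- p * r)\<^sup>2 * q" by (rule quad)
    also have "\<dots> = p\<^sup>2 * r * (r * q - 2)" by (simp add: power2_eq_square algebra_simps)
    also have "\<dots> \<le> p\<^sup>2 * r * (- 1)" using r by (intro mult_left_mono) auto
    finally show ?thesis using r by (simp add: mult_le_0_iff p_def)
  qed
  moreover have "l *\<^sub>R x - T x \<in> V" using xV TV V by (simp add: subspace_diff subspace_scale)
  ultimately have "T x = l *\<^sub>R x" by (metis eq_iff_diff_eq_0 inner_eq_zero_iff)
  moreover have "x \<noteq> 0" using xx by auto
  ultimately show ?thesis using xV by blast
qed

text \<open>The image of \<open>S\<close> is invariant under \<open>T\<close>, so it contains an
  eigenvector \<open>f\<close>. A self-adjoint \<open>S\<close> is injective on its own image, hence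
  does not kill \<open>f\<close>.\<close>

lemma selfadjoint_eigenvector_in_range:
  fixes T S :: "'e::euclidean_space \<Rightarrow> 'e"
  assumes T: "linear T" and S: "linear S" and V: "subspace V"
    and TV: "\<And>x. x \<in> V \<Longrightarrow> T x \<in> V" and SV: "\<And>x. x \<in> V \<Longrightarrow> S x \<in> V"
    and TS: "\<And>x. x \<in> V \<Longrightarrow> T (S x) = S (T x)"
    and sym: "\<And>x y. x \<in> V \<Longrightarrow> y \<in> V \<Longrightarrow> inner (T x) y = inner x (T y)"
    and symS: "\<And>x y. x \<in> V \<Longrightarrow> y \<in> V \<Longrightarrow> inner (S x) y = inner x (S y)"
    and x: "x \<in> V" "S x \<noteq> 0"
  shows "\<exists>f \<nu>. f \<in> V \<and> f \<noteq> 0 \<and> T f = \<nu> *\<^sub>R f \<and> S f \<noteq> 0"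
proof -
  have "subspace (S ` V)" by (rule linear_subspace_image[OF S V])
  moreover have "S ` V \<noteq> {0}" using x by auto
  moreover have "T y \<in> S ` V" if "y \<in> S ` V" for y using that TV TS by auto
  moreover have "inner (T y) z = inner y (T z)" if "y \<in> S ` V" "z \<in> S ` V" for y z
    using that SV sym by auto
  ultimately obtain f \<nu> where f: "f \<in> S ` V" "f \<noteq> 0" "T f = \<nu> *\<^sub>R f"
    using selfadjoint_eigenvector[OF T] by metis
  then obtain g where g: "g \<in> V" "f = S g" by auto
  have fV: "f \<in> V" using SV g by simp
  have "S f \<noteq> 0"
  proof
    assume "S f = 0"
    then have "inner f f = 0" using symS[OF g(1) fV] g(2) by simp
    then show False using f(2) by simp
  qed
  then show ?thesis using f fV by blast
qed

text \<open>Replaces full diagonalization. The preceding lemma with \<open>S = T\<close> gives a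
  nonzero eigenvalue \<open>l\<close>; with \<open>S = T\<^sup>2 - l T\<close> it would give an
  eigenvalue other than 0 and \<open>l\<close>, which \<open>prod\<close> forbids. So
  \<open>T\<close> satisfies \<open>T\<^sup>2 = l T\<close> on \<open>V\<close>, and
  \<open>T / l\<close> is the projection that splits \<open>x\<close>.\<close>

lemma selfadjoint_two_eigenspaces:
  fixes T :: "'e::euclidean_space \<Rightarrow> 'e"
  assumes T: "linear T" and V: "subspace V" and TV: "\<And>x. x \<in> V \<Longrightarrow> T x \<in> V"
    and sym: "\<And>x y. x \<in> V \<Longrightarrow> y \<in> V \<Longrightarrow> inner (T x) y = inner x (T y)"
    and prod: "\<And>x y l \<mu>. x \<in> V \<Longrightarrow> y \<in> V \<Longrightarrow> x \<noteq> 0 \<Longrightarrow> y \<noteq> 0 \<Longrightarrow>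
      T x = l *\<^sub>R x \<Longrightarrow> T y = \<mu> *\<^sub>R y \<Longrightarrow> l \<noteq> \<mu> \<Longrightarrow> l * \<mu> = 0"
    and ne: "x0 \<in> V" "T x0 \<noteq> 0"
  shows "\<exists>l. l \<noteq> 0 \<and> (\<exists>x\<in>V. x \<noteq> 0 \<and> T x = l *\<^sub>R x) \<and>
    (\<forall>x\<in>V. \<exists>y\<in>V. \<exists>z\<in>V. x = y + z \<and> T y = l *\<^sub>R y \<and> T z = 0)"
proof -
  obtain e l where e: "e \<in> V" "e \<noteq> 0" "T e = l *\<^sub>R e" "T e \<noteq> 0"
    using selfadjoint_eigenvector_in_range[OF T T V TV TV _ sym sym ne] by blast
  then have l: "l \<noteq> 0" by auto
  let ?S = "\<lambda>x. T (T x) - l *\<^sub>R T x"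
  have S: "linear ?S"
    by (intro linearI) (simp_all add: linear_add[OF T] linear_scale[OF T] algebra_simps)
  have SV: "?S x \<in> V" if "x \<in> V" for x
    using that V TV by (simp add: subspace_diff subspace_scale)
  have TS: "T (?S x) = ?S (T x)" for x
    by (simp add: linear_diff[OF T] linear_scale[OF T])
  have symS: "inner (?S x) y = inner x (?S y)" if "x \<in> V" "y \<in> V" for x y
    using that sym TV by (simp add: inner_diff_left inner_diff_right)
  have S0: "?S x = 0" if x: "x \<in> V" for x
  proof (rule ccontr)
    assume "?S x \<noteq> 0"
    then obtain f \<nu> where f: "f \<in> V" "f \<noteq> 0" "T f = \<nu> *\<^sub>R f" "?S f \<noteq> 0"
      using selfadjoint_eigenvector_in_range[OF T S V TV SV TS sym symS x] by blast
    have "?S f = (\<nu> * (\<nu> - l)) *\<^sub>R f"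
      by (simp add: f(3) linear_scale[OF T] algebra_simps)
    with f(4) have "\<nu> \<noteq> 0" "\<nu> \<noteq> l" by auto
    with prod[OF f(1) e(1) f(2) e(2) f(3) e(3)] l show False by simp
  qed
  have "\<exists>y\<in>V. \<exists>z\<in>V. x = y + z \<and> T y = l *\<^sub>R y \<and> T z = 0" if x: "x \<in> V" for x
  proof (intro bexI conjI)
    show "x = (1 / l) *\<^sub>R T x + (x - (1 / l) *\<^sub>R T x)" by simp
    show "T ((1 / l) *\<^sub>R T x) = l *\<^sub>R (1 / l) *\<^sub>R T x"
      using S0[OF x] l by (simp add: linear_scale[OF T])
    show "T (x - (1 / l) *\<^sub>R T x) = 0"
      using S0[OF x] l by (simp add: linear_scale[OF T] linear_diff[OF T])
  qed (use x TV V in \<open>auto simp: subspace_diff subspace_scale\<close>)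
  then show ?thesis using l e by blast
qed

section \<open>The complex structure and irreducibility of the isotropy action\<close>

abbreviation left_i :: "complex^'k^'m \<Rightarrow> complex^'k^'m" ("\<J>") where
  "\<J> X \<equiv> mat \<i> ** X"

lemma conj_transpose_mat: "(mat c)\<^sup>\<dagger> = mat (cnj c)"
  by (auto simp: vec_eq_iff mat_def)

lemma skew_mat_i: "(mat \<i>)\<^sup>\<dagger> = - mat \<i>"
  by (auto simp: vec_eq_iff mat_def)

lemma left_i_nth [simp]: "\<J> X $ k $ l = \<i> * X $ k $ l"
  by (simp add: mat_matrix_mult)

lemma left_i_commute:
  "\<J> (a ** X) = a ** \<J> X" "\<J> (X ** b) = \<J> X ** b"
  by (simp_all add: vec_eq_iff matrix_matrix_mult_def[of a] matrix_matrix_mult_def[of _ b]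
      sum_distrib_left mult_ac)

lemma left_i_left_i [simp]: "\<J> (\<J> X) = - X"
  by (simp add: vec_eq_iff)

lemma inner_left_i: "inner (\<J> X) Y = - inner X (\<J> Y)"
proof -
  have "inner (\<J> X) Y = inner X (mat (- \<i>) ** Y)"
    by (simp add: inner_matrix_mult_left conj_transpose_mat)
  also have "mat (- \<i>) ** Y = - \<J> Y" by (simp add: vec_eq_iff mat_matrix_mult)
  finally show ?thesis by simp
qed

lemma inner_left_i_left_i [simp]: "inner (\<J> X) (\<J> Y) = inner X Y"
  by (simp add: inner_left_i)

lemma inner_left_i_self [simp]: "inner (\<J> X) X = 0" "inner X (\<J> X) = 0"
  using inner_left_i[of X X] by (simp_all add: inner_commute)

text \<open>The hypothesis says that \<open>X ** Y\<^sup>\<dagger>\<close> is Hermitian, and the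
  trace of a skew-Hermitian times a Hermitian matrix is imaginary. The right-hand version uses
  \<open>X\<^sup>\<dagger> ** Y\<close> in the same way.\<close>

lemma left_skew_orthogonal:
  assumes "\<alpha>\<^sup>\<dagger> = - \<alpha>" "X ** Y\<^sup>\<dagger> = Y ** X\<^sup>\<dagger>"
  shows "inner (\<alpha> ** X) (Y :: complex^2^'m) = 0"
proof -
  have "inner (\<alpha> ** X) Y = - inner X (\<alpha> ** Y)"
    using assms by (simp add: inner_matrix_mult_left matrix_mult_minus_left)
  also have "\<dots> = - Re (trace (\<alpha> ** (Y ** X\<^sup>\<dagger>)))"
    by (simp add: inner_trace_rotate(1) matrix_mul_assoc)
  also have "\<dots> = - inner Y (\<alpha> ** X)"
    by (simp add: inner_trace_rotate(1) matrix_mul_assoc assms(2)[symmetric])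
  finally show ?thesis by (simp add: inner_commute)
qed

lemma right_skew_orthogonal:
  assumes "\<beta>\<^sup>\<dagger> = - \<beta>" "X\<^sup>\<dagger> ** Y = Y\<^sup>\<dagger> ** X"
  shows "inner (X ** \<beta>) (Y :: complex^2^'m) = 0"
proof -
  have "inner (X ** \<beta>) Y = - inner X (Y ** \<beta>)"
    using assms by (simp add: inner_matrix_mult_right matrix_mult_minus_right)
  also have "\<dots> = - Re (trace ((X\<^sup>\<dagger> ** Y) ** \<beta>))"
    by (simp add: Re_trace_conj_transpose_mult[symmetric] matrix_mul_assoc)
  also have "\<dots> = - inner Y (X ** \<beta>)"
    by (simp add: Re_trace_conj_transpose_mult[symmetric] matrix_mul_assoc assms(2))
  finally show ?thesis by (simp add: inner_commute)
qed

text \<open>The skew-Hermitian matrices acting on the left or on the right span the isotropy algebra.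
  A complex subspace preserved by it is preserved by all matrices on both sides, as
  \<open>a = (a - a\<^sup>\<dagger>)/2 + (a + a\<^sup>\<dagger>)/2\<close> and the second summand is \<open>\<i>\<close> times a skew-Hermitian one.\<close>

lemma isotropy_irreducible:
  fixes P :: "(complex^2^'m) set"
  assumes P: "subspace P" and J: "\<And>X. X \<in> P \<Longrightarrow> \<J> X \<in> P"
    and left: "\<And>\<alpha> X. \<alpha>\<^sup>\<dagger> = - \<alpha> \<Longrightarrow> X \<in> P \<Longrightarrow> \<alpha> ** X \<in> P"
    and right: "\<And>\<beta> X. \<beta>\<^sup>\<dagger> = - \<beta> \<Longrightarrow> X \<in> P \<Longrightarrow> X ** \<beta> \<in> P"
    and X: "X \<in> P" "X \<noteq> 0"
  shows "P = UNIV"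
proof -
  have split: "\<exists>s h. s\<^sup>\<dagger> = - s \<and> h\<^sup>\<dagger> = - h \<and> a = s + mat \<i> ** h" for a :: "complex^'k^'k"
  proof (intro exI conjI)
    let ?s = "(1/2) *\<^sub>R (a - a\<^sup>\<dagger>)" and ?h = "- ((1/2) *\<^sub>R (mat \<i> ** (a + a\<^sup>\<dagger>)))"
    show "?s\<^sup>\<dagger> = - ?s" by (simp add: vec_eq_iff algebra_simps)
    show "?h\<^sup>\<dagger> = - ?h" by (simp add: vec_eq_iff mat_matrix_mult)
    show "a = ?s + mat \<i> ** ?h"
      by (simp add: vec_eq_iff mat_matrix_mult complex_eq_iff field_simps)
  qed
  have leftP: "a ** Z \<in> P" if Z: "Z \<in> P" for a Z
  proof -
    obtain s h where sh: "s\<^sup>\<dagger> = - s" "h\<^sup>\<dagger> = - h" "a = s + mat \<i> ** h" using split by blast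
    then have "a ** Z = s ** Z + \<J> (h ** Z)" by (simp add: matrix_mult_add_left matrix_mul_assoc)
    then show ?thesis using sh left J Z P by (simp add: subspace_add)
  qed
  have rightP: "Z ** b \<in> P" if Z: "Z \<in> P" for b Z
  proof -
    obtain s h where sh: "s\<^sup>\<dagger> = - s" "h\<^sup>\<dagger> = - h" "b = s + mat \<i> ** h" using split by blast
    have "Z ** (mat \<i> ** h) = \<J> (Z ** h)"
      by (simp add: vec_eq_iff matrix_mul_assoc matrix_mult_mat mat_matrix_mult)
        (simp add: matrix_matrix_mult_def sum_distrib_left mult_ac)
    then have "Z ** b = Z ** s + \<J> (Z ** h)" using sh by (simp add: matrix_mult_add_right)
    then show ?thesis using sh right J Z P by (simp add: subspace_add)
  qed
  obtain i0 j0 where c: "X $ i0 $ j0 \<noteq> 0" using X(2) by (auto simp: vec_eq_iff)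
  have "N \<in> P" for N
  proof -
    \<comment> \<open>\<open>b l\<close> moves the column \<open>j0\<close> of \<open>X\<close> into
      column \<open>l\<close>; \<open>a l\<close> then uses the nonzero entry in row
      \<open>i0\<close> to produce column \<open>l\<close> of \<open>N\<close>.\<close>
    define a :: "2 \<Rightarrow> complex^'m^'m" where "a l = (\<chi> k i. if i = i0 then N $ k $ l / X $ i0 $ j0 else 0)" for l
    define b :: "2 \<Rightarrow> complex^2^2" where "b l = (\<chi> j l'. if j = j0 \<and> l' = l then 1 else 0)" for l
    have "(a l ** X ** b l) $ k $ l' = (if l' = l then N $ k $ l else 0)" for k l l'
      using c by (simp add: matrix_matrix_mult_def a_def b_def if_distrib[of "\<lambda>x. x * _"]
          if_distrib[of "\<lambda>x. _ * x"] cong: if_cong conj_cong)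
    then have "N = (\<Sum>l\<in>UNIV. a l ** X ** b l)"
      by (simp add: vec_eq_iff)
    moreover have "(\<Sum>l\<in>UNIV. a l ** X ** b l) \<in> P"
      by (intro subspace_sum[OF P] leftP rightP X(1))
    ultimately show "N \<in> P" by simp
  qed
  then show ?thesis by auto
qed

text \<open>Since \<J> \<open>N\<close> lies in \<open>Q\<close>, the space \<open>P\<close> is
  complex, and no skew matrix leads from \<open>P\<close> to \<open>Q\<close> or to
  \<open>N\<close>. A nonzero \<open>P\<close> would thus be everything, although it is orthogonal
  to \<open>N\<close>.\<close>

lemma commuting_splitting_trivial_aux:
  fixes P Q :: "(complex^2^'m) set"
  assumes P: "subspace P" and N: "N \<noteq> 0"
    and perpP: "\<And>X. X \<in> P \<Longrightarrow> inner X N = 0"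
    and orth: "\<And>X Y. X \<in> P \<Longrightarrow> Y \<in> Q \<Longrightarrow> inner X Y = 0"
    and decomp: "\<And>Z. (\<And>Y. Y \<in> Q \<Longrightarrow> inner Z Y = 0) \<Longrightarrow> inner Z N = 0 \<Longrightarrow> Z \<in> P"
    and comm: "\<And>X Y. X \<in> P \<Longrightarrow> Y \<in> Q \<Longrightarrow> X ** Y\<^sup>\<dagger> = Y ** X\<^sup>\<dagger> \<and> X\<^sup>\<dagger> ** Y = Y\<^sup>\<dagger> ** X"
    and JN: "\<J> N \<in> Q"
  shows "P \<subseteq> {0}"
proof (rule ccontr)
  assume "\<not> P \<subseteq> {0}"
  then obtain X where X: "X \<in> P" "X \<noteq> 0" by auto
  have J: "\<J> X \<in> P" if "X \<in> P" for X
  proof (rule decomp)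
    show "inner (\<J> X) Y = 0" if "Y \<in> Q" for Y
      using left_skew_orthogonal[OF skew_mat_i, of X Y] comm \<open>X \<in> P\<close> that by blast
    show "inner (\<J> X) N = 0"
      using orth[OF that JN] by (simp add: inner_left_i)
  qed
  have "P = UNIV"
  proof (rule isotropy_irreducible[OF P J _ _ X])
    fix \<alpha> :: "complex^'m^'m" and X assume \<alpha>: "\<alpha>\<^sup>\<dagger> = - \<alpha>" and X: "X \<in> P"
    show "\<alpha> ** X \<in> P"
    proof (rule decomp)
      show "inner (\<alpha> ** X) Y = 0" if "Y \<in> Q" for Y
        using left_skew_orthogonal \<alpha> comm X that by blast
      \<comment> \<open>\<J> is an isometry commuting with \<alpha>, which replaces
        \<open>N\<close>, outside the splitting, by \<J> \<open>N\<close> in \<open>Q\<close>, where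
        commutation is available.\<close>
      have "inner (\<alpha> ** X) N = inner (\<alpha> ** \<J> X) (\<J> N)"
        by (simp flip: left_i_commute)
      also have "\<dots> = 0"
        using left_skew_orthogonal \<alpha> comm J X JN by blast
      finally show "inner (\<alpha> ** X) N = 0" .
    qed
  next
    fix \<beta> :: "complex^2^2" and X assume \<beta>: "\<beta>\<^sup>\<dagger> = - \<beta>" and X: "X \<in> P"
    show "X ** \<beta> \<in> P"
    proof (rule decomp)
      show "inner (X ** \<beta>) Y = 0" if "Y \<in> Q" for Y
        using right_skew_orthogonal \<beta> comm X that by blast
      have "inner (X ** \<beta>) N = inner (\<J> X ** \<beta>) (\<J> N)"
        by (simp flip: left_i_commute)
      also have "\<dots> = 0"
        using right_skew_orthogonal \<beta> comm J X JN by blast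
      finally show "inner (X ** \<beta>) N = 0" .
    qed
  qed
  then show False using perpP[of N] N by simp
qed

text \<open>It must be shown that \<J> \<open>N\<close> lies in one of the two spaces. Split it as
  \<open>X0 + Y0\<close>; applying \<J> keeps each summand in its space up to a multiple of
  \<open>N\<close>. The sum of the two images is \<open>- N\<close>, so by orthogonality \<J>
  \<open>X0\<close> is itself a multiple \<open>c\<close> of \<open>N\<close>. Thus
  \<open>X0\<close> is proportional to \<J> \<open>N\<close>, and \<open>c\<close> decides which
  space contains it.\<close>

lemma commuting_splitting_trivial:
  fixes P Q :: "(complex^2^'m) set"
  assumes P: "subspace P" and Q: "subspace Q" and N: "N \<noteq> 0"
    and perp: "\<And>X. X \<in> P \<union> Q \<Longrightarrow> inner X N = 0"
    and orth: "\<And>X Y. X \<in> P \<Longrightarrow> Y \<in> Q \<Longrightarrow> inner X Y = 0"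
    and sum: "\<And>Z. inner Z N = 0 \<Longrightarrow> \<exists>X\<in>P. \<exists>Y\<in>Q. Z = X + Y"
    and comm: "\<And>X Y. X \<in> P \<Longrightarrow> Y \<in> Q \<Longrightarrow> X ** Y\<^sup>\<dagger> = Y ** X\<^sup>\<dagger> \<and> X\<^sup>\<dagger> ** Y = Y\<^sup>\<dagger> ** X"
  shows "P \<subseteq> {0} \<or> Q \<subseteq> {0}"
proof -
  have orth': "inner Y X = 0" if "X \<in> P" "Y \<in> Q" for X Y
    using orth[OF that] by (simp add: inner_commute)
  have comm': "Y ** X\<^sup>\<dagger> = X ** Y\<^sup>\<dagger> \<and> Y\<^sup>\<dagger> ** X = X\<^sup>\<dagger> ** Y" if "X \<in> P" "Y \<in> Q" for X Y
    using comm[OF that] by simp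
  have decP: "Z \<in> P" if Z: "\<And>Y. Y \<in> Q \<Longrightarrow> inner Z Y = 0" "inner Z N = 0" for Z
  proof -
    obtain X Y where XY: "X \<in> P" "Y \<in> Q" "Z = X + Y" using sum[OF Z(2)] by blast
    have "inner Y Y = 0" using Z(1)[OF XY(2)] XY orth by (simp add: inner_add_left)
    then show ?thesis using XY by simp
  qed
  have decQ: "Z \<in> Q" if Z: "\<And>X. X \<in> P \<Longrightarrow> inner Z X = 0" "inner Z N = 0" for Z
  proof -
    obtain X Y where XY: "X \<in> P" "Y \<in> Q" "Z = X + Y" using sum[OF Z(2)] by blast
    have "inner X X = 0" using Z(1)[OF XY(1)] XY orth' by (simp add: inner_add_left)
    then show ?thesis using XY by simp
  qed
  define q where "q = inner N N"
  have q: "q \<noteq> 0" using N by (simp add: q_def)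
  have "inner (\<J> N) N = 0" by simp
  then obtain X0 Y0 where XY: "X0 \<in> P" "Y0 \<in> Q" "\<J> N = X0 + Y0" using sum by blast
  define c where "c = inner (\<J> X0) N / q"
  define d where "d = inner (\<J> Y0) N / q"
  have J_perp: "inner (\<J> X) Y = 0" if "X \<in> P" "Y \<in> Q" for X Y
    using left_skew_orthogonal[OF skew_mat_i, of X Y] comm that by blast
  have X1: "\<J> X0 - c *\<^sub>R N \<in> P"
  proof (rule decP)
    show "inner (\<J> X0 - c *\<^sub>R N) Y = 0" if "Y \<in> Q" for Y
      using J_perp[OF XY(1) that] perp[of Y] that by (simp add: inner_diff_left inner_diff_right inner_commute)
  qed (use q in \<open>simp add: c_def q_def inner_diff_left\<close>)
  have Y1: "\<J> Y0 - d *\<^sub>R N \<in> Q"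
  proof (rule decQ)
    show "inner (\<J> Y0 - d *\<^sub>R N) X = 0" if "X \<in> P" for X
    proof -
      have "inner (\<J> Y0) X = 0"
        using J_perp[OF that XY(2)] inner_left_i[of Y0 X] by (simp add: inner_commute)
      then show ?thesis
        using perp[of X] that by (simp add: inner_diff_left inner_commute[of N X])
    qed
  qed (use q in \<open>simp add: d_def q_def inner_diff_left\<close>)
  have "- N = \<J> X0 + \<J> Y0"
    using XY(3) left_i_left_i[of N] by (simp add: matrix_mult_add_right)
  then have sum_eq: "(\<J> X0 - c *\<^sub>R N) + (\<J> Y0 - d *\<^sub>R N) = (- 1 - c - d) *\<^sub>R N"
    by (simp add: algebra_simps)
  have "inner ((- 1 - c - d) *\<^sub>R N) N = 0"
    unfolding sum_eq[symmetric] using perp X1 Y1 by (simp add: inner_add_left)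
  then have "(\<J> X0 - c *\<^sub>R N) + (\<J> Y0 - d *\<^sub>R N) = 0"
    using sum_eq N by auto
  moreover have "inner (\<J> X0 - c *\<^sub>R N) (\<J> Y0 - d *\<^sub>R N) = 0" using orth X1 Y1 by blast
  moreover have "inner A A = 0" if "A + B = 0" "inner A B = 0" for A B :: "complex^2^'m"
  proof -
    have "B = - A" using that(1) by (simp add: add_eq_0_iff)
    then show ?thesis using that(2) by simp
  qed
  ultimately have "inner (\<J> X0 - c *\<^sub>R N) (\<J> X0 - c *\<^sub>R N) = 0" by blast
  then have JX0: "\<J> X0 = c *\<^sub>R N" by simp
  then have X0: "X0 = (- c) *\<^sub>R \<J> N"
  proof -
    have "- X0 = \<J> (c *\<^sub>R N)" using left_i_left_i[of X0] unfolding JX0 by (rule sym)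
    then have "- X0 = c *\<^sub>R \<J> N" by (simp only: matrix_mult_scaleR_right)
    then show ?thesis by (metis minus_minus scaleR_minus_left)
  qed
  show ?thesis
  proof (cases "c = 0")
    case True
    then have "\<J> N \<in> Q" using X0 XY by simp
    then have "P \<subseteq> {0}"
      using commuting_splitting_trivial_aux[OF P N _ orth decP comm] perp by blast
    then show ?thesis ..
  next
    case False
    then have "(- 1 / c) *\<^sub>R ((- c) *\<^sub>R \<J> N) = \<J> N" by simp
    then have "\<J> N = (- 1 / c) *\<^sub>R X0" unfolding X0 by (rule sym)
    moreover have "(- 1 / c) *\<^sub>R X0 \<in> P" by (rule subspace_scale[OF P XY(1)])
    ultimately have "\<J> N \<in> P" by (simp only:)
    then have "Q \<subseteq> {0}"
      using commuting_splitting_trivial_aux[OF Q N _ orth' decQ comm'] perp by blast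
    then show ?thesis ..
  qed
qed

text \<open>For eigenvectors \<open>X\<close>, \<open>Y\<close> of \<open>T\<close> with different eigenvalues, the operator \<open>curv0 X Y\<close> agrees on the
  orthogonal complement of \<open>N\<close> with a multiple of \<open>X \<and> Y\<close> modulo \<open>N\<close>, hence its range lies in a
  four-dimensional space.\<close>

lemma semi_parallel_point_umbilic:
  fixes N :: "complex^2^'m" and T :: "complex^2^'m \<Rightarrow> complex^2^'m"
  assumes m: "CARD('m) \<ge> 3" and N: "N \<noteq> 0" and \<kappa>: "\<kappa> \<noteq> 0"
    and T: "linear T" and TN: "T N = 0" and sym: "\<And>X Y. inner (T X) Y = inner X (T Y)"
    and comm: "\<And>X Y Z. inner X N = 0 \<Longrightarrow> inner Y N = 0 \<Longrightarrow> inner Z N = 0 \<Longrightarrow>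
      \<exists>c. T (R X Y Z) = R X Y (T Z) + c *\<^sub>R N"
    and R: "\<And>X Y Z. R X Y Z = curv0 X Y Z + \<kappa> *\<^sub>R (inner (T Y) Z *\<^sub>R T X - inner (T X) Z *\<^sub>R T Y)"
  shows "\<exists>l. \<forall>X. inner X N = 0 \<longrightarrow> T X = l *\<^sub>R X"
proof (rule ccontr)
  assume not_umbilic: "\<not> ?thesis"
  let ?V = "{X. inner X N = 0}"
  have V: "subspace ?V" by (auto simp: subspace_def inner_add_left)
  have TV: "inner (T X) N = 0" for X by (simp add: sym TN)
  have main: "l * \<mu> = 0 \<and> X ** Y\<^sup>\<dagger> = Y ** X\<^sup>\<dagger> \<and> X\<^sup>\<dagger> ** Y = Y\<^sup>\<dagger> ** X \<and> inner X Y = 0"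
    if X: "inner X N = 0" "X \<noteq> 0" "T X = l *\<^sub>R X" and Y: "inner Y N = 0" "Y \<noteq> 0" "T Y = \<mu> *\<^sub>R Y"
      and ne: "l \<noteq> \<mu>" for X Y l \<mu>
  proof -
    have XY: "inner X Y = 0"
    proof -
      have "l * inner X Y = \<mu> * inner X Y"
        using sym[of X Y] X(3) Y(3) by simp
      then show ?thesis using ne by simp
    qed
    define e where "e = \<kappa> * l * \<mu>"
    define K where "K U = curv0 X Y U + e *\<^sub>R (inner Y U *\<^sub>R X - inner X U *\<^sub>R Y)" for U
    \<comment> \<open>Commutation applied to \<open>X\<close> and paired with \<open>Y\<close> gives
      \<open>(l - \<mu>) * inner (R U W X) Y = 0\<close>; pair symmetry rewrites the result as a
      statement about \<open>K\<close>.\<close>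
    have inner_K: "inner (K U) W = 0" if U: "inner U N = 0" and W: "inner W N = 0" for U W
    proof -
      obtain c where c: "T (R U W X) = R U W (T X) + c *\<^sub>R N" using comm[OF U W X(1)] by blast
      have "R U W (T X) = l *\<^sub>R R U W X"
        by (simp add: X(3) R curv0_def matrix_mult_scaleR_left matrix_mult_scaleR_right algebra_simps)
      then have "l * inner (R U W X) Y = inner (T (R U W X)) Y"
        using c Y(1) by (simp add: inner_add_left inner_commute[of N])
      also have "\<dots> = \<mu> * inner (R U W X) Y"
        using sym Y(3) by simp
      finally have "inner (R U W X) Y = 0" using ne by simp
      moreover have "inner (T U) X = l * inner U X" "inner (T W) X = l * inner W X"
        "inner (T U) Y = \<mu> * inner U Y" "inner (T W) Y = \<mu> * inner W Y"
        using sym X Y by simp_all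
      ultimately have "inner (curv0 X Y U) W + e * (inner W X * inner U Y - inner U X * inner W Y) = 0"
        by (simp add: R inner_add_left inner_diff_left e_def curv0_pair_symmetry[of U] algebra_simps)
      then show ?thesis
        by (simp add: K_def inner_add_left inner_diff_left inner_commute[of _ X] inner_commute[of _ Y]
            algebra_simps)
    qed
    have K: "\<exists>c. K U = c *\<^sub>R N" if U: "inner U N = 0" for U
    proof -
      define c where "c = inner (K U) N / inner N N"
      have W: "inner (K U - c *\<^sub>R N) N = 0" using N by (simp add: c_def inner_diff_left)
      have "inner (K U - c *\<^sub>R N) (K U - c *\<^sub>R N)
          = inner (K U) (K U - c *\<^sub>R N) - c * inner (K U - c *\<^sub>R N) N"
        by (simp only: inner_diff_left[of "K U" "c *\<^sub>R N" "K U - c *\<^sub>R N"] inner_scaleR_left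
            inner_commute[of N "K U - c *\<^sub>R N"])
      also have "\<dots> = 0" using inner_K[OF U W] W by simp
      finally have "inner (K U - c *\<^sub>R N) (K U - c *\<^sub>R N) = 0" .
      then show ?thesis by (intro exI[of _ c]) simp
    qed
    \<comment> \<open>\<open>K\<close> maps vectors orthogonal to \<open>N\<close> to multiples of
      \<open>N\<close>, but \<open>K N\<close> itself is uncontrolled and must be a generator of its
      own.\<close>
    define F where "F = span {X, Y, N, K N}"
    have inF: "X \<in> F" "Y \<in> F" "N \<in> F" "K N \<in> F" by (auto simp: F_def span_base)
    have F: "subspace F" by (simp add: F_def)
    have "dim F \<le> card {X, Y, N, K N}" by (simp add: F_def dim_le_card')
    also have "\<dots> \<le> 4" by (simp add: card_insert_if)
    finally have dimF: "dim F \<le> 4" .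
    have "curv0 X Y Z \<in> F" for Z
    proof -
      define c where "c = inner Z N / inner N N"
      have "inner (Z - c *\<^sub>R N) N = 0" using N by (simp add: c_def inner_diff_left)
      then obtain d where d: "K (Z - c *\<^sub>R N) = d *\<^sub>R N" using K by blast
      have "K Z = K (Z - c *\<^sub>R N) + c *\<^sub>R K N"
        by (simp add: K_def curv0_def matrix_distribs inner_diff_right algebra_simps)
      then have "K Z \<in> F" using d inF F by (simp add: subspace_add subspace_scale)
      then have "K Z - e *\<^sub>R (inner Y Z *\<^sub>R X - inner X Z *\<^sub>R Y) \<in> F"
        using inF F by (simp add: subspace_diff subspace_scale)
      then show ?thesis by (simp add: K_def)
    qed
    then have herm: "X ** Y\<^sup>\<dagger> = Y ** X\<^sup>\<dagger>" "X\<^sup>\<dagger> ** Y = Y\<^sup>\<dagger> ** X"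
      using curv0_small_range[OF m F dimF inF(1,2)] by blast+
    then have "curv0 X Y U = 0" for U by (simp add: curv0_conv)
    \<comment> \<open>With the curvature term gone, \<open>K X\<close> is \<open>- e\<close> times
      the squared norm of \<open>X\<close> times \<open>Y\<close>. It is a multiple of
      \<open>N\<close>, so pairing with \<open>Y\<close> forces \<open>e = 0\<close>.\<close>
    then obtain c where c: "e *\<^sub>R (inner Y X *\<^sub>R X - inner X X *\<^sub>R Y) = c *\<^sub>R N"
      using K[OF X(1)] by (auto simp: K_def)
    have "- e * inner X X * inner Y Y = c * inner N Y"
      using arg_cong[OF c, of "\<lambda>Z. inner Z Y"] XY by (simp add: inner_diff_left inner_commute)
    then have "e = 0" using X Y by (simp add: inner_commute[of N])
    then have "l * \<mu> = 0" using \<kappa> by (simp add: e_def)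
    with herm XY show ?thesis by blast
  qed
  obtain x0 where "inner x0 N = 0" "T x0 \<noteq> 0 *\<^sub>R x0" using not_umbilic by blast
  then have x0: "x0 \<in> ?V" "T x0 \<noteq> 0" by simp_all
  obtain l x1 where l: "l \<noteq> 0" and x1: "x1 \<in> ?V" "x1 \<noteq> 0" "T x1 = l *\<^sub>R x1"
    and split: "\<And>x. x \<in> ?V \<Longrightarrow> \<exists>y\<in>?V. \<exists>z\<in>?V. x = y + z \<and> T y = l *\<^sub>R y \<and> T z = 0"
    using selfadjoint_two_eigenspaces[OF T V _ sym _ x0] main TV by (smt (verit) mem_Collect_eq)
  let ?P = "{x\<in>?V. T x = l *\<^sub>R x}" and ?Q = "{x\<in>?V. T x = 0}"
  have PQ: "X ** Y\<^sup>\<dagger> = Y ** X\<^sup>\<dagger> \<and> X\<^sup>\<dagger> ** Y = Y\<^sup>\<dagger> ** X \<and> inner X Y = 0" if "X \<in> ?P" "Y \<in> ?Q" for X Y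
  proof (cases "X = 0 \<or> Y = 0")
    case True
    then show ?thesis by auto
  next
    case False
    then show ?thesis using main[of X l Y 0] that l by auto
  qed
  have "?P \<subseteq> {0} \<or> ?Q \<subseteq> {0}"
  proof (rule commuting_splitting_trivial[OF _ _ N])
    show "subspace ?P" "subspace ?Q"
      using V by (auto simp: subspace_def linear_add[OF T] linear_scale[OF T] linear_0[OF T] algebra_simps)
    show "\<exists>X\<in>?P. \<exists>Y\<in>?Q. Z = X + Y" if "inner Z N = 0" for Z
      using split[of Z] that by blast
    show "inner X N = 0" if "X \<in> ?P \<union> ?Q" for X using that by blast
    show "inner X Y = 0" if "X \<in> ?P" "Y \<in> ?Q" for X Y using PQ[OF that] by blast
    show "X ** Y\<^sup>\<dagger> = Y ** X\<^sup>\<dagger> \<and> X\<^sup>\<dagger> ** Y = Y\<^sup>\<dagger> ** X" if "X \<in> ?P" "Y \<in> ?Q" for X Y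
      using PQ[OF that] by blast
  qed
  then have "?Q \<subseteq> {0}" using x1 by auto
  then have "T x = l *\<^sub>R x" if "inner x N = 0" for x
    using split[of x] that by auto
  with not_umbilic show False by blast
qed

text \<open>The test pair is \<J> \<open>N\<close> and \<open>Y = outer q v\<close>, with
  \<open>q\<close> orthogonal to the columns of \<open>N\<close> and \<open>v\<close> a nonzero row
  of \<open>N\<close>. All but one term of the curvature vanish, leaving \<J>
  \<open>(Y ** (N\<^sup>\<dagger> ** N))\<close>. If this were a combination of the pair, then
  pairing with \<open>Y\<close> twice would give \<open>Y ** N\<^sup>\<dagger> = 0\<close>, contrary
  to the choice of \<open>v\<close>.\<close>

lemma not_umbilic_codazzi:
  fixes N :: "complex^2^'m"
  assumes m: "CARD('m) \<ge> 3" and N: "N \<noteq> 0"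
    and curv: "\<And>X Y. inner X N = 0 \<Longrightarrow> inner Y N = 0 \<Longrightarrow> \<exists>c d. curv0 X Y N = c *\<^sub>R X + d *\<^sub>R Y"
  shows False
proof -
  obtain i0 l0 where il: "N $ i0 $ l0 \<noteq> 0" using N by (auto simp: vec_eq_iff)
  define col where "col l = (\<chi> i. N $ i $ l)" for l
  \<comment> \<open>Two labels for the two columns of \<open>N\<close>. They do not exhaust the
    indices since m \<ge> 3, which leaves room for \<open>q\<close>.\<close>
  obtain i1 i2 :: 'm where i12: "i1 \<noteq> i2"
    using m card_le_Suc0_iff_eq[of "UNIV :: 'm set"] by auto
  have "{i1, i2} \<noteq> UNIV"
  proof
    assume "{i1, i2} = UNIV"
    then have "CARD('m) \<le> 2" by (metis card_2_iff i12 order_refl)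
    then show False using m by simp
  qed
  then obtain q where q: "hinner q q = 1" and "\<forall>i\<in>{i1,i2}. hinner q (if i = i1 then col 1 else col 2) = 0"
    using exists_unit_horthogonal[of "{i1, i2}" "\<lambda>i. if i = i1 then col 1 else col 2"] by blast
  then have q12: "hinner q (col 1) = 0" "hinner q (col 2) = 0" using i12 by auto
  then have qcol: "hinner q (col l) = 0" for l by (metis exhaust_2)
  define v where "v = N $ i0"
  define Y where "Y = outer q v"
  have NY: "N\<^sup>\<dagger> ** Y = 0"
  proof -
    have "(N\<^sup>\<dagger> ** Y) $ l $ k = hinner q (col l) * v $ k" for l k
      by (simp add: Y_def matrix_matrix_mult_def hinner_def col_def sum_distrib_left sum_distrib_right mult_ac)
    then show ?thesis by (simp add: vec_eq_iff qcol)
  qed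
  have YN: "Y\<^sup>\<dagger> ** N = 0"
    using arg_cong[OF NY, of conj_transpose] by (simp add: conj_transpose_mult)
  have iY: "inner Y N = 0" by (simp add: Re_trace_conj_transpose_mult[symmetric] YN trace_def)
  have "inner (\<J> N) N = 0" by simp
  then obtain c d where cd: "curv0 (\<J> N) Y N = c *\<^sub>R \<J> N + d *\<^sub>R Y"
    using curv iY by blast
  have "curv0 (\<J> N) Y N = \<J> (Y ** (N\<^sup>\<dagger> ** N))"
  proof -
    have YJN: "Y\<^sup>\<dagger> ** \<J> N = 0" and JNY: "(\<J> N)\<^sup>\<dagger> ** Y = 0"
    proof -
      have "(Y\<^sup>\<dagger> ** \<J> N) = (\<chi> k l. \<i> * (Y\<^sup>\<dagger> ** N) $ k $ l)"
        by (simp add: vec_eq_iff matrix_matrix_mult_def[of "Y\<^sup>\<dagger>"] sum_distrib_left mult_ac)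
      then show YJN: "Y\<^sup>\<dagger> ** \<J> N = 0" by (simp add: YN vec_eq_iff)
      show "(\<J> N)\<^sup>\<dagger> ** Y = 0"
        using arg_cong[OF YJN, of conj_transpose] by (simp add: conj_transpose_mult)
    qed
    have "curv0 (\<J> N) Y N = - (Y ** (\<J> N)\<^sup>\<dagger> ** N)"
      by (simp add: curv0_def YJN JNY YN matrix_mul_assoc[symmetric])
    also have "Y ** (\<J> N)\<^sup>\<dagger> = - \<J> (Y ** N\<^sup>\<dagger>)"
      by (simp add: vec_eq_iff matrix_matrix_mult_def[of Y] mat_matrix_mult sum_distrib_left sum_negf mult_ac)
    also have "- (- \<J> (Y ** N\<^sup>\<dagger>) ** N) = \<J> (Y ** (N\<^sup>\<dagger> ** N))"
      by (simp add: matrix_mult_minus_left matrix_mul_assoc)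
    finally show ?thesis .
  qed
  then have eq: "\<J> (Y ** (N\<^sup>\<dagger> ** N)) = c *\<^sub>R \<J> N + d *\<^sub>R Y" using cd by simp
  have YJ: "inner (\<J> (Y ** (N\<^sup>\<dagger> ** N))) Y = 0"
  proof -
    have "inner (\<J> (Y ** (N\<^sup>\<dagger> ** N))) Y = inner (\<J> (Y ** N\<^sup>\<dagger>)) (Y ** N\<^sup>\<dagger>)"
      by (simp add: matrix_mul_assoc inner_matrix_mult_right[of _ N] )
    then show ?thesis by (simp add: inner_left_i_self)
  qed
  have JNY: "inner (\<J> N) Y = 0"
  proof -
    have "\<J> N \<bullet> Y = - Re (trace (N\<^sup>\<dagger> ** \<J> Y))"
      by (simp add: inner_left_i Re_trace_conj_transpose_mult)
    also have "N\<^sup>\<dagger> ** \<J> Y = (\<chi> k l. \<i> * (N\<^sup>\<dagger> ** Y) $ k $ l)"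
      by (simp add: vec_eq_iff matrix_matrix_mult_def[of "N\<^sup>\<dagger>"] sum_distrib_left mult_ac)
    finally show ?thesis by (simp add: NY trace_def)
  qed
  have "q \<noteq> 0" using q by auto
  then have Y0: "Y \<noteq> 0"
    using il by (auto simp: Y_def outer_eq_0_iff v_def vec_eq_iff)
  have "d = 0"
    using arg_cong[OF eq, of "\<lambda>Z. inner Z Y"] YJ JNY Y0 by (simp add: inner_add_left)
  then have "\<J> (Y ** (N\<^sup>\<dagger> ** N)) = \<J> (c *\<^sub>R N)" using eq by (simp add: matrix_mult_scaleR_right)
  then have YNN: "Y ** (N\<^sup>\<dagger> ** N) = c *\<^sub>R N"
    using left_i_left_i by (metis minus_minus)
  have "inner (Y ** N\<^sup>\<dagger>) (Y ** N\<^sup>\<dagger>) = inner (Y ** (N\<^sup>\<dagger> ** N)) Y"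
    by (simp add: matrix_mul_assoc inner_matrix_mult_right[of _ N])
  also have "\<dots> = 0" by (simp add: YNN inner_commute[of N] iY)
  finally have YN0: "Y ** N\<^sup>\<dagger> = 0" by simp
  have "(Y ** N\<^sup>\<dagger>) $ i $ i0 = q $ i * hinner v v" for i
    by (simp add: Y_def matrix_matrix_mult_def hinner_def v_def sum_distrib_left mult_ac)
  then have "q $ i * hinner v v = 0" for i using YN0 by simp
  moreover have "v \<noteq> 0" using il by (auto simp: v_def vec_eq_iff)
  then have "hinner v v \<noteq> 0" by simp
  ultimately have "q $ i = 0" for i by (metis mult_eq_0_iff)
  then have "q = 0" by (simp add: vec_eq_iff)
  then show False using q by simp
qed

subsection \<open>Semi-parallel hypersurfaces\<close>

context immersed_hypersurface
begin

text \<open>\<Theta> is injective because it preserves the positive form \<open>G\<close> up to a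
  factor, so it carries the tangent space onto the orthogonal complement of the image of the
  normal.\<close>

lemma tangent_model:
  fixes \<Theta> :: "'b \<Rightarrow> complex^2^'m"
  assumes x: "x \<in> U" and \<Theta>: "linear \<Theta>" "surj \<Theta>"
    and metric: "\<And>u v. G (h x) u v = inner (\<Theta> u) (\<Theta> v) / 2"
  shows "inner X (\<Theta> (n x)) = 0 \<longleftrightarrow> (\<exists>u. X = \<Theta> (\<partial> h u x))"
proof -
  obtain X' where X': "X = \<Theta> X'" using \<Theta>(2) by blast
  have inj_\<Theta>: "X' = Y" if "\<Theta> X' = \<Theta> Y" for Y
  proof -
    have "G (h x) (X' - Y) (X' - Y) = 0" using that by (simp add: metric linear_diff[OF \<Theta>(1)])
    then show ?thesis by (simp add: G_eq_0_iff)
  qed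
  have "inner X (\<Theta> (n x)) = 0 \<longleftrightarrow> G (h x) (n x) X' = 0"
    by (simp add: metric X' inner_commute)
  also have "\<dots> \<longleftrightarrow> (\<exists>u. X' = \<partial> h u x)" using tangent_iff[OF x] by simp
  also have "\<dots> \<longleftrightarrow> (\<exists>u. X = \<Theta> (\<partial> h u x))" using X' inj_\<Theta> by metis
  finally show ?thesis .
qed

text \<open>Transports the shape operator at one point to the matrix model and extends it by zero
  along the normal. The extension \<open>T\<close> stays self-adjoint and annihilates the unknown
  normal terms of the Gauss equation.\<close>

lemma semi_parallel_imp_umbilic:
  fixes \<Theta> :: "'b \<Rightarrow> complex^2^'m"
  assumes m: "CARD('m) \<ge> 3" and x: "x \<in> U" and \<Theta>: "linear \<Theta>" "surj \<Theta>"
    and metric: "\<And>u v. G (h x) u v = inner (\<Theta> u) (\<Theta> v) / 2"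
    and curv: "\<And>u v w. \<Theta> (riem (h x) u v w) = curv0 (\<Theta> u) (\<Theta> v) (\<Theta> w)"
    and semi: "\<And>u v w. riemann_curvature g x u v (shape x w) = shape x (riemann_curvature g x u v w)"
  shows "\<exists>l. \<forall>u. shape x u = l *\<^sub>R u"
proof -
  define N where "N = \<Theta> (n x)"
  define \<Phi> where "\<Phi> u = \<Theta> (\<partial> h u x)" for u
  have NN: "inner N N = 2" using n_unit[OF x] by (simp add: metric N_def)
  then have N0: "N \<noteq> 0" by auto
  have \<Phi>: "linear \<Phi>"
    using linear_compose[OF linear_dh[OF x] \<Theta>(1)] by (simp add: \<Phi>_def[abs_def] o_def)
  have g\<Phi>: "inner (\<Phi> u) (\<Phi> v) = 2 * g x u v" for u v by (simp add: g[OF x] metric \<Phi>_def)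
  have \<Phi>N: "inner X N = 0 \<longleftrightarrow> (\<exists>u. X = \<Phi> u)" for X
    unfolding N_def \<Phi>_def by (rule tangent_model[OF x \<Theta> metric])
  have inj: "inj \<Phi>"
    unfolding linear_injective_0[OF \<Phi>]
  proof (intro allI impI)
    fix u assume "\<Phi> u = 0"
    then have "g x u u = 0" using g\<Phi>[of u u] by simp
    then have "\<partial> h u x = \<partial> h 0 x" by (simp add: g[OF x] G_eq_0_iff linear_0[OF linear_dh[OF x]])
    then show "u = 0" using dh_eq_iff[OF x] by blast
  qed
  obtain L where L: "linear L" "L \<circ> \<Phi> = id" using linear_injective_left_inverse[OF \<Phi> inj] by blast
  \<comment> \<open>Orthogonal projection to the tangent space; the 2 is the squared norm of
    \<open>N\<close>, caused by the factor 1/2 in the metric.\<close>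
  define P where "P X = X - (inner X N / 2) *\<^sub>R N" for X
  have P: "linear P" by (intro linearI) (simp_all add: P_def inner_add_left add_divide_distrib algebra_simps)
  define T where "T X = \<Phi> (shape x (L (P X)))" for X
  have T: "linear T"
    using linear_compose[OF linear_compose[OF linear_compose[OF P L(1)] linear_shape[OF x]] \<Phi>]
    by (simp add: T_def[abs_def] o_def)
  have TN: "T N = 0"
    by (simp add: T_def P_def NN linear_0[OF L(1)] linear_0[OF linear_shape[OF x]] linear_0[OF \<Phi>])
  have T\<Phi>: "T (\<Phi> u) = \<Phi> (shape x u)" for u
  proof -
    have "P (\<Phi> u) = \<Phi> u" using \<Phi>N[of "\<Phi> u"] by (auto simp: P_def)
    moreover have "L (\<Phi> u) = u" using L(2) by (simp add: fun_eq_iff)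
    ultimately show ?thesis by (simp add: T_def)
  qed
  have decomp: "\<exists>u s. X = \<Phi> u + s *\<^sub>R N" for X
  proof -
    have "inner (P X) N = 0" by (simp add: P_def inner_diff_left NN)
    then obtain u where "P X = \<Phi> u" using \<Phi>N by blast
    then have "X = \<Phi> u + (inner X N / 2) *\<^sub>R N" by (simp add: P_def algebra_simps)
    then show ?thesis by blast
  qed
  have \<Phi>N0: "inner (\<Phi> u) N = 0" "inner N (\<Phi> u) = 0" for u
  proof -
    show "inner (\<Phi> u) N = 0" using \<Phi>N by blast
    then show "inner N (\<Phi> u) = 0" by (subst inner_commute)
  qed
  have sym: "inner (T X) Y = inner X (T Y)" for X Y
  proof -
    obtain u s v t where "X = \<Phi> u + s *\<^sub>R N" "Y = \<Phi> v + t *\<^sub>R N" using decomp by metis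
    then show ?thesis
      using shape_symmetric[OF x, of u v]
      by (simp add: linear_add[OF T] linear_scale[OF T] TN T\<Phi> inner_add_left inner_add_right \<Phi>N0 g\<Phi>)
  qed
  \<comment> \<open>The coefficient 1/2 rewrites \<open>g\<close> in the Gauss equation as half the
    inner product of the model.\<close>
  define R where "R X Y Z = curv0 X Y Z + (1/2) *\<^sub>R (inner (T Y) Z *\<^sub>R T X - inner (T X) Z *\<^sub>R T Y)" for X Y Z
  have R: "\<exists>c. \<Phi> (riemann_curvature g x u v w) = R (\<Phi> u) (\<Phi> v) (\<Phi> w) + c *\<^sub>R N" for u v w
  proof -
    obtain c where c: "\<partial> h (riemann_curvature g x u v w) x = riem (h x) (\<partial> h u x) (\<partial> h v x) (\<partial> h w x)
      + g x (shape x v) w *\<^sub>R \<partial> h (shape x u) x - g x (shape x u) w *\<^sub>R \<partial> h (shape x v) x + c *\<^sub>R n x"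
      using gauss_equation[OF x] by blast
    have "\<Phi> (riemann_curvature g x u v w) = R (\<Phi> u) (\<Phi> v) (\<Phi> w) + c *\<^sub>R N"
      unfolding R_def T\<Phi> g\<Phi> unfolding \<Phi>_def c N_def
      by (simp add: linear_add[OF \<Theta>(1)] linear_diff[OF \<Theta>(1)] linear_scale[OF \<Theta>(1)] curv algebra_simps)
    then show ?thesis by blast
  qed
  have "\<exists>l. \<forall>X. inner X N = 0 \<longrightarrow> T X = l *\<^sub>R X"
  proof (rule semi_parallel_point_umbilic[OF m N0 _ T TN sym _ R_def])
    fix X Y Z assume XYZ: "inner X N = 0" "inner Y N = 0" "inner Z N = 0"
    obtain u where u: "X = \<Phi> u" using \<Phi>N XYZ(1) by blast
    obtain v where v: "Y = \<Phi> v" using \<Phi>N XYZ(2) by blast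
    obtain w where w: "Z = \<Phi> w" using \<Phi>N XYZ(3) by blast
    obtain c where c: "\<Phi> (riemann_curvature g x u v w) = R X Y Z + c *\<^sub>R N" using R u v w by blast
    obtain d where d: "\<Phi> (riemann_curvature g x u v (shape x w)) = R X Y (T Z) + d *\<^sub>R N"
      using R u v w T\<Phi> by metis
    have "T (R X Y Z) = T (R X Y Z + c *\<^sub>R N)" by (simp add: linear_add[OF T] linear_scale[OF T] TN)
    also have "\<dots> = \<Phi> (shape x (riemann_curvature g x u v w))" unfolding c[symmetric] by (rule T\<Phi>)
    also have "\<dots> = R X Y (T Z) + d *\<^sub>R N" unfolding semi[symmetric] by (rule d)
    finally show "\<exists>c. T (R X Y Z) = R X Y (T Z) + c *\<^sub>R N" by blast
  qed simp
  then obtain l where l: "\<And>X. inner X N = 0 \<Longrightarrow> T X = l *\<^sub>R X" by blast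
  have "shape x u = l *\<^sub>R u" for u
  proof -
    have "\<Phi> (shape x u) = \<Phi> (l *\<^sub>R u)" using l[OF \<Phi>N0(1)[of u]] by (simp add: T\<Phi> linear_scale[OF \<Phi>])
    then show ?thesis using inj by (simp add: inj_eq)
  qed
  then show ?thesis by blast
qed

text \<open>Umbilicity is obtained point by point with a separate \<Theta> for each point, while the
  Codazzi step differentiates the resulting function \<open>l\<close> and so needs umbilicity on the
  whole open set \<open>U\<close>.\<close>

lemma no_semi_parallel:
  assumes m: "CARD('m) \<ge> 3" and ne: "U \<noteq> {}"
    and model: "\<And>z. \<exists>\<Theta> :: 'b \<Rightarrow> complex^2^'m. linear \<Theta> \<and> surj \<Theta> \<and>
      (\<forall>u v. G z u v = inner (\<Theta> u) (\<Theta> v) / 2) \<and>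
      (\<forall>u v w. \<Theta> (riem z u v w) = curv0 (\<Theta> u) (\<Theta> v) (\<Theta> w))"
    and semi: "\<And>x u v w. x \<in> U \<Longrightarrow>
      riemann_curvature g x u v (shape x w) = shape x (riemann_curvature g x u v w)"
  shows False
proof -
  have "\<exists>l. \<forall>u. shape y u = l *\<^sub>R u" if y: "y \<in> U" for y
  proof -
    obtain \<Theta> :: "'b \<Rightarrow> complex^2^'m" where "linear \<Theta>" "surj \<Theta>"
      "\<And>u v. G (h y) u v = inner (\<Theta> u) (\<Theta> v) / 2"
      "\<And>u v w. \<Theta> (riem (h y) u v w) = curv0 (\<Theta> u) (\<Theta> v) (\<Theta> w)" using model by metis
    then show ?thesis by (rule semi_parallel_imp_umbilic[OF m y _ _ _ _ semi[OF y]])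
  qed
  then obtain l where l: "\<And>y u. y \<in> U \<Longrightarrow> shape y u = l y *\<^sub>R u" by metis
  obtain x where x: "x \<in> U" using ne by blast
  obtain \<Theta> :: "'b \<Rightarrow> complex^2^'m" where \<Theta>: "linear \<Theta>" "surj \<Theta>"
    and metric: "\<And>u v. G (h x) u v = inner (\<Theta> u) (\<Theta> v) / 2"
    and curv: "\<And>u v w. \<Theta> (riem (h x) u v w) = curv0 (\<Theta> u) (\<Theta> v) (\<Theta> w)" using model by metis
  have N: "\<Theta> (n x) \<noteq> 0" using n_unit[OF x] metric[of "n x" "n x"] by auto
  show False
  proof (rule not_umbilic_codazzi[OF m N])
    fix X Y assume XY: "inner X (\<Theta> (n x)) = 0" "inner Y (\<Theta> (n x)) = 0"
    obtain u where u: "X = \<Theta> (\<partial> h u x)" using tangent_model[OF x \<Theta> metric] XY(1) by blast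
    obtain v where v: "Y = \<Theta> (\<partial> h v x)" using tangent_model[OF x \<Theta> metric] XY(2) by blast
    obtain c d where "riem (h x) (\<partial> h u x) (\<partial> h v x) (n x) = c *\<^sub>R \<partial> h u x + d *\<^sub>R \<partial> h v x"
      using codazzi_umbilic[OF x l] by blast
    then have "curv0 X Y (\<Theta> (n x)) = \<Theta> (c *\<^sub>R \<partial> h u x + d *\<^sub>R \<partial> h v x)"
      unfolding u v curv[symmetric] by simp
    then show "\<exists>c d. curv0 X Y (\<Theta> (n x)) = c *\<^sub>R X + d *\<^sub>R Y"
      unfolding u v by (auto simp: linear_add[OF \<Theta>(1)] linear_scale[OF \<Theta>(1)])
  qed
qed

end

text \<open>Each \<K> becomes \<open>b ** b\<^sup>\<dagger>\<close> and each \<S> becomes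
  \<open>a\<^sup>\<dagger> ** a\<close>, so the factors distribute over the three arguments of the
  curvature, and \<Theta> \<open>X = a ** X ** b\<close> absorbs them.\<close>

lemma G2_model:
  fixes Z :: "complex^2^'m"
  assumes BC: "unitary_frame (B :: complex^2^'n) (C :: complex^'m^'n)" and card: "CARD('n) = CARD('m) + 2"
  shows "\<exists>\<Theta> :: complex^2^'m \<Rightarrow> complex^2^'m. linear \<Theta> \<and> surj \<Theta> \<and>
    (\<forall>u v. G2_G Z u v = inner (\<Theta> u) (\<Theta> v) / 2) \<and>
    (\<forall>u v w. \<Theta> (G2.riem Z u v w) = curv0 (\<Theta> u) (\<Theta> v) (\<Theta> w))"
proof -
  have "G2_param B C Z \<in> G2"
    unfolding G2_param_eq by (intro range_in_G2 inj_matrix_left_inverse[OF unitary_frame_simps(6)[OF BC]])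
  then obtain B' and C' :: "complex^'m^'n" where "unitary_frame B' C'" "range ((*v) B') = G2_param B C Z"
    using adapted_unitary_frame[OF _ card] by blast
  from adapted_frame_factor[OF BC this] obtain a :: "complex^'m^'m" and b :: "complex^2^2" and a' b'
    where S: "\<S> Z = a\<^sup>\<dagger> ** a" and K: "\<K> Z = b ** b\<^sup>\<dagger>"
    and a': "a ** a' = mat 1" and b': "b' ** b = mat 1" by blast
  define \<Theta> where "\<Theta> X = a ** X ** b" for X :: "complex^2^'m"
  show ?thesis
  proof (intro exI[of _ \<Theta>] conjI allI)
    show "linear \<Theta>" by (intro linearI) (simp_all add: \<Theta>_def matrix_distribs)
    have "\<Theta> (a' ** X ** b') = X" for X
    proof -
      have "\<Theta> (a' ** X ** b') = (a ** a') ** X ** (b' ** b)" by (simp add: \<Theta>_def matrix_mul_assoc)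
      then show ?thesis by (simp add: a' b')
    qed
    then show "surj \<Theta>" by (rule surjI)
    show "G2_G Z u v = inner (\<Theta> u) (\<Theta> v) / 2" for u v
      using inner_matrix_mult_right[of "a ** u" b "a ** v ** b"] inner_matrix_mult_left[of a u "a ** v ** b ** b\<^sup>\<dagger>"]
      by (simp add: G2_G_def S K \<Theta>_def matrix_mul_assoc)
    show "\<Theta> (G2.riem Z u v w) = curv0 (\<Theta> u) (\<Theta> v) (\<Theta> w)" for u v w
      by (simp add: G2_riem S K \<Theta>_def curv0_def conj_transpose_mult matrix_distribs matrix_mul_assoc)
  qed
qed

theorem theorem3:
  fixes m :: nat
  assumes "m \<ge> 3"
    and "CARD('m::finite) = m" and "CARD('n::finite) = m + 2" and "CARD('d::finite) = 4 * m - 1"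
  shows "\<not> (\<exists>(M :: 'p topology) (\<A> :: ('p, real^'d) chart set) g
      (f :: 'p \<Rightarrow> (complex^'n) set)
      (N :: ((complex^'n) set, complex^2^'m) chart \<Rightarrow> 'p \<Rightarrow> complex^2^'m).
      real_hypersurface_G2 M \<A> g f N \<and> semi_parallel \<A> g G2_atlas G2_metric f N)"
proof
  assume "\<exists>(M :: 'p topology) (\<A> :: ('p, real^'d) chart set) g (f :: 'p \<Rightarrow> (complex^'n) set)
      (N :: ((complex^'n) set, complex^2^'m) chart \<Rightarrow> 'p \<Rightarrow> complex^2^'m).
      real_hypersurface_G2 M \<A> g f N \<and> semi_parallel \<A> g G2_atlas G2_metric f N"
  then obtain M :: "'p topology" and \<A> :: "('p, real^'d) chart set" and g
      and f :: "'p \<Rightarrow> (complex^'n) set"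
      and N :: "((complex^'n) set, complex^2^'m) chart \<Rightarrow> 'p \<Rightarrow> complex^2^'m"
    where hyp: "real_hypersurface_G2 M \<A> g f N" and semi: "semi_parallel \<A> g G2_atlas G2_metric f N"
    by blast
  have card: "CARD('n) = CARD('m) + 2" using assms by simp
  have man: "smooth_manifold M \<A>" and ne: "topspace M \<noteq> {}"
    and iso: "isometric_immersion M \<A> g G2_topology
      (G2_atlas :: ((complex^'n) set, complex^2^'m) chart set) G2_metric f"
    and nor: "unit_normal_field M \<A> (G2_atlas :: ((complex^'n) set, complex^2^'m) chart set) G2_metric f N"
    using hyp by (auto simp: real_hypersurface_G2_def)
  obtain p where p: "p \<in> topspace M" using ne by blast
  obtain c where c: "c \<in> \<A>" "p \<in> fst c" using man p unfolding smooth_manifold_def by blast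
  have cont: "continuous_map M G2_topology f"
    using iso by (simp add: isometric_immersion_def smooth_immersion_def)
  have "f p \<in> topspace G2_topology" using continuous_map_image_subset_topspace[OF cont] p by blast
  then have "f p \<in> G2" by (simp add: G2_topology_def topspace_pullback_topology)
  \<comment> \<open>The frame is centred at \<open>f p\<close>, so that the chart it defines
    contains \<open>f p\<close> as the point with coordinate 0.\<close>
  then obtain B and C :: "complex^'m^'n" where BC: "unitary_frame B C" and B: "range ((*v) B) = f p"
    using adapted_unitary_frame[OF _ card] by blast
  define d where "d = (range (G2_param B C), inv (G2_param B C))"
  have d: "d \<in> (G2_atlas :: ((complex^'n) set, complex^2^'m) chart set)"
    using complementary_unitary[OF BC] by (auto simp: d_def G2_atlas_def)
  have G: "G2_metric d = G2_G" unfolding d_def by (rule G2_metric_eq[OF BC])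
  have fp: "f p \<in> fst d"
  proof -
    have "G2_param B C 0 = f p" by (simp add: G2_param_eq B)
    then show ?thesis unfolding d_def by (metis fst_conv rangeI)
  qed
  let ?U = "coord_dom c d f" and ?h = "coord_map c d f" and ?n = "field_coord c d N"
  have "snd c p \<in> ?U" using c fp by (auto simp: coord_dom_def)
  then have U_ne: "?U \<noteq> {}" by blast
  have "openin M (fst c \<inter> f -` fst d)"
  proof -
    have cM: "openin M (fst c)" using man c by (simp add: smooth_manifold_def)
    have "openin M {x \<in> topspace M. f x \<in> fst d}"
      using openin_continuous_map_preimage[OF cont] openin_G2_chart[OF BC card] by (simp add: d_def)
    then have "openin M (fst c \<inter> {x \<in> topspace M. f x \<in> fst d})" using cM by blast
    moreover have "fst c \<inter> {x \<in> topspace M. f x \<in> fst d} = fst c \<inter> f -` fst d"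
      using openin_subset[OF cM] by auto
    ultimately show ?thesis by simp
  qed
  then have "openin (subtopology M (fst c)) (fst c \<inter> f -` fst d)"
    by (simp add: openin_subtopology_Int2 openin_subtopology) blast
  moreover have "homeomorphic_map (subtopology M (fst c)) (top_of_set (snd c ` fst c)) (snd c)"
    and open_c: "open (snd c ` fst c)"
    using man c by (auto simp: smooth_manifold_def)
  ultimately have "openin (top_of_set (snd c ` fst c)) ?U"
    unfolding coord_dom_def using homeomorphic_imp_open_map open_map_def by blast
  then have U: "open ?U" using open_c openin_open_trans by blast
  have imm: "smooth_on ?U ?h" "x \<in> ?U \<Longrightarrow> inj (frechet_derivative ?h (at x))"
    "x \<in> ?U \<Longrightarrow> g c x u v = G2_G (?h x) (frechet_derivative ?h (at x) u) (frechet_derivative ?h (at x) v)" for x u v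
    using iso c d by (auto simp: isometric_immersion_def smooth_immersion_def G[symmetric])
  have n: "smooth_on ?U ?n" "x \<in> ?U \<Longrightarrow> G2_G (?h x) (?n x) (?n x) = 1"
    "x \<in> ?U \<Longrightarrow> G2_G (?h x) (?n x) (frechet_derivative ?h (at x) u) = 0" for x u
    using nor c d by (auto simp: unit_normal_field_def smooth_field_along_def G[symmetric])
  interpret immersed_hypersurface G2_G G2_Gamma D_G2_Gamma ?U ?h ?n "g c"
  proof
    \<comment> \<open>The real dimension is \<open>4 * m\<close>; the truncated subtraction in
      \<open>4 * m - 1\<close> is harmless because m \<ge> 3.\<close>
    show "DIM(complex^2^'m) = CARD('d) + 1" using assms by simp
  qed (use U imm n in auto)
  have shape: "shape_operator G2_metric f N c d x u = shape x u" for x u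
    by (simp add: shape_operator_def shape_def G)
  show False
  proof (rule no_semi_parallel[where 'm='m, OF _ U_ne G2_model[OF BC card]])
    show "CARD('m) \<ge> 3" using assms by simp
    show "riemann_curvature (g c) x u v (shape x w) = shape x (riemann_curvature (g c) x u v w)"
      if "x \<in> ?U" for x u v w
    proof -
      have "riemann_curvature (g c) x u v (shape_operator G2_metric f N c d x w)
          = shape_operator G2_metric f N c d x (riemann_curvature (g c) x u v w)"
        using semi c d that by (simp add: semi_parallel_def)
      then show ?thesis unfolding shape .
    qed
  qed
qed

end
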